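(* Let $\omega$ be a $3$-form on $\mathbb{R}^8$, with associated symmetric bilinear map $S^\omega$ and trace form $B^\omega$. (i) The trace form $B^\omega$ is compatible with the multiplication $S^\omega$ in the following sense: for all $a,b,c\in\mathbb{R}^8$, $$B^\omega(S^\omega(a,b),c)=B^\omega(a,S^\omega(b,c)).$$ (ii) The trace form $B^\omega$ is non-degenerate if and only if $\omega$ is stable.
   Context: A $3$-form $\omega$ on $\mathbb{R}^8$ is stable if its $GL(\mathbb{R}^8)$-orbit is open in $\Lambda^3(\mathbb{R}^8)^*$. Let $I:\mathbb{R}^8\otimes\Lambda^8(\mathbb{R}^8)^*\to\Lambda^7(\mathbb{R}^8)^*$ be the natural isomorphism $I(v\otimes\theta)=v\rfloor\theta$ (contraction). Define the symmetric bilinear map $S^\omega:\mathbb{R}^8\times\mathbb{R}^8\to\mathbb{R}^8\otimes\Lambda^8(\mathbb{R}^8)^*$ by $S^\omega(v,w)=I^{-1}\big((v\rfloor\omega)\wedge(w\rfloor\omega)\wedge\omega\big)$. For $v\in\mathbb{R}^8$ let $L^\omega_v:\mathbb{R}^8\to\mathbb{R}^8\otimes\Lambda^8(\mathbb{R}^8)^*$, $L_v^\omega(w)=S^\omega(v,w)$. The trace form is the symmetric bilinear form $B^\omega(v,w)=\mathrm{Tr}(L^\omega_v\circ L^\omega_w)\in(\Lambda^8(\mathbb{R}^8)^* )^{\otimes 2}$, where maps are extended linearly over the one-dimensional factors $\Lambda^8(\mathbb{R}^8)^*$. In (i) $B^\omega$ is likewise extended linearly to arguments with values in $\mathbb{R}^8\otimes\Lambda^8(\mathbb{R}^8)^*$,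 so both sides lie in $(\Lambda^8(\mathbb{R}^8)^* )^{\otimes 3}$. $B^\omega$ is called non-degenerate if for some $\rho\in\Lambda^8(\mathbb{R}^8)\setminus\{0\}$ the real-valued (reduced trace) form $\langle B^\omega,\rho^2\rangle$ on $\mathbb{R}^8$ is non-degenerate. *)

theory Defs
  imports "HOL-Analysis.Analysis"
begin

text \<open>
  A \<open>k\<close>-form is a function on lists of vectors; to make it unique it is zero on all lists
  of length different from \<open>k\<close>.  The values may lie in a vector space \<open>W\<close>, which
  realises \<open>W \<otimes> \<Lambda>\<^sup>k V\<^sup>*\<close> through
  \<open>w \<otimes> \<theta> = (\<lambda>xs. \<theta> xs *\<^sub>R w)\<close>.  In the same way an element of
  \<open>W \<otimes> \<Lambda>\<^sup>k V\<^sup>* \<otimes> \<Lambda>\<^sup>k V\<^sup>*\<close> is a function of two lists, and so on.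
\<close>

definition alt_forms :: "nat \<Rightarrow> ('v::real_vector list \<Rightarrow> 'w::real_vector) set" where
  "alt_forms k = {\<omega>.
     (\<forall>xs. length xs \<noteq> k \<longrightarrow> \<omega> xs = 0) \<and>
     (\<forall>xs ys. length xs + length ys + 1 = k \<longrightarrow> linear (\<lambda>v. \<omega> (xs @ v # ys))) \<and>
     (\<forall>xs. \<not> distinct xs \<longrightarrow> \<omega> xs = 0)}"

definition interior_prod :: "'v \<Rightarrow> ('v list \<Rightarrow> 'w) \<Rightarrow> 'v list \<Rightarrow> 'w" where
  "interior_prod v \<omega> = (\<lambda>xs. \<omega> (v # xs))"

text \<open>
  The wedge product of a \<open>k\<close>-form and an \<open>l\<close>-form, normalised so that it is the
  sum over \<open>(k, l)\<close>-shuffles.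
\<close>

definition wedge :: "nat \<Rightarrow> nat \<Rightarrow> ('v list \<Rightarrow> real) \<Rightarrow> ('v list \<Rightarrow> real) \<Rightarrow> 'v list \<Rightarrow> real" where
  "wedge k l \<alpha> \<beta> = (\<lambda>xs. if length xs = k + l then
     (\<Sum>p | p permutes {..<k + l}. of_int (sign p) *
        \<alpha> (map (\<lambda>i. xs ! p i) [0..<k]) * \<beta> (map (\<lambda>i. xs ! p i) [k..<k + l]))
       / (fact k * fact l)
     else 0)"

definition GL :: "('v::real_vector \<Rightarrow> 'v) set" where
  "GL = {g. linear g \<and> bij g}"

definition gl_act :: "('v \<Rightarrow> 'v) \<Rightarrow> ('v list \<Rightarrow> real) \<Rightarrow> 'v list \<Rightarrow> real" where
  "gl_act g \<omega> = (\<lambda>xs. \<omega> (map (inv g) xs))"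

text \<open>
  The topology on functions is that of pointwise convergence; on the finite-dimensional
  subspace of 3-forms it induces the standard vector space topology.
\<close>

definition stable3 :: "('v::euclidean_space list \<Rightarrow> real) \<Rightarrow> bool" where
  "stable3 \<omega> \<longleftrightarrow> openin (top_of_set (alt_forms 3)) ((\<lambda>g. gl_act g \<omega>) ` GL)"

text \<open>
  The linear map \<open>V \<otimes> \<Lambda>\<^sup>k V\<^sup>* \<rightarrow> \<Lambda>\<^sup>k\<^sup>-\<^sup>1 V\<^sup>*\<close> determined by
  \<open>v \<otimes> \<theta> \<mapsto> v \<rfloor> \<theta>\<close> (lemma \<open>contract_tensor\<close>).
  It is an isomorphism if \<open>k = dim V\<close>.
\<close>

definition contract :: "((real^'n) list \<Rightarrow> real^'n) \<Rightarrow> (real^'n) list \<Rightarrow> real" where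
  "contract T = (\<lambda>xs. trace (matrix (\<lambda>u. T (u # xs))))"

lemma contract_tensor:
  fixes \<theta> :: "(real^'n) list \<Rightarrow> real"
  assumes "\<theta> \<in> alt_forms k"
  shows "contract (\<lambda>xs. \<theta> xs *\<^sub>R v) = interior_prod v \<theta>"
proof
  fix xs
  show "contract (\<lambda>xs. \<theta> xs *\<^sub>R v) xs = interior_prod v \<theta> xs"
  proof (cases "length xs + 1 = k")
    case True
    then have lin: "linear (\<lambda>u. \<theta> (u # xs))"
      using assms unfolding alt_forms_def
      by (auto dest: spec[of _ "[]"])
    have "\<theta> (v # xs) = \<theta> ((\<Sum>i\<in>UNIV. v $ i *\<^sub>R axis i 1) # xs)"
      using basis_expansion[of v] by (simp add: scalar_mult_eq_scaleR)
    also have "\<dots> = (\<Sum>i\<in>UNIV. v $ i * \<theta> (axis i 1 # xs))"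
      using linear_sum[OF lin, of "\<lambda>i. v $ i *\<^sub>R axis i 1" UNIV]
      by (simp add: linear_scale[OF lin])
    finally show ?thesis
      by (simp add: contract_def interior_prod_def trace_def matrix_def mult.commute)
  next
    case False
    then show ?thesis
      using assms by (simp add: alt_forms_def contract_def interior_prod_def trace_def matrix_def)
  qed
qed

definition S_map :: "((real^8) list \<Rightarrow> real) \<Rightarrow> real^8 \<Rightarrow> real^8 \<Rightarrow> (real^8) list \<Rightarrow> real^8" where
  "S_map \<omega> v w = inv_into (alt_forms 8) contract
     (wedge 4 3 (wedge 2 2 (interior_prod v \<omega>) (interior_prod w \<omega>)) \<omega>)"

text \<open>
  The linear extension of \<open>f : V \<rightarrow> W\<close> to
  \<open>V \<otimes> \<Lambda>\<^sup>8 V\<^sup>* \<rightarrow> W \<otimes> \<Lambda>\<^sup>8 V\<^sup>*\<close>.  The new factor \<open>\<Lambda>\<^sup>8 V\<^sup>*\<close> becomes the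
  first list argument.  Since \<open>\<Lambda>\<^sup>8 V\<^sup>*\<close> is one-dimensional, flipping factors in its
  tensor powers is the identity, so the order of the list arguments does not matter.
\<close>

definition extend :: "('v \<Rightarrow> 'w) \<Rightarrow> ('v list \<Rightarrow> 'v) \<Rightarrow> 'v list \<Rightarrow> 'w" where
  "extend f T = (\<lambda>xs. f (T xs))"

definition trace_form ::
  "((real^8) list \<Rightarrow> real) \<Rightarrow> real^8 \<Rightarrow> real^8 \<Rightarrow> (real^8) list \<Rightarrow> (real^8) list \<Rightarrow> real" where
  "trace_form \<omega> v w =
     (\<lambda>xs ys. trace (matrix (\<lambda>u. extend (S_map \<omega> v) (S_map \<omega> w u) xs ys)))"

text \<open>\<open>\<Lambda>\<^sup>k V\<close>, as the dual space of \<open>\<Lambda>\<^sup>k V\<^sup>*\<close>.\<close>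

definition multivectors :: "nat \<Rightarrow> (('v::real_vector list \<Rightarrow> real) \<Rightarrow> real) set" where
  "multivectors k = {\<rho>.
     (\<forall>\<alpha>\<in>alt_forms k. \<forall>\<beta>\<in>alt_forms k. \<rho> (\<lambda>xs. \<alpha> xs + \<beta> xs) = \<rho> \<alpha> + \<rho> \<beta>) \<and>
     (\<forall>c. \<forall>\<alpha>\<in>alt_forms k. \<rho> (\<lambda>xs. c * \<alpha> xs) = c * \<rho> \<alpha>)}"

definition nonzero_multivector :: "nat \<Rightarrow> (('v::real_vector list \<Rightarrow> real) \<Rightarrow> real) \<Rightarrow> bool" where
  "nonzero_multivector k \<rho> \<longleftrightarrow> \<rho> \<in> multivectors k \<and> (\<exists>\<alpha>\<in>alt_forms k. \<rho> \<alpha> \<noteq> 0)"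

text \<open>The pairing of \<open>b \<in> (\<Lambda>\<^sup>8 V\<^sup>*) \<otimes> (\<Lambda>\<^sup>8 V\<^sup>*)\<close> with \<open>\<rho> \<otimes> \<rho>\<close>.\<close>

definition pair_square ::
  "('v list \<Rightarrow> 'v list \<Rightarrow> real) \<Rightarrow> (('v list \<Rightarrow> real) \<Rightarrow> real) \<Rightarrow> real" where
  "pair_square b \<rho> = \<rho> (\<lambda>xs. \<rho> (\<lambda>ys. b xs ys))"

definition nondegenerate_form :: "('v::real_vector \<Rightarrow> 'v \<Rightarrow> real) \<Rightarrow> bool" where
  "nondegenerate_form b \<longleftrightarrow> (\<forall>v. (\<forall>w. b v w = 0) \<longrightarrow> v = 0)"

definition trace_form_nondegenerate :: "((real^8) list \<Rightarrow> real) \<Rightarrow> bool" where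
  "trace_form_nondegenerate \<omega> \<longleftrightarrow>
     (\<exists>\<rho>. nonzero_multivector 8 \<rho> \<and>
          nondegenerate_form (\<lambda>v w. pair_square (trace_form \<omega> v w) \<rho>))"

end

(* All objects are polynomial in the form and transform under GL by powers of the determinant, so
   an identity which holds at the 3-form w0 of su(3) holds on its orbit; if the orbit of w0 contains a
   neighbourhood of w0, it holds along the line from w0 to any other form w, hence at w. This gives (i).

   For (ii), let Q be the determinant of the Gram matrix of the trace form. It is a semi-invariant of
   weight 18. The adjugate C of the Gram matrix is, up to weight, an equivariant metric on the dual
   space. Composing the infinitesimal orbit map A |-> A.w with its C-adjoint gives an endomorphism
   N(w) of the space of 3-forms, whose image lies in the tangent space of the orbit. The determinant
   of N is a semi-invariant as well, so it is a multiple of a power of Q on the orbit of w0 and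
   therefore everywhere, and the multiple is non-zero because at w0 the metric is definite and the
   orbit map is onto. Hence Q(w) <> 0 makes the orbit map of w onto, and the orbit open. Conversely,
   an open orbit meets the line towards w0 in a neighbourhood of w; if Q(w) = 0, then Q vanishes there
   and thus on the whole line, contradicting Q(w0) <> 0. *)

theory Submission
  imports Defs "HOL-Computational_Algebra.Polynomial"
begin

section \<open>Alternating forms on lists\<close>

text \<open>The adjugate replaces the inverse of the Gram matrix because everything must stay
  polynomial along a line. The weights then fit together: the Gram matrix \<open>G\<close> pulls
  back to \<open>(det H)^2\<close> times the congruent matrix, so its determinant has weight 2 * 8 +
  2 = 18, its adjugate has weight 18 - 2 = 16, and N contains three adjugates, hence weight 48.
  Since 3 * 48 = 8 * 18, the cube of N can be completed by the 8th power of Q on the complement of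
  the 3-forms in the 512-dimensional space of all tensors, with one common weight 144; so N is
  handled through an ordinary square matrix. At the reference form everything is explicit. Its
  multiplication is, up to scale, the symmetric tensor d_ijk of the Gell-Mann basis, and (i)
  expresses the total symmetry of that tensor. The metric pairing of N(\<sigma>) with \<sigma> is a
  weighted sum of squares, so the kernel of N is the kernel of the adjoint orbit map, given by 64
  linear equations in the 56 coefficients of \<sigma>. They have only the zero solution, in
  accordance with 64 - 8 = 56, where 8 is the dimension of the stabiliser su(3).\<close>

lemma alt_formsI:
  assumes "\<And>xs. length xs \<noteq> k \<Longrightarrow> \<omega> xs = 0"
    and "\<And>xs ys. length xs + length ys + 1 = k \<Longrightarrow> linear (\<lambda>v. \<omega> (xs @ v # ys))"
    and "\<And>xs. length xs = k \<Longrightarrow> \<not> distinct xs \<Longrightarrow> \<omega> xs = 0"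
  shows "\<omega> \<in> alt_forms k"
  using assms unfolding alt_forms_def by blast

lemma alt_forms_length: "\<omega> \<in> alt_forms k \<Longrightarrow> length xs \<noteq> k \<Longrightarrow> \<omega> xs = 0"
  and alt_forms_linear: "\<omega> \<in> alt_forms k \<Longrightarrow> length xs + length ys + 1 = k \<Longrightarrow> linear (\<lambda>v. \<omega> (xs @ v # ys))"
  and alt_forms_distinct: "\<omega> \<in> alt_forms k \<Longrightarrow> \<not> distinct xs \<Longrightarrow> \<omega> xs = 0"
  unfolding alt_forms_def by blast+

text \<open>Polarisation: the value with \<open>u + v\<close> in both adjacent slots is zero, and so
  are the two diagonal terms of its expansion.\<close>

lemma alt_forms_swap:
  assumes "\<omega> \<in> alt_forms k"
  shows "\<omega> (xs @ u # v # ys) = - \<omega> (xs @ v # u # ys)"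
proof (cases "length xs + length ys + 2 = k")
  case True
  have 1: "linear (\<lambda>z. \<omega> (xs @ z # b # ys))" for b
    using alt_forms_linear[OF assms, of xs "b # ys"] True by simp
  have 2: "linear (\<lambda>z. \<omega> (xs @ a # z # ys))" for a
    using alt_forms_linear[OF assms, of "xs @ [a]" ys] True by simp
  have 0: "\<omega> (xs @ a # a # ys) = 0" for a
    by (rule alt_forms_distinct[OF assms]) auto
  have "0 = \<omega> (xs @ (u + v) # (u + v) # ys)" by (rule 0[symmetric])
  also have "\<dots> = \<omega> (xs @ u # v # ys) + \<omega> (xs @ v # u # ys)"
    unfolding linear_add[OF 1] linear_add[OF 2] unfolding 0 by simp
  finally show ?thesis by (metis eq_neg_iff_add_eq_0)
next
  case False
  then show ?thesis by (simp add: alt_forms_length[OF assms])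
qed

lemma alt_forms_move:
  assumes "\<omega> \<in> alt_forms k"
  shows "\<omega> (xs @ ys @ v # zs) = (- 1) ^ length ys *\<^sub>R \<omega> (xs @ v # ys @ zs)"
proof (induction ys arbitrary: xs)
  case (Cons y ys)
  have "\<omega> (xs @ (y # ys) @ v # zs) = (- 1) ^ length ys *\<^sub>R \<omega> (xs @ y # v # ys @ zs)"
    using Cons[of "xs @ [y]"] by simp
  also have "\<omega> (xs @ y # v # ys @ zs) = - \<omega> (xs @ v # y # ys @ zs)"
    by (rule alt_forms_swap[OF assms])
  finally show ?case by simp
qed simp

text \<open>Only vanishing is transported, so signs of reorderings never have to be computed. The
  fixed prefix \<open>ps\<close> collects the entries already brought into place.\<close>

lemma alt_forms_eq_0_mset:
  assumes "\<omega> \<in> alt_forms k" "mset xs = mset ys" "\<omega> (ps @ ys) = 0"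
  shows "\<omega> (ps @ xs) = 0"
  using assms(2,3)
proof (induction xs arbitrary: ys ps)
  case (Cons x xs)
  obtain as bs where ys: "ys = as @ x # bs"
    by (metis Cons.prems(1) list.set_intros(1) mset_eq_setD split_list)
  have "\<omega> (ps @ x # as @ bs) = 0"
    using Cons.prems(2) alt_forms_move[OF assms(1), of ps as x bs] by (simp add: ys)
  then show ?case
    using Cons.IH[of "as @ bs" "ps @ [x]"] Cons.prems(1) by (simp add: ys)
qed simp

text \<open>A form of top degree is determined by one value. The arguments are expanded one at a
  time, \<open>as\<close> being the part already replaced by basis vectors; a full list of basis
  vectors either has a repetition or is a reordering of \<open>E\<close>.\<close>

lemma alt_forms_eq_0_basis:
  fixes \<omega> :: "'v::euclidean_space list \<Rightarrow> 'w::real_vector"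
  assumes \<omega>: "\<omega> \<in> alt_forms k" and E: "distinct E" "set E = Basis" "length E = k"
    and 0: "\<omega> E = 0"
  shows "\<omega> xs = 0"
proof -
  have "set as \<subseteq> Basis \<Longrightarrow> \<omega> (as @ bs) = 0" for as bs
  proof (induction bs arbitrary: as)
    case Nil
    show ?case
    proof (cases "distinct as \<and> length as = k")
      case True
      have "set as = set E"
        by (rule card_subset_eq) (use E Nil True distinct_card[of as] distinct_card[of E] in auto)
      then have "mset as = mset E"
        using True E(1) set_eq_iff_mset_eq_distinct by blast
      then show ?thesis
        using alt_forms_eq_0_mset[OF \<omega>, of as E "[]"] 0 by simp
    next
      case False
      then show ?thesis using alt_forms_length[OF \<omega>] alt_forms_distinct[OF \<omega>] by auto
    qed
  next
    case (Cons b bs)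
    show ?case
    proof (cases "length as + length bs + 1 = k")
      case True
      have lin: "linear (\<lambda>v. \<omega> (as @ v # bs))"
        by (rule alt_forms_linear[OF \<omega> True])
      have "\<omega> (as @ b # bs) = \<omega> (as @ (\<Sum>i\<in>Basis. (b \<bullet> i) *\<^sub>R i) # bs)"
        by (simp add: euclidean_representation)
      also have "\<dots> = (\<Sum>i\<in>Basis. (b \<bullet> i) *\<^sub>R \<omega> (as @ i # bs))"
        by (simp add: linear_sum[OF lin] linear_scale[OF lin])
      also have "\<dots> = 0"
      proof (rule sum.neutral, rule ballI)
        fix i :: 'v assume "i \<in> Basis"
        then show "(b \<bullet> i) *\<^sub>R \<omega> (as @ i # bs) = 0"
          using Cons.IH[of "as @ [i]"] Cons.prems by simp
      qed
      finally show ?thesis .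
    next
      case False
      then show ?thesis by (simp add: alt_forms_length[OF \<omega>])
    qed
  qed
  from this[of "[]"] show ?thesis by simp
qed

lemma alt_forms_scaleR_left:
  fixes t :: "'w::real_vector"
  assumes "\<alpha> \<in> alt_forms k"
  shows "(\<lambda>xs. \<alpha> xs *\<^sub>R t) \<in> alt_forms k"
proof (rule alt_formsI)
  fix xs ys :: "'a list" assume "length xs + length ys + 1 = k"
  from alt_forms_linear[OF assms this]
  show "linear (\<lambda>v. \<alpha> (xs @ v # ys) *\<^sub>R t)"
    by (simp add: linear_iff algebra_simps)
qed (auto simp: alt_forms_length[OF assms] alt_forms_distinct[OF assms])

lemma alt_forms_diff:
  assumes "\<alpha> \<in> alt_forms k" "\<beta> \<in> alt_forms k"
  shows "(\<lambda>xs. \<alpha> xs - \<beta> xs) \<in> alt_forms k"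
proof (rule alt_formsI)
  fix xs ys :: "'a list" assume *: "length xs + length ys + 1 = k"
  from linear_compose_sub[OF alt_forms_linear[OF assms(1) *] alt_forms_linear[OF assms(2) *]]
  show "linear (\<lambda>v. \<alpha> (xs @ v # ys) - \<beta> (xs @ v # ys))" .
qed (auto simp: alt_forms_length[OF assms(1)] alt_forms_length[OF assms(2)]
      alt_forms_distinct[OF assms(1)] alt_forms_distinct[OF assms(2)])

lemma alt_forms_map:
  fixes h :: "'v::real_vector \<Rightarrow> 'u::real_vector"
  assumes "\<alpha> \<in> alt_forms k" "linear h"
  shows "(\<lambda>xs. \<alpha> (map h xs)) \<in> alt_forms k"
proof (rule alt_formsI)
  fix xs ys :: "'v list" assume *: "length xs + length ys + 1 = k"
  have "linear (\<lambda>v. \<alpha> (map h xs @ v # map h ys))"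
    by (rule alt_forms_linear[OF assms(1)]) (use * in simp)
  from linear_compose[OF assms(2) this]
  show "linear (\<lambda>v. \<alpha> (map h (xs @ v # ys)))" by (simp add: o_def)
next
  fix xs :: "'v list" assume "\<not> distinct xs"
  then have "\<not> distinct (map h xs)" by (auto simp: distinct_map)
  then show "\<alpha> (map h xs) = 0" by (rule alt_forms_distinct[OF assms(1)])
qed (auto simp: alt_forms_length[OF assms(1)])

lemma interior_prod_alt_forms:
  assumes "\<omega> \<in> alt_forms (Suc k)"
  shows "interior_prod v \<omega> \<in> alt_forms k"
proof (rule alt_formsI)
  fix xs ys :: "'a list" assume *: "length xs + length ys + 1 = k"
  show "linear (\<lambda>z. interior_prod v \<omega> (xs @ z # ys))"
    using alt_forms_linear[OF assms, of "v # xs" ys] * by (simp add: interior_prod_def)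
qed (auto simp: interior_prod_def alt_forms_length[OF assms] alt_forms_distinct[OF assms])

lemma alt_forms_linear_upt:
  assumes "\<alpha> \<in> alt_forms k" "a \<le> j" "j < a + k"
  shows "linear (\<lambda>v. \<alpha> (map (\<lambda>i. if i = j then v else f i) [a..<a + k]))"
proof -
  have upt: "[a..<a + k] = [a..<j] @ j # [Suc j..<a + k]"
    using assms(2,3) upt_add_eq_append[of a j "a + k - j"] by (simp add: upt_conv_Cons)
  have eq: "map (\<lambda>i. if i = j then v else f i) [a..<a + k] = map f [a..<j] @ v # map f [Suc j..<a + k]" for v
    by (simp add: upt)
  show ?thesis unfolding eq
    by (rule alt_forms_linear[OF assms(1)]) (use assms(2,3) in simp)
qed

lemma wedge_alt_forms:
  assumes \<alpha>: "\<alpha> \<in> alt_forms k" and \<beta>: "\<beta> \<in> alt_forms l"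
  shows "wedge k l \<alpha> \<beta> \<in> alt_forms (k + l)"
proof (rule alt_formsI)
  fix xs ys :: "'a list" assume len: "length xs + length ys + 1 = k + l"
  define n where "n = length xs"
  define f where "f i = (xs @ 0 # ys) ! i" for i
  have nth: "(xs @ v # ys) ! i = (if i = n then v else f i)" for v i
    by (auto simp: n_def f_def nth_append nth_Cons split: nat.splits)
  have "linear (\<lambda>v. of_int (sign p) * \<alpha> (map (\<lambda>i. (xs @ v # ys) ! p i) [0..<k]) *
      \<beta> (map (\<lambda>i. (xs @ v # ys) ! p i) [k..<k + l]))" (is "linear ?F")
    if p: "p permutes {..<k + l}" for p
  proof -
    \<comment> \<open>The varying slot \<open>n\<close> is read at exactly one position
      \<open>j\<close>, so it enters only one of the two factors; the other is constant.\<close>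
    obtain j where j: "j < k + l" "p j = n"
      using p len unfolding n_def
      by (metis add.commute bij_betw_iff_bijections less_add_Suc1 lessThan_iff permutes_imp_bij
          add_Suc_right Suc_eq_plus1)
    have eq: "(xs @ v # ys) ! p i = (if i = j then v else f (p i))" for v i
      unfolding nth using j permutes_inj[OF p] by (metis injD)
    have const: "map (\<lambda>i. if i = j then v else f (p i)) [a..<b] = map (\<lambda>i. f (p i)) [a..<b]"
      if "j < a \<or> b \<le> j" for v a b
      using that by auto
    show ?thesis
    proof (cases "j < k")
      case True
      have "linear (\<lambda>v. \<alpha> (map (\<lambda>i. if i = j then v else f (p i)) [0..<k]))"
        using alt_forms_linear_upt[OF \<alpha>, of 0 j "\<lambda>i. f (p i)"] True by simp
      moreover have "?F = (\<lambda>v. (of_int (sign p) * \<beta> (map (\<lambda>i. f (p i)) [k..<k + l])) *\<^sub>R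
          \<alpha> (map (\<lambda>i. if i = j then v else f (p i)) [0..<k]))"
        unfolding eq const[of k "k + l", OF disjI1[OF True]] by (simp add: mult_ac)
      ultimately show ?thesis by (simp only: linear_compose_scale_right)
    next
      case False
      have "linear (\<lambda>v. \<beta> (map (\<lambda>i. if i = j then v else f (p i)) [k..<k + l]))"
        using alt_forms_linear_upt[OF \<beta>, of k j "\<lambda>i. f (p i)"] j False by simp
      moreover have "?F = (\<lambda>v. (of_int (sign p) * \<alpha> (map (\<lambda>i. f (p i)) [0..<k])) *\<^sub>R
          \<beta> (map (\<lambda>i. if i = j then v else f (p i)) [k..<k + l]))"
        unfolding eq const[of 0 k, OF disjI2[OF leI[OF False]]] by (simp add: mult_ac)
      ultimately show ?thesis by (simp only: linear_compose_scale_right)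
    qed
  qed
  then have "linear (\<lambda>v. \<Sum>p | p permutes {..<k + l}. of_int (sign p) *
      \<alpha> (map (\<lambda>i. (xs @ v # ys) ! p i) [0..<k]) * \<beta> (map (\<lambda>i. (xs @ v # ys) ! p i) [k..<k + l]))"
    by (intro linear_compose_sum) simp
  then have "linear (\<lambda>v. (1 / (fact k * fact l)) *\<^sub>R (\<Sum>p | p permutes {..<k + l}. of_int (sign p) *
      \<alpha> (map (\<lambda>i. (xs @ v # ys) ! p i) [0..<k]) * \<beta> (map (\<lambda>i. (xs @ v # ys) ! p i) [k..<k + l])))"
    by (rule linear_compose_scale_right)
  then show "linear (\<lambda>v. wedge k l \<alpha> \<beta> (xs @ v # ys))"
    using len by (simp add: wedge_def)
next
  fix xs :: "'a list" assume len: "length xs = k + l" and "\<not> distinct xs"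
  then obtain a b where ab: "a < k + l" "b < k + l" "a \<noteq> b" "xs ! a = xs ! b"
    by (auto simp: distinct_conv_nth)
  let ?\<tau> = "Transposition.transpose a b"
  define G where "G p = \<alpha> (map (\<lambda>i. xs ! p i) [0..<k]) * \<beta> (map (\<lambda>i. xs ! p i) [k..<k + l])" for p
  have \<tau>: "?\<tau> permutes {..<k + l}" using ab by (simp add: permutes_swap_id)
  have xs\<tau>: "xs ! ?\<tau> i = xs ! i" for i
    using ab(4) by (cases "i = a"; cases "i = b") auto
  \<comment> \<open>Composition with the transposition of the two equal arguments flips every sign
    and keeps every value, so the sum equals its own negative.\<close>
  have "(\<Sum>p | p permutes {..<k + l}. of_int (sign p) * G p) =
      (\<Sum>p | p permutes {..<k + l}. of_int (sign (?\<tau> \<circ> p)) * G (?\<tau> \<circ> p))"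
    by (rule sum.reindex_bij_witness[of _ "\<lambda>p. ?\<tau> \<circ> p" "\<lambda>p. ?\<tau> \<circ> p"])
      (auto simp: \<tau> permutes_compose o_assoc simp del: o_apply)
  also have "\<dots> = - (\<Sum>p | p permutes {..<k + l}. of_int (sign p) * G p)"
    unfolding sum_negf[symmetric]
  proof (rule sum.cong)
    fix p assume "p \<in> {p. p permutes {..<k + l}}"
    then have "sign (?\<tau> \<circ> p) = - sign p"
      using ab(3) \<tau> by (simp add: sign_compose sign_swap_id permutes_imp_permutation[of "{..<k + l}"])
    moreover have "G (?\<tau> \<circ> p) = G p" unfolding G_def o_def xs\<tau> ..
    ultimately show "of_int (sign (?\<tau> \<circ> p)) * G (?\<tau> \<circ> p) = - (of_int (sign p) * G p)"
      by simp
  qed simp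
  finally have "(\<Sum>p | p permutes {..<k + l}. of_int (sign p) * G p) = 0" by simp
  then show "wedge k l \<alpha> \<beta> xs = 0"
    using len by (simp add: wedge_def G_def mult.assoc)
qed (simp add: wedge_def)

section \<open>The contraction isomorphism\<close>

lemma contract_eq_sum: "contract T xs = (\<Sum>i\<in>UNIV. T (axis i 1 # xs) $ i)"
  by (simp add: contract_def trace_def matrix_def)

text \<open>On top-degree forms this inverts \<open>contract\<close>. It involves no volume form, which makes it
  manifestly equivariant.\<close>

definition uncontract :: "((real^'n) list \<Rightarrow> real) \<Rightarrow> (real^'n) list \<Rightarrow> real^'n" where
  "uncontract \<Phi> xs = (\<Sum>m<length xs. ((- 1) ^ m * \<Phi> (take m xs @ drop (Suc m) xs)) *\<^sub>R xs ! m)"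

lemma linear_mult_scaleR_left:
  fixes f :: "'v::real_vector \<Rightarrow> real"
  assumes "linear f"
  shows "linear (\<lambda>v. (c * f v) *\<^sub>R x)"
  by (rule linearI) (simp_all add: linear_add[OF assms] linear_scale[OF assms] algebra_simps)

lemma uncontract_alt_forms:
  fixes \<Phi> :: "(real^'n) list \<Rightarrow> real"
  assumes \<Phi>: "\<Phi> \<in> alt_forms k"
  shows "uncontract \<Phi> \<in> alt_forms (Suc k)"
proof (rule alt_formsI)
  fix xs :: "(real^'n) list" assume "length xs \<noteq> Suc k"
  then show "uncontract \<Phi> xs = 0"
    by (auto simp: uncontract_def alt_forms_length[OF \<Phi>] intro!: sum.neutral)
next
  fix xs ys :: "(real^'n) list" assume len: "length xs + length ys + 1 = Suc k"
  let ?zs = "\<lambda>v. xs @ v # ys"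
  have lin: "linear (\<lambda>v. ((- 1) ^ m * \<Phi> (take m (?zs v) @ drop (Suc m) (?zs v))) *\<^sub>R ?zs v ! m)" (is "linear ?F")
    if m: "m < length xs + length ys + 1" for m
  proof -
    consider "m < length xs" | "m = length xs" | q where "m = length xs + Suc q"
      by (metis add_Suc_right less_imp_Suc_add linorder_neqE_nat)
    then show ?thesis
    proof cases
      case 1
      have "linear (\<lambda>v. \<Phi> ((take m xs @ drop (Suc m) xs) @ v # ys))"
        by (rule alt_forms_linear[OF \<Phi>]) (use 1 len in auto)
      from linear_mult_scaleR_left[OF this, of "(- 1) ^ m" "xs ! m"] show ?thesis
        using 1 by (simp add: nth_append)
    next
      case 2
      show ?thesis unfolding 2 by (simp add: linear_compose_scale_right linear_id[unfolded id_def])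
    next
      case 3
      then have "linear (\<lambda>v. \<Phi> (xs @ v # take q ys @ drop (Suc q) ys))"
        by (intro alt_forms_linear[OF \<Phi>]) (use m len in auto)
      from linear_mult_scaleR_left[OF this, of "(- 1) ^ m" "ys ! q"] show ?thesis
        unfolding 3 by (simp add: nth_append)
    qed
  qed
  have len': "length (?zs v) = length xs + length ys + 1" for v by simp
  show "linear (\<lambda>v. uncontract \<Phi> (xs @ v # ys))"
    unfolding uncontract_def len' by (intro linear_compose_sum ballI lin) simp
next
  fix xs :: "(real^'n) list" assume len: "length xs = Suc k" and "\<not> distinct xs"
  then obtain as bs cs x where "xs = as @ [x] @ bs @ [x] @ cs"
    using not_distinct_decomp by blast
  then have xs: "xs = as @ x # bs @ x # cs" by simp
  define F where "F m = ((- 1) ^ m * \<Phi> (take m xs @ drop (Suc m) xs)) *\<^sub>R xs ! m" for m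
  let ?i = "length as" and ?j = "length as + Suc (length bs)"
  \<comment> \<open>Omitting any argument other than the two copies of \<open>x\<close> leaves a
    repetition. The two remaining terms cancel: their positions differ by
    \<open>Suc (length bs)\<close>, while moving \<open>x\<close> across \<open>bs\<close> costs the
    sign of \<open>length bs\<close>.\<close>
  have 0: "F m = 0" if m: "m < length xs" "m \<noteq> ?i" "m \<noteq> ?j" for m
  proof -
    have "\<not> distinct (take m xs @ drop (Suc m) xs)"
    proof
      assume d: "distinct (take m xs @ drop (Suc m) xs)"
      consider "m < ?i" | q where "m = ?i + Suc q" "q < length bs" | q where "m = ?j + Suc q"
      proof -
        consider "m < ?i" | "?i < m" "m < ?j" | "?j < m" using m(2,3) by linarith
        then show ?thesis
        proof cases
          case 2 then show ?thesis using that(2)[of "m - Suc ?i"] by simp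
        next
          case 3 then show ?thesis using that(3)[of "m - Suc ?j"] by simp
        qed (rule that(1))
      qed
      then show False
      proof cases
        case 1 then show False using d by (simp add: xs)
      next
        case 2 then show False using d by (simp add: xs)
      next
        case 3 then show False using d by (simp add: xs)
      qed
    qed
    then show ?thesis by (simp add: F_def alt_forms_distinct[OF \<Phi>])
  qed
  have "uncontract \<Phi> xs = (\<Sum>m\<in>{?i, ?j}. F m)"
    unfolding uncontract_def F_def[symmetric]
    by (rule sum.mono_neutral_right) (use 0 in \<open>auto simp: xs\<close>)
  also have "\<dots> = F ?i + F ?j" by simp
  also have "F ?i = ((- 1) ^ length as * \<Phi> (as @ bs @ x # cs)) *\<^sub>R x"
    by (simp add: F_def xs)
  also have "F ?j = ((- 1) ^ ?j * \<Phi> (as @ x # bs @ cs)) *\<^sub>R x"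
    by (simp add: F_def xs nth_append)
  also have "\<Phi> (as @ bs @ x # cs) = (- 1) ^ length bs * \<Phi> (as @ x # bs @ cs)"
    using alt_forms_move[OF \<Phi>, of as bs x cs] by simp
  finally show "uncontract \<Phi> xs = 0" by (simp add: power_add)
qed

text \<open>In the trace, the summand omitting the new first argument contributes
  \<open>\<Phi> xs\<close> once for each of the \<open>Suc k\<close> basis vectors. Each of the
  other \<open>k\<close> summands reassembles, by basis expansion, to \<open>- \<Phi> xs\<close>.
  Exactly one copy survives.\<close>

lemma contract_uncontract:
  fixes \<Phi> :: "(real^'n) list \<Rightarrow> real"
  assumes \<Phi>: "\<Phi> \<in> alt_forms k" and k: "Suc k = CARD('n)"
  shows "contract (uncontract \<Phi>) = \<Phi>"
proof
  fix xs :: "(real^'n) list"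
  show "contract (uncontract \<Phi>) xs = \<Phi> xs"
  proof (cases "length xs = k")
    case False
    then show ?thesis
      by (simp add: contract_eq_sum alt_forms_length[OF \<Phi>] alt_forms_length[OF uncontract_alt_forms[OF \<Phi>]])
  next
    case True
    define ys where "ys m = take m xs @ drop (Suc m) xs" for m
    have step: "(\<Sum>i\<in>UNIV. \<Phi> (axis i 1 # ys m) * xs ! m $ i) = (- 1) ^ m * \<Phi> xs" if "m < k" for m
    proof -
      have lin: "linear (\<lambda>v. \<Phi> (v # ys m))"
        using alt_forms_linear[OF \<Phi>, of "[]" "ys m"] that True by (simp add: ys_def)
      have "xs ! m = (\<Sum>i\<in>UNIV. xs ! m $ i *\<^sub>R axis i 1)"
        using basis_expansion[of "xs ! m"] by (simp add: scalar_mult_eq_scaleR)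
      then have "\<Phi> (xs ! m # ys m) = \<Phi> ((\<Sum>i\<in>UNIV. xs ! m $ i *\<^sub>R axis i 1) # ys m)"
        by simp
      also have "\<dots> = (\<Sum>i\<in>UNIV. \<Phi> (axis i 1 # ys m) * xs ! m $ i)"
        by (simp add: linear_sum[OF lin] linear_scale[OF lin] mult.commute)
      also have "\<Phi> (xs ! m # ys m) = (- 1) ^ m * \<Phi> xs"
        using alt_forms_move[OF \<Phi>, of "[]" "take m xs" "xs ! m" "drop (Suc m) xs"] that True
        by (simp add: ys_def id_take_nth_drop[symmetric] mult.assoc[symmetric] flip: power_add)
      finally show ?thesis by simp
    qed
    have "contract (uncontract \<Phi>) xs
        = (\<Sum>i\<in>UNIV. \<Phi> xs - (\<Sum>m<k. (- 1) ^ m * (\<Phi> (axis i 1 # ys m) * xs ! m $ i)))"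
      by (simp add: contract_eq_sum uncontract_def sum.lessThan_Suc_shift True ys_def sum_negf algebra_simps
          del: sum.lessThan_Suc)
    also have "\<dots> = real CARD('n) * \<Phi> xs - (\<Sum>m<k. (- 1) ^ m * (\<Sum>i\<in>UNIV. \<Phi> (axis i 1 # ys m) * xs ! m $ i))"
      by (subst sum_subtractf, subst sum.swap) (simp add: sum_distrib_left)
    also have "\<dots> = real CARD('n) * \<Phi> xs - (\<Sum>m<k. \<Phi> xs)"
      by (simp add: step flip: mult.assoc power_add)
    also have "\<dots> = \<Phi> xs"
      by (simp add: k[symmetric] algebra_simps)
    finally show ?thesis .
  qed
qed

lemma inj_on_contract:
  "inj_on contract (alt_forms CARD('n) :: ((real^'n) list \<Rightarrow> real^'n) set)"
proof (rule inj_onI)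
  fix S T :: "(real^'n) list \<Rightarrow> real^'n"
  assume S: "S \<in> alt_forms CARD('n)" and T: "T \<in> alt_forms CARD('n)" and eq: "contract S = contract T"
  define U where "U xs = S xs - T xs" for xs
  have U: "U \<in> alt_forms CARD('n)" using alt_forms_diff[OF S T] by (simp add: U_def[abs_def])
  have cU: "contract U xs = 0" for xs
    using fun_cong[OF eq, of xs] by (simp add: contract_eq_sum U_def sum_subtractf)
  obtain E :: "(real^'n) list" where E: "set E = Basis" "distinct E"
    using finite_distinct_list[OF finite_Basis] by blast
  have len: "length E = CARD('n)" using E distinct_card by fastforce
  have "U E $ k = 0" for k
  proof -
    have "axis k 1 \<in> set E" unfolding E by (simp add: axis_in_Basis_iff)
    then obtain as bs where AB: "E = as @ axis k 1 # bs" using split_list by metis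
    \<comment> \<open>Evaluating the contraction on the basis list with \<open>axis k 1\<close>
      removed leaves a single term of the trace, since every other basis vector is repeated.\<close>
    have "U (axis i 1 # as @ bs) = 0" if "i \<noteq> k" for i
    proof -
      have "axis i 1 \<in> set E" unfolding E by (simp add: axis_in_Basis_iff)
      then have "axis i 1 \<in> set (as @ bs)" using that by (auto simp: AB axis_eq_axis)
      then show ?thesis by (intro alt_forms_distinct[OF U]) auto
    qed
    then have "contract U (as @ bs) = (\<Sum>i\<in>UNIV. if i = k then U (axis k 1 # as @ bs) $ k else 0)"
      unfolding contract_eq_sum by (intro sum.cong) auto
    then have "U (axis k 1 # as @ bs) $ k = 0" using cU by simp
    then show ?thesis
      using alt_forms_move[OF U, of "[]" as "axis k 1" bs] by (simp add: AB)
  qed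
  then have "U E = 0" by (simp add: vec_eq_iff)
  from alt_forms_eq_0_basis[OF U E(2) E(1) len this]
  show "S = T" by (auto simp: U_def)
qed

section \<open>The multiplication in coordinates\<close>

definition mult_form :: "((real^8) list \<Rightarrow> real) \<Rightarrow> real^8 \<Rightarrow> real^8 \<Rightarrow> (real^8) list \<Rightarrow> real" where
  "mult_form \<omega> v w = wedge 4 3 (wedge 2 2 (interior_prod v \<omega>) (interior_prod w \<omega>)) \<omega>"

lemma mult_form_alt_forms:
  assumes "\<omega> \<in> alt_forms 3"
  shows "mult_form \<omega> v w \<in> alt_forms 7"
proof -
  have "interior_prod u \<omega> \<in> alt_forms 2" for u
    by (rule interior_prod_alt_forms) (use assms in \<open>simp add: eval_nat_numeral\<close>)
  from wedge_alt_forms[OF wedge_alt_forms[OF this this] assms]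
  show ?thesis by (simp add: mult_form_def)
qed

lemma S_map_eq:
  assumes "\<omega> \<in> alt_forms 3"
  shows "S_map \<omega> v w = uncontract (mult_form \<omega> v w)"
  unfolding S_map_def mult_form_def[symmetric]
proof (rule inv_into_f_eq)
  show "inj_on contract (alt_forms 8 :: ((real^8) list \<Rightarrow> real^8) set)"
    using inj_on_contract[where 'n = 8] by simp
  show "uncontract (mult_form \<omega> v w) \<in> alt_forms 8"
    using uncontract_alt_forms[OF mult_form_alt_forms[OF assms]] by simp
  show "contract (uncontract (mult_form \<omega> v w)) = mult_form \<omega> v w"
    by (rule contract_uncontract[OF mult_form_alt_forms[OF assms]]) simp
qed

lemma S_map_alt_forms:
  assumes "\<omega> \<in> alt_forms 3"
  shows "S_map \<omega> v w \<in> alt_forms 8"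
  using uncontract_alt_forms[OF mult_form_alt_forms[OF assms]] by (simp add: S_map_eq[OF assms])

section \<open>Coordinates indexed by the naturals below 8, and the standard volume form\<close>

lemma bij_betw_of_nat_8: "bij_betw (of_nat :: nat \<Rightarrow> 8) {..<8} UNIV"
proof -
  have "(UNIV :: 8 set) \<subseteq> of_nat ` {..<8}"
  proof
    fix x :: 8
    show "x \<in> of_nat ` {..<8}"
    proof (cases x)
      case (of_int z)
      then have "x = of_nat (nat z)" "nat z < 8" by auto
      then show ?thesis by blast
    qed
  qed
  then have img: "of_nat ` {..<8} = (UNIV :: 8 set)" by auto
  then have "inj_on (of_nat :: nat \<Rightarrow> 8) {..<8}"
    by (intro eq_card_imp_inj_on) auto
  with img show ?thesis by (simp add: bij_betw_def)
qed

lemma sum_UNIV_8: "(\<Sum>i\<in>(UNIV :: 8 set). f i) = (\<Sum>i<8. f (of_nat i))"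
  using sum.reindex_bij_betw[OF bij_betw_of_nat_8, of f] by simp

lemma of_nat_8_eq_iff: "i < 8 \<Longrightarrow> j < 8 \<Longrightarrow> (of_nat i :: 8) = of_nat j \<longleftrightarrow> i = j"
  using bij_betw_of_nat_8 unfolding bij_betw_def by (meson inj_on_eq_iff lessThan_iff)

definition idx8 :: "8 \<Rightarrow> nat" where
  "idx8 = inv_into {..<8} of_nat"

lemma idx8_less: "idx8 i < 8" and of_nat_idx8 [simp]: "of_nat (idx8 i) = i"
proof -
  have "i \<in> of_nat ` {..<8}" using bij_betw_of_nat_8 by (simp add: bij_betw_def)
  from inv_into_into[OF this] f_inv_into_f[OF this]
  show "idx8 i < 8" "of_nat (idx8 i) = i" by (auto simp: idx8_def)
qed

lemma idx8_eq_iff [simp]: "idx8 i = idx8 j \<longleftrightarrow> i = j"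
  by (metis of_nat_idx8)

lemma idx8_of_nat: "i < 8 \<Longrightarrow> idx8 (of_nat i) = i"
  using of_nat_8_eq_iff[of "idx8 (of_nat i)" i] idx8_less by simp

text \<open>Natural numbers serve as indices because the structure constants of the reference form
  are computed on lists of numbers.\<close>

definition e8 :: "nat \<Rightarrow> real^8" where
  "e8 i = axis (of_nat i) 1"

definition basis8 :: "(real^8) list" where
  "basis8 = map e8 [0..<8]"

lemma length_basis8 [simp]: "length basis8 = 8"
  by (simp add: basis8_def)

lemma basis8_nth: "i < 8 \<Longrightarrow> basis8 ! i = e8 i"
  by (simp add: basis8_def)

lemma e8_idx8 [simp]: "e8 (idx8 i) = axis i 1"
  by (simp add: e8_def)

lemma distinct_basis8: "distinct basis8"
  by (auto simp: basis8_def distinct_map inj_on_def e8_def axis_eq_axis of_nat_8_eq_iff)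

lemma set_basis8: "set basis8 = Basis"
proof (rule card_subset_eq)
  show "set basis8 \<subseteq> Basis" by (auto simp: basis8_def e8_def axis_in_Basis_iff)
  show "card (set basis8) = card (Basis :: (real^8) set)"
    using distinct_card[OF distinct_basis8] by simp
qed simp

definition vol8 :: "(real^8) list \<Rightarrow> real" where
  "vol8 xs = (if length xs = 8 then det (\<chi> i. xs ! idx8 i) else 0)"

lemma vol8_alt_forms: "vol8 \<in> alt_forms 8"
proof (rule alt_formsI)
  fix xs ys :: "(real^8) list" assume len: "length xs + length ys + 1 = 8"
  define k :: 8 where "k = of_nat (length xs)"
  have nth: "(xs @ v # ys) ! idx8 i = (if i = k then v else (xs @ 0 # ys) ! idx8 i)" for v i
  proof -
    have "i = k \<longleftrightarrow> idx8 i = length xs"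
      unfolding k_def using len by (metis idx8_of_nat of_nat_idx8 less_add_Suc1 Suc_eq_plus1 add_Suc_shift)
    then show ?thesis by (auto simp: nth_append nth_Cons split: nat.splits)
  qed
  show "linear (\<lambda>v. vol8 (xs @ v # ys))"
  proof (rule linearI)
    fix a b :: "real^8"
    show "vol8 (xs @ (a + b) # ys) = vol8 (xs @ a # ys) + vol8 (xs @ b # ys)"
      using len det_row_add[of k "\<lambda>_. a" "\<lambda>_. b" "\<lambda>i. (xs @ 0 # ys) ! idx8 i"]
      by (simp add: vol8_def nth)
  next
    fix c and a :: "real^8"
    show "vol8 (xs @ (c *\<^sub>R a) # ys) = c *\<^sub>R vol8 (xs @ a # ys)"
      using len det_row_mul[of k c "\<lambda>_. a" "\<lambda>i. (xs @ 0 # ys) ! idx8 i"]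
      unfolding scalar_mult_eq_scaleR by (simp add: vol8_def nth)
  qed
next
  fix xs :: "(real^8) list" assume len: "length xs = 8" and "\<not> distinct xs"
  then obtain a b where "a < 8" "b < 8" "a \<noteq> b" "xs ! a = xs ! b"
    by (auto simp: distinct_conv_nth)
  then have "(of_nat a :: 8) \<noteq> of_nat b" "row (of_nat a) (\<chi> i. xs ! idx8 i) = row (of_nat b) (\<chi> i. xs ! idx8 i)"
    by (auto simp: of_nat_8_eq_iff row_def vec_eq_iff idx8_of_nat)
  from det_identical_rows[OF this] show "vol8 xs = 0" by (simp add: vol8_def)
qed (simp add: vol8_def)

lemma vol8_map: "vol8 (map ((*v) H) basis8) = det H"
proof -
  have "(\<chi> i. map ((*v) H) basis8 ! idx8 i) = transpose H"
    by (simp add: vec_eq_iff idx8_less basis8_nth transpose_def matrix_vector_mul_component column_def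
        matrix_vector_mult_basis)
  then show ?thesis by (simp add: vol8_def)
qed

lemma vol8_basis8: "vol8 basis8 = 1"
proof -
  have "map ((*v) (mat 1)) basis8 = basis8" by (simp add: map_idI)
  then show ?thesis using vol8_map[of "mat 1"] by simp
qed

lemma alt_forms_8_eq:
  fixes T :: "(real^8) list \<Rightarrow> 'w::real_vector"
  assumes T: "T \<in> alt_forms 8"
  shows "T xs = vol8 xs *\<^sub>R T basis8"
proof -
  have "(\<lambda>xs. T xs - vol8 xs *\<^sub>R T basis8) \<in> alt_forms 8"
    by (rule alt_forms_diff[OF T alt_forms_scaleR_left[OF vol8_alt_forms]])
  from alt_forms_eq_0_basis[OF this distinct_basis8 set_basis8, of xs]
  show ?thesis by (simp add: vol8_basis8)
qed

text \<open>The line of 8-forms is trivialised by \<open>vol8\<close>, which turns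
  \<open>S_map\<close> into an ordinary multiplication on the vector space.\<close>

definition smul :: "((real^8) list \<Rightarrow> real) \<Rightarrow> real^8 \<Rightarrow> real^8 \<Rightarrow> real^8" where
  "smul \<omega> v w = S_map \<omega> v w basis8"

lemma S_map_smul: "\<omega> \<in> alt_forms 3 \<Longrightarrow> S_map \<omega> v w xs = vol8 xs *\<^sub>R smul \<omega> v w"
  unfolding smul_def by (rule alt_forms_8_eq[OF S_map_alt_forms])

section \<open>Bilinearity of the multiplication, and the trace form as a real-valued form\<close>

lemma linear_wedge_left:
  assumes "\<And>xs. linear (\<lambda>v. \<alpha> v xs)"
  shows "linear (\<lambda>v. wedge k l (\<alpha> v) \<beta> xs)"
proof (cases "length xs = k + l")
  case True
  have eq: "(\<lambda>v. wedge k l (\<alpha> v) \<beta> xs) = (\<lambda>v. \<Sum>p | p permutes {..<k + l}.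
      (of_int (sign p) * \<beta> (map (\<lambda>i. xs ! p i) [k..<k + l]) / (fact k * fact l)) *\<^sub>R
        \<alpha> v (map (\<lambda>i. xs ! p i) [0..<k]))"
    unfolding wedge_def if_P[OF True] sum_divide_distrib by (intro ext sum.cong refl) simp
  show ?thesis
    unfolding eq by (intro linear_compose_sum ballI linear_compose_scale_right assms)
next
  case False
  then show ?thesis by (simp add: wedge_def linear_zero)
qed

lemma linear_wedge_right:
  assumes "\<And>xs. linear (\<lambda>v. \<beta> v xs)"
  shows "linear (\<lambda>v. wedge k l \<alpha> (\<beta> v) xs)"
proof (cases "length xs = k + l")
  case True
  have eq: "(\<lambda>v. wedge k l \<alpha> (\<beta> v) xs) = (\<lambda>v. \<Sum>p | p permutes {..<k + l}.
      (of_int (sign p) * \<alpha> (map (\<lambda>i. xs ! p i) [0..<k]) / (fact k * fact l)) *\<^sub>R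
        \<beta> v (map (\<lambda>i. xs ! p i) [k..<k + l]))"
    unfolding wedge_def if_P[OF True] sum_divide_distrib by (intro ext sum.cong refl) simp
  show ?thesis
    unfolding eq by (intro linear_compose_sum ballI linear_compose_scale_right assms)
next
  case False
  then show ?thesis by (simp add: wedge_def linear_zero)
qed

lemma linear_interior_prod:
  assumes "\<omega> \<in> alt_forms (Suc k)"
  shows "linear (\<lambda>v. interior_prod v \<omega> xs)"
proof (cases "length xs = k")
  case True
  then show ?thesis using alt_forms_linear[OF assms, of "[]" xs] by (simp add: interior_prod_def)
next
  case False
  then show ?thesis by (simp add: interior_prod_def alt_forms_length[OF assms] linear_iff)
qed

lemma linear_uncontract:
  assumes "\<And>xs. linear (\<lambda>v. \<Phi> v xs)"
  shows "linear (\<lambda>v. uncontract (\<Phi> v) xs)"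
  unfolding uncontract_def
  by (intro linear_compose_sum ballI linearI)
    (simp_all add: linear_add[OF assms] linear_scale[OF assms] algebra_simps)

lemma linear_smul_left: "\<omega> \<in> alt_forms 3 \<Longrightarrow> linear (\<lambda>v. smul \<omega> v w)"
  and linear_smul_right: "\<omega> \<in> alt_forms 3 \<Longrightarrow> linear (\<lambda>w. smul \<omega> v w)"
proof -
  assume \<omega>: "\<omega> \<in> alt_forms 3"
  have lin: "linear (\<lambda>v. interior_prod v \<omega> xs)" for xs
    by (rule linear_interior_prod[of _ 2]) (use \<omega> in \<open>simp add: eval_nat_numeral\<close>)
  show "linear (\<lambda>v. smul \<omega> v w)" "linear (\<lambda>w. smul \<omega> v w)"
    unfolding smul_def S_map_eq[OF \<omega>] mult_form_def
    by (rule linear_uncontract, rule linear_wedge_left, rule linear_wedge_left, rule lin)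
      (rule linear_uncontract, rule linear_wedge_left, rule linear_wedge_right, rule lin)
qed

definition trace_form8 :: "((real^8) list \<Rightarrow> real) \<Rightarrow> real^8 \<Rightarrow> real^8 \<Rightarrow> real" where
  "trace_form8 \<omega> v w = trace (matrix (smul \<omega> v) ** matrix (smul \<omega> w))"

lemma trace_form_eq:
  assumes \<omega>: "\<omega> \<in> alt_forms 3"
  shows "trace_form \<omega> v w xs ys = vol8 xs * vol8 ys * trace_form8 \<omega> v w"
proof -
  have "trace_form \<omega> v w xs ys = trace (matrix (\<lambda>u. (vol8 ys * vol8 xs) *\<^sub>R smul \<omega> v (smul \<omega> w u)))"
    unfolding trace_form_def extend_def S_map_smul[OF \<omega>] linear_scale[OF linear_smul_right[OF \<omega>]] scaleR_scaleR ..
  also have "\<dots> = vol8 xs * vol8 ys * trace (matrix (\<lambda>u. smul \<omega> v (smul \<omega> w u)))"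
    by (simp add: trace_def matrix_def sum_distrib_left mult.commute mult.left_commute)
  also have "matrix (\<lambda>u. smul \<omega> v (smul \<omega> w u)) = matrix (smul \<omega> v) ** matrix (smul \<omega> w)"
    using matrix_compose[OF linear_smul_right[OF \<omega>, of w] linear_smul_right[OF \<omega>, of v]] by (simp add: o_def)
  finally show ?thesis by (simp add: trace_form8_def)
qed

subsection \<open>Equivariance\<close>

definition pull :: "('v \<Rightarrow> 'v) \<Rightarrow> ('v list \<Rightarrow> 'w) \<Rightarrow> 'v list \<Rightarrow> 'w" where
  "pull h \<omega> xs = \<omega> (map h xs)"

lemma wedge_pull: "wedge k l (pull h \<alpha>) (pull h \<beta>) = pull h (wedge k l \<alpha> \<beta>)"
proof
  fix xs
  have key: "map (\<lambda>i. map h xs ! p i) [a..<b] = map h (map (\<lambda>i. xs ! p i) [a..<b])"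
    if "p permutes {..<k + l}" "length xs = k + l" "b \<le> k + l" for p a b
  proof (rule nth_equalityI)
    fix i assume "i < length (map (\<lambda>i. map h xs ! p i) [a..<b])"
    then have i: "a + i < b" by simp
    then have "p (a + i) < length xs"
      using that permutes_in_image[OF that(1), of "a + i"] by simp
    then show "map (\<lambda>i. map h xs ! p i) [a..<b] ! i = map h (map (\<lambda>i. xs ! p i) [a..<b]) ! i"
      using i nth_upt[OF i] by simp
  qed simp
  show "wedge k l (pull h \<alpha>) (pull h \<beta>) xs = pull h (wedge k l \<alpha> \<beta>) xs"
  proof (cases "length xs = k + l")
    case True
    have "(\<Sum>p | p permutes {..<k + l}. of_int (sign p) * pull h \<alpha> (map (\<lambda>i. xs ! p i) [0..<k]) *
          pull h \<beta> (map (\<lambda>i. xs ! p i) [k..<k + l])) =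
        (\<Sum>p | p permutes {..<k + l}. of_int (sign p) * \<alpha> (map (\<lambda>i. map h xs ! p i) [0..<k]) *
          \<beta> (map (\<lambda>i. map h xs ! p i) [k..<k + l]))"
    proof (rule sum.cong[OF refl], unfold mem_Collect_eq pull_def)
      fix p assume p: "p permutes {..<k + l}"
      show "of_int (sign p) * \<alpha> (map h (map (\<lambda>i. xs ! p i) [0..<k])) *
          \<beta> (map h (map (\<lambda>i. xs ! p i) [k..<k + l])) =
        of_int (sign p) * \<alpha> (map (\<lambda>i. map h xs ! p i) [0..<k]) *
          \<beta> (map (\<lambda>i. map h xs ! p i) [k..<k + l])"
        by (simp only: key[OF p True le_add1] key[OF p True order_refl])
    qed
    then show ?thesis using True unfolding wedge_def pull_def[of h "\<lambda>xs. _ xs"] length_map by simp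
  qed (simp add: wedge_def pull_def)
qed

lemma interior_prod_pull: "interior_prod v (pull h \<omega>) = pull h (interior_prod (h v) \<omega>)"
  by (simp add: interior_prod_def pull_def fun_eq_iff)

lemma mult_form_pull: "mult_form (pull h \<omega>) v w = pull h (mult_form \<omega> (h v) (h w))"
  by (simp add: mult_form_def interior_prod_pull wedge_pull)

lemma uncontract_pull:
  assumes "linear h"
  shows "h (uncontract (pull h \<Phi>) xs) = uncontract \<Phi> (map h xs)"
  by (simp add: uncontract_def pull_def linear_sum[OF assms] linear_scale[OF assms] take_map drop_map)

lemma pull_alt_forms: "\<omega> \<in> alt_forms k \<Longrightarrow> linear h \<Longrightarrow> pull h \<omega> \<in> alt_forms k"
  unfolding pull_def[abs_def] by (rule alt_forms_map)

text \<open>All constructions are natural except the choice of \<open>basis8\<close> as the place of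
  evaluation; the vector-valued 8-form evaluated at the image of that basis yields the factor
  \<open>det H\<close>.\<close>

lemma smul_pull:
  assumes \<omega>: "\<omega> \<in> alt_forms 3"
  shows "H *v smul (pull ((*v) H) \<omega>) v w = det H *\<^sub>R smul \<omega> (H *v v) (H *v w)"
proof -
  have lin: "linear ((*v) H)" by simp
  have "H *v smul (pull ((*v) H) \<omega>) v w = S_map \<omega> (H *v v) (H *v w) (map ((*v) H) basis8)"
    unfolding smul_def S_map_eq[OF \<omega>] S_map_eq[OF pull_alt_forms[OF \<omega> lin]] mult_form_pull
    by (rule uncontract_pull[OF lin])
  then show ?thesis by (simp add: S_map_smul[OF \<omega>] vol8_map)
qed

lemma matrix_works_real:
  fixes f :: "real^'n \<Rightarrow> real^'m"
  assumes "linear f"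
  shows "matrix f *v x = f x"
  by (rule matrix_works) (simp add: linear_matrix_vector_mul_eq assms)

text \<open>By \<open>smul_pull\<close>, each multiplication operator is \<open>det H\<close> times
  a conjugate by \<open>H\<close>. The conjugation disappears in the trace, the two scalars
  remain.\<close>

lemma trace_form8_pull:
  assumes \<omega>: "\<omega> \<in> alt_forms 3" and H: "det H \<noteq> 0"
  shows "trace_form8 (pull ((*v) H) \<omega>) v w = (det H)\<^sup>2 * trace_form8 \<omega> (H *v v) (H *v w)"
proof -
  let ?\<omega>' = "pull ((*v) H) \<omega>"
  have \<omega>': "?\<omega>' \<in> alt_forms 3" by (rule pull_alt_forms[OF \<omega>]) simp
  obtain K where K: "K ** H = mat 1" "H ** K = mat 1"
    using H by (metis invertible_det_nz invertible_def)
  have eq: "matrix (smul ?\<omega>' v) = det H *\<^sub>R (K ** matrix (smul \<omega> (H *v v)) ** H)" for v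
  proof -
    have "matrix (smul ?\<omega>' v) *v w = (det H *\<^sub>R (K ** matrix (smul \<omega> (H *v v)) ** H)) *v w" for w
    proof -
      have "matrix (smul ?\<omega>' v) *v w = K *v (H *v smul ?\<omega>' v w)"
        by (simp add: matrix_works_real[OF linear_smul_right[OF \<omega>']] matrix_vector_mul_assoc K)
      also have "\<dots> = det H *\<^sub>R (K *v (matrix (smul \<omega> (H *v v)) *v (H *v w)))"
        by (simp add: smul_pull[OF \<omega>] matrix_works_real[OF linear_smul_right[OF \<omega>]] matrix_vector_mult_scaleR)
      also have "\<dots> = (det H *\<^sub>R (K ** matrix (smul \<omega> (H *v v)) ** H)) *v w"
        by (simp only: matrix_vector_mul_assoc scaleR_matrix_vector_assoc matrix_mul_assoc)
      finally show ?thesis .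
    qed
    then show ?thesis unfolding matrix_eq by (rule allI)
  qed
  have "trace_form8 ?\<omega>' v w = (det H)\<^sup>2 *
      trace (K ** (matrix (smul \<omega> (H *v v)) ** matrix (smul \<omega> (H *v w)) ** H))"
  proof -
    have "K ** A ** H ** (K ** B ** H) = K ** (A ** B ** H)" for A B :: "real^8^8"
    proof -
      have "H ** (K ** X) = X" for X :: "real^8^8" by (simp add: matrix_mul_assoc K)
      then show ?thesis by (simp only: matrix_mul_assoc[symmetric])
    qed
    moreover have "trace (c *\<^sub>R M) = c * trace M" for c and M :: "real^8^8"
      by (simp add: trace_def sum_distrib_left)
    moreover have "(c *\<^sub>R A) ** (d *\<^sub>R B) = (c * d) *\<^sub>R (A ** B)" for c d and A B :: "real^8^8"
      by (simp add: vec_eq_iff matrix_matrix_mult_def sum_distrib_left mult_ac)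
    ultimately show ?thesis
      unfolding trace_form8_def eq by (simp only: power2_eq_square)
  qed
  also have "K ** (matrix (smul \<omega> (H *v v)) ** matrix (smul \<omega> (H *v w)) ** H) =
      K ** (matrix (smul \<omega> (H *v v)) ** matrix (smul \<omega> (H *v w))) ** H"
    by (rule matrix_mul_assoc)
  also have "trace \<dots> = trace (H ** (K ** (matrix (smul \<omega> (H *v v)) ** matrix (smul \<omega> (H *v w)))))"
    by (rule trace_mul_sym)
  also have "\<dots> = trace_form8 \<omega> (H *v v) (H *v w)"
    unfolding matrix_mul_assoc[of H K] K(2) matrix_mul_lid trace_form8_def ..
  finally show ?thesis .
qed

section \<open>Polynomial functions of one variable\<close>

text \<open>Polynomial dependence on a form is only ever tested along lines, so univariate
  polynomials are enough.\<close>

definition polyfun :: "(real \<Rightarrow> real) \<Rightarrow> bool" where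
  "polyfun f \<longleftrightarrow> (\<exists>p. f = poly p)"

lemma polyfun_const [simp]: "polyfun (\<lambda>t. c)"
  by (auto simp: polyfun_def fun_eq_iff intro: exI[of _ "[:c:]"])

lemma polyfun_id [simp]: "polyfun (\<lambda>t. t)"
  by (auto simp: polyfun_def fun_eq_iff intro: exI[of _ "[:0, 1:]"])

lemma polyfun_add: "polyfun f \<Longrightarrow> polyfun g \<Longrightarrow> polyfun (\<lambda>t. f t + g t)"
  unfolding polyfun_def fun_eq_iff by (metis poly_add)

lemma polyfun_diff: "polyfun f \<Longrightarrow> polyfun g \<Longrightarrow> polyfun (\<lambda>t. f t - g t)"
  unfolding polyfun_def fun_eq_iff by (metis poly_diff)

lemma polyfun_mult: "polyfun f \<Longrightarrow> polyfun g \<Longrightarrow> polyfun (\<lambda>t. f t * g t)"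
  unfolding polyfun_def fun_eq_iff by (metis poly_mult)

lemma polyfun_power: "polyfun f \<Longrightarrow> polyfun (\<lambda>t. f t ^ n)"
  unfolding polyfun_def fun_eq_iff by (metis poly_power)

lemma polyfun_divide_const: "polyfun f \<Longrightarrow> polyfun (\<lambda>t. f t / c)"
  using polyfun_mult[of f "\<lambda>_. 1 / c"] by simp

lemma polyfun_sum: "(\<And>i. i \<in> A \<Longrightarrow> polyfun (f i)) \<Longrightarrow> polyfun (\<lambda>t. \<Sum>i\<in>A. f i t)"
  by (induction A rule: infinite_finite_induct) (auto intro: polyfun_add)

lemma polyfun_prod: "(\<And>i. i \<in> A \<Longrightarrow> polyfun (f i)) \<Longrightarrow> polyfun (\<lambda>t. \<Prod>i\<in>A. f i t)"
  by (induction A rule: infinite_finite_induct) (auto intro: polyfun_mult)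

lemma polyfun_det:
  assumes "\<And>i j. polyfun (\<lambda>t. A t $ i $ j)"
  shows "polyfun (\<lambda>t. det (A t))"
  unfolding det_def by (intro polyfun_sum polyfun_mult polyfun_prod polyfun_const assms)

lemma polyfun_matrix_mult:
  assumes "\<And>i j. polyfun (\<lambda>t. A t $ i $ j)" "\<And>i j. polyfun (\<lambda>t. B t $ i $ j)"
  shows "polyfun (\<lambda>t. (A t ** B t) $ i $ j)"
  unfolding matrix_matrix_mult_def by (simp add: polyfun_sum polyfun_mult assms)

lemma polyfun_zero_near:
  assumes "polyfun f" "\<forall>\<^sub>F t in at 0. f t = 0"
  shows "f t = 0"
proof -
  obtain p where p: "f = poly p" using assms(1) by (auto simp: polyfun_def)
  obtain d where d: "d > 0" "\<And>t. t \<noteq> 0 \<Longrightarrow> dist t 0 < d \<Longrightarrow> f t = 0"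
    using assms(2) by (auto simp: eventually_at)
  have "{0<..<d} \<subseteq> {t. poly p t = 0}"
    using d(2) by (auto simp: p)
  moreover have "infinite {0<..<d}" using d(1) by simp
  ultimately have "infinite {t. poly p t = 0}" using finite_subset by blast
  then have "p = 0" using poly_roots_finite by blast
  then show ?thesis by (simp add: p)
qed

section \<open>Three-forms as tensors\<close>

text \<open>Component arrays form a type \<open>real^'n\<close>, on which determinants, matrices and
  derivatives are available. The 3-forms correspond to the fixed points of the projection
  \<open>skew\<close>.\<close>

type_synonym tensor = "real^(8 \<times> 8 \<times> 8)"

definition form_of :: "tensor \<Rightarrow> (real^8) list \<Rightarrow> real" where
  "form_of W xs = (if length xs = 3 then
     \<Sum>i\<in>UNIV. \<Sum>j\<in>UNIV. \<Sum>k\<in>UNIV. W $ (i, j, k) * (xs ! 0 $ i * (xs ! 1 $ j * xs ! 2 $ k)) else 0)"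

definition tensor_of :: "((real^8) list \<Rightarrow> real) \<Rightarrow> tensor" where
  "tensor_of \<omega> = (\<chi> q. \<omega> [axis (fst q) 1, axis (fst (snd q)) 1, axis (snd (snd q)) 1])"

definition skew :: "tensor \<Rightarrow> tensor" where
  "skew W = (\<chi> q. case q of (i, j, k) \<Rightarrow>
     (W $ (i, j, k) + W $ (j, k, i) + W $ (k, i, j)
       - W $ (j, i, k) - W $ (i, k, j) - W $ (k, j, i)) / 6)"

lemma tensor_of_nth [simp]: "tensor_of \<omega> $ (i, j, k) = \<omega> [axis i 1, axis j 1, axis k 1]"
  by (simp add: tensor_of_def)

lemma skew_nth: "skew W $ (i, j, k) = (W $ (i, j, k) + W $ (j, k, i) + W $ (k, i, j)
       - W $ (j, i, k) - W $ (i, k, j) - W $ (k, j, i)) / 6"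
  by (simp add: skew_def)

lemma tensor_eq_iff: "(W :: tensor) = V \<longleftrightarrow> (\<forall>i j k. W $ (i, j, k) = V $ (i, j, k))"
  by (simp add: vec_eq_iff)

lemma linear_skew: "linear skew"
  by (rule linearI) (simp_all add: tensor_eq_iff skew_nth algebra_simps add_divide_distrib diff_divide_distrib)

lemma skew_skew [simp]: "skew (skew W) = skew W"
  by (simp add: tensor_eq_iff skew_nth field_simps)

lemma skew_swap:
  assumes "skew W = W"
  shows "W $ (j, i, k) = - W $ (i, j, k)" "W $ (i, k, j) = - W $ (i, j, k)"
proof -
  have "skew W $ (j, i, k) = - skew W $ (i, j, k)" "skew W $ (i, k, j) = - skew W $ (i, j, k)"
    by (simp_all add: skew_nth field_simps)
  then show "W $ (j, i, k) = - W $ (i, j, k)" "W $ (i, k, j) = - W $ (i, j, k)"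
    by (simp_all add: assms)
qed

lemma length3_obtain:
  assumes "length xs = 3" obtains x y z where "xs = [x, y, z]"
  using assms by (auto simp: eval_nat_numeral length_Suc_conv)

lemma alt3_basis_expansion:
  fixes \<omega> :: "(real^8) list \<Rightarrow> real"
  assumes \<omega>: "\<omega> \<in> alt_forms 3"
  shows "\<omega> [x, y, z] = (\<Sum>i\<in>UNIV. \<Sum>j\<in>UNIV. \<Sum>k\<in>UNIV.
    \<omega> [axis i 1, axis j 1, axis k 1] * (x $ i * (y $ j * z $ k)))"
proof -
  have l1: "linear (\<lambda>v. \<omega> [v, b, c])" for b c
    using alt_forms_linear[OF \<omega>, of "[]" "[b, c]"] by simp
  have l2: "linear (\<lambda>v. \<omega> [a, v, c])" for a c
    using alt_forms_linear[OF \<omega>, of "[a]" "[c]"] by simp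
  have l3: "linear (\<lambda>v. \<omega> [a, b, v])" for a b
    using alt_forms_linear[OF \<omega>, of "[a, b]" "[]"] by simp
  have e: "f v = (\<Sum>i\<in>UNIV. v $ i * f (axis i 1))" if "linear f" for f :: "real^8 \<Rightarrow> real" and v
  proof -
    have "f v = f (\<Sum>i\<in>UNIV. v $ i *\<^sub>R axis i 1)"
      using basis_expansion[of v] by (simp add: scalar_mult_eq_scaleR)
    then show ?thesis by (simp add: linear_sum[OF that] linear_scale[OF that])
  qed
  have "\<omega> [x, y, z] = (\<Sum>i\<in>UNIV. x $ i * (\<Sum>j\<in>UNIV. y $ j * (\<Sum>k\<in>UNIV. z $ k *
    \<omega> [axis i 1, axis j 1, axis k 1])))"
    by (subst e[OF l1], subst e[OF l2], subst e[OF l3]) simp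
  then show ?thesis by (simp add: sum_distrib_left mult_ac)
qed

lemma form_of_tensor_of:
  assumes \<omega>: "\<omega> \<in> alt_forms 3"
  shows "form_of (tensor_of \<omega>) = \<omega>"
proof
  fix xs
  show "form_of (tensor_of \<omega>) xs = \<omega> xs"
  proof (cases "length xs = 3")
    case True
    then obtain x y z where "xs = [x, y, z]" by (rule length3_obtain)
    then show ?thesis by (simp add: form_of_def alt3_basis_expansion[OF \<omega>, of x y z])
  qed (simp add: form_of_def alt_forms_length[OF \<omega>])
qed

lemma tensor_of_form_of [simp]: "tensor_of (form_of W) = W"
proof -
  have "form_of W [axis i 1, axis j 1, axis k 1] = W $ (i, j, k)" for i j k
    by (simp add: form_of_def axis_def if_distrib[where f = "\<lambda>x. _ * x"] cong: if_cong)
  then show ?thesis by (simp add: tensor_eq_iff)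
qed

lemma skew_tensor_of:
  assumes \<omega>: "\<omega> \<in> alt_forms 3"
  shows "skew (tensor_of \<omega>) = tensor_of \<omega>"
proof -
  have 1: "\<omega> [b, a, c] = - \<omega> [a, b, c]" for a b c
    using alt_forms_swap[OF \<omega>, of "[]" b a "[c]"] by simp
  have 2: "\<omega> [a, c, b] = - \<omega> [a, b, c]" for a b c
    using alt_forms_swap[OF \<omega>, of "[a]" c b "[]"] by simp
  have "skew (tensor_of \<omega>) $ (i, j, k) = tensor_of \<omega> $ (i, j, k)" for i j k
  proof -
    define a b c where "a = axis i (1 :: real)" and "b = axis j (1 :: real)" and "c = axis k (1 :: real)"
    show ?thesis
      using 1[of b a c] 2[of a c b] 1[of b c a] 2[of b a c] 1[of c a b] 2[of c b a]
      unfolding skew_nth tensor_of_nth a_def[symmetric] b_def[symmetric] c_def[symmetric] by argo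
  qed
  then show ?thesis unfolding tensor_eq_iff by blast
qed

lemma form_of_alt_forms:
  assumes W: "skew W = W"
  shows "form_of W \<in> alt_forms 3"
proof (rule alt_formsI)
  fix xs ys :: "(real^8) list" assume "length xs + length ys + 1 = 3"
  then consider (1) b c where "xs = []" "ys = [b, c]" | (2) a c where "xs = [a]" "ys = [c]"
    | (3) a b where "xs = [a, b]" "ys = []"
    by (cases xs; cases ys; cases "tl xs"; cases "tl ys") (auto simp: length_Suc_conv)
  then show "linear (\<lambda>v. form_of W (xs @ v # ys))"
    by cases (auto intro!: linearI simp: form_of_def algebra_simps sum.distrib sum_distrib_left)
next
  fix xs :: "(real^8) list" assume "length xs = 3" "\<not> distinct xs"
  then obtain x y z where xs: "xs = [x, y, z]" and eq: "x = y \<or> y = z \<or> x = z"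
    by (auto elim!: length3_obtain)
  define F where "F x y z = (\<Sum>i\<in>UNIV. \<Sum>j\<in>UNIV. \<Sum>k\<in>UNIV. W $ (i, j, k) * (x $ i * (y $ j * z $ k)))"
    for x y z :: "real^8"
  \<comment> \<open>An exchange of two vectors is absorbed by renaming summation indices, at the
    price of the sign from the skewness of \<open>W\<close>.\<close>
  have F1: "F x y z = - F y x z" for x y z
  proof -
    have "F x y z = (\<Sum>j\<in>UNIV. \<Sum>i\<in>UNIV. \<Sum>k\<in>UNIV. W $ (i, j, k) * (x $ i * (y $ j * z $ k)))"
      unfolding F_def by (rule sum.swap)
    also have "\<dots> = (\<Sum>j\<in>UNIV. \<Sum>i\<in>UNIV. \<Sum>k\<in>UNIV. - (W $ (j, i, k) * (y $ j * (x $ i * z $ k))))"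
    proof (intro sum.cong refl)
      fix i j k show "W $ (i, j, k) * (x $ i * (y $ j * z $ k)) = - (W $ (j, i, k) * (y $ j * (x $ i * z $ k)))"
        using skew_swap(1)[OF W, of i j k] by simp
    qed
    finally show ?thesis by (simp add: F_def sum_negf)
  qed
  have F2: "F x y z = - F x z y" for x y z
  proof -
    have "F x y z = (\<Sum>i\<in>UNIV. \<Sum>k\<in>UNIV. \<Sum>j\<in>UNIV. W $ (i, j, k) * (x $ i * (y $ j * z $ k)))"
      unfolding F_def by (intro sum.cong refl sum.swap)
    also have "\<dots> = (\<Sum>i\<in>UNIV. \<Sum>k\<in>UNIV. \<Sum>j\<in>UNIV. - (W $ (i, k, j) * (x $ i * (z $ k * y $ j))))"
    proof (intro sum.cong refl)
      fix i j k show "W $ (i, j, k) * (x $ i * (y $ j * z $ k)) = - (W $ (i, k, j) * (x $ i * (z $ k * y $ j)))"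
        using skew_swap(2)[OF W, of i k j] by simp
    qed
    finally show ?thesis by (simp add: F_def sum_negf)
  qed
  have "F x y z = 0" using eq F1[of x y z] F2[of x y z] F1[of x z y] F2[of z x y] by auto
  then show "form_of W xs = 0" by (simp add: form_of_def xs F_def)
qed (simp add: form_of_def)

section \<open>Equivariant constructions\<close>

definition slices :: "tensor \<Rightarrow> real^(8 \<times> 8)^8" where
  "slices W = (\<chi> a q. W $ (a, q))"

definition unslice :: "real^(8 \<times> 8)^8 \<Rightarrow> tensor" where
  "unslice M = (\<chi> q. M $ fst q $ snd q)"

definition kron :: "real^8^8 \<Rightarrow> real^8^8 \<Rightarrow> real^(8 \<times> 8)^(8 \<times> 8)" where
  "kron A B = (\<chi> p q. A $ fst p $ fst q * B $ snd p $ snd q)"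

lemma unslice_slices [simp]: "unslice (slices W) = W"
  and slices_unslice [simp]: "slices (unslice M) = M"
  by (simp_all add: slices_def unslice_def vec_eq_iff)

lemma sum_UNIV_prod: "(\<Sum>q\<in>(UNIV :: ('a::finite \<times> 'b::finite) set). f q) = (\<Sum>i\<in>UNIV. \<Sum>j\<in>UNIV. f (i, j))"
  by (simp add: sum.cartesian_product flip: UNIV_Times_UNIV)

lemma kron_mult: "kron A B ** kron C D = kron (A ** C) (B ** D)"
  by (simp add: vec_eq_iff kron_def matrix_matrix_mult_def sum_UNIV_prod sum_product mult_ac)

lemma transpose_kron: "transpose (kron A B) = kron (transpose A) (transpose B)"
  by (simp add: vec_eq_iff kron_def transpose_def)

lemma kron_scaleR: "kron (c *\<^sub>R A) (d *\<^sub>R B) = (c * d) *\<^sub>R kron A B"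
  by (simp add: vec_eq_iff kron_def)

text \<open>Flattening a tensor to an 8 by 64 matrix turns the substitution of \<open>H\<close> into
  all three arguments into multiplication on both sides, so that equivariance becomes matrix
  algebra.\<close>

definition pull_tensor :: "real^8^8 \<Rightarrow> tensor \<Rightarrow> tensor" where
  "pull_tensor H W = unslice (transpose H ** slices W ** kron H H)"

lemma slices_pull: "slices (pull_tensor H W) = transpose H ** slices W ** kron H H"
  by (simp add: pull_tensor_def)

lemma pull_tensor_nth:
  "pull_tensor H W $ (i, j, k) =
    (\<Sum>a\<in>UNIV. \<Sum>b\<in>UNIV. \<Sum>c\<in>UNIV. W $ (a, b, c) * (H $ a $ i * (H $ b $ j * H $ c $ k)))"
proof -
  have "pull_tensor H W $ (i, j, k) =
     (\<Sum>b\<in>UNIV. \<Sum>c\<in>UNIV. \<Sum>a\<in>UNIV. W $ (a, b, c) * (H $ a $ i * (H $ b $ j * H $ c $ k)))"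
    by (simp add: pull_tensor_def unslice_def slices_def kron_def matrix_matrix_mult_def sum_UNIV_prod
       transpose_def sum_distrib_right sum_distrib_left mult_ac)
  also have "\<dots> = (\<Sum>b\<in>UNIV. \<Sum>a\<in>UNIV. \<Sum>c\<in>UNIV. W $ (a, b, c) * (H $ a $ i * (H $ b $ j * H $ c $ k)))"
    by (intro sum.cong refl sum.swap)
  also have "\<dots> = (\<Sum>a\<in>UNIV. \<Sum>b\<in>UNIV. \<Sum>c\<in>UNIV. W $ (a, b, c) * (H $ a $ i * (H $ b $ j * H $ c $ k)))"
    by (rule sum.swap)
  finally show ?thesis .
qed

lemma pull_tensor_mult: "pull_tensor H (pull_tensor K W) = pull_tensor (K ** H) W"
  by (simp add: pull_tensor_def matrix_mul_assoc matrix_transpose_mul kron_mult)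
    (simp add: matrix_mul_assoc[symmetric] kron_mult)

lemma kron_mat_1: "kron (mat 1) (mat 1) = mat 1"
  by (auto simp: vec_eq_iff kron_def mat_def prod_eq_iff)

lemma pull_tensor_id [simp]: "pull_tensor (mat 1) W = W"
  by (simp add: pull_tensor_def kron_mat_1 transpose_mat)

lemma linear_pull_tensor: "linear (pull_tensor H)"
  by (rule linearI) (simp_all add: tensor_eq_iff pull_tensor_nth algebra_simps sum.distrib sum_distrib_left)

lemma pull_form_of: "pull ((*v) H) (form_of W) = form_of (pull_tensor H W)"
proof
  fix xs
  show "pull ((*v) H) (form_of W) xs = form_of (pull_tensor H W) xs"
  proof (cases "length xs = 3")
    case True
    then obtain x y z where xs: "xs = [x, y, z]" by (rule length3_obtain)
    let ?f = "\<lambda>a b c i j k. W $ (a, b, c) * (H $ a $ i * (H $ b $ j * H $ c $ k)) * (x $ i * (y $ j * z $ k))"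
    have sw: "(\<Sum>i\<in>UNIV. \<Sum>p\<in>UNIV. g p i) = (\<Sum>p\<in>UNIV. \<Sum>i\<in>UNIV. g p i)" for g :: "8 \<times> 8 \<times> 8 \<Rightarrow> 8 \<times> 8 \<times> 8 \<Rightarrow> real"
      by (rule sum.swap)
    have "form_of (pull_tensor H W) xs =
      (\<Sum>q\<in>UNIV. \<Sum>p\<in>UNIV. ?f (fst p) (fst (snd p)) (snd (snd p)) (fst q) (fst (snd q)) (snd (snd q)))"
      by (simp add: form_of_def xs pull_tensor_nth sum_UNIV_prod sum_distrib_right)
    also have "\<dots> = (\<Sum>p\<in>UNIV. \<Sum>q\<in>UNIV. ?f (fst p) (fst (snd p)) (snd (snd p)) (fst q) (fst (snd q)) (snd (snd q)))"
      by (rule sw)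
    also have "\<dots> = pull ((*v) H) (form_of W) xs"
    proof -
      have prod3: "(\<Sum>i\<in>UNIV. f i) * ((\<Sum>j\<in>UNIV. g j) * (\<Sum>k\<in>UNIV. h k)) =
          (\<Sum>i\<in>UNIV. \<Sum>j\<in>UNIV. \<Sum>k\<in>UNIV. f i * (g j * h k))" for f g h :: "8 \<Rightarrow> real"
        unfolding sum_product unfolding sum_distrib_left ..
      have "(H *v x) $ i * ((H *v y) $ j * (H *v z) $ k) =
          (\<Sum>a\<in>UNIV. \<Sum>b\<in>UNIV. \<Sum>c\<in>UNIV. (H $ i $ a * x $ a) * ((H $ j $ b * y $ b) * (H $ k $ c * z $ c)))" for i j k
        by (simp only: matrix_vector_mult_def vec_lambda_beta prod3)
      then have "pull ((*v) H) (form_of W) xs = (\<Sum>i\<in>UNIV. \<Sum>j\<in>UNIV. \<Sum>k\<in>UNIV. W $ (i, j, k) *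
          (\<Sum>a\<in>UNIV. \<Sum>b\<in>UNIV. \<Sum>c\<in>UNIV. (H $ i $ a * x $ a) * ((H $ j $ b * y $ b) * (H $ k $ c * z $ c))))"
        by (simp add: pull_def form_of_def xs)
      then show ?thesis by (simp add: sum_UNIV_prod sum_distrib_left mult_ac)
    qed
    finally show ?thesis ..
  qed (simp add: pull_def form_of_def)
qed

text \<open>The projection is a combination of composites of the two adjacent index exchanges
  \<open>s12\<close> and \<open>s23\<close>, and pull-back commutes with both because it treats all
  three indices alike.\<close>

lemma skew_pull: "skew (pull_tensor H W) = pull_tensor H (skew W)"
proof -
  have swap12: "pull_tensor H (\<chi> q. W $ (fst (snd q), fst q, snd (snd q))) $ (i, j, k) = pull_tensor H W $ (j, i, k)" for W i j k
    unfolding pull_tensor_nth by (subst sum.swap) (simp add: mult_ac)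
  have swap23: "pull_tensor H (\<chi> q. W $ (fst q, snd (snd q), fst (snd q))) $ (i, j, k) = pull_tensor H W $ (i, k, j)" for W i j k
    unfolding pull_tensor_nth by (rule sum.cong[OF refl], rule trans[OF sum.swap], rule sum.cong[OF refl], rule sum.cong[OF refl])
      (simp add: mult_ac)
  define s12 where "s12 W = (\<chi> q. W $ (fst (snd q), fst q, snd (snd q)))" for W :: tensor
  define s23 where "s23 W = (\<chi> q. W $ (fst q, snd (snd q), fst (snd q)))" for W :: tensor
  have n: "s12 W $ (i, j, k) = W $ (j, i, k)" "s23 W $ (i, j, k) = W $ (i, k, j)" for W i j k
    by (simp_all add: s12_def s23_def)
  have p: "pull_tensor H (s12 W) = s12 (pull_tensor H W)" "pull_tensor H (s23 W) = s23 (pull_tensor H W)" for W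
    using swap12[of W] swap23[of W] by (simp_all add: tensor_eq_iff n flip: s12_def s23_def)
  have sk: "skew W = (1/6) *\<^sub>R (W + s12 (s23 W) + s23 (s12 W) - s12 W - s23 W - s12 (s23 (s12 W)))" for W
    by (simp add: tensor_eq_iff skew_nth n)
  show ?thesis
    unfolding sk linear_scale[OF linear_pull_tensor] linear_add[OF linear_pull_tensor]
      linear_diff[OF linear_pull_tensor] p ..
qed

section \<open>The Gram matrix of the trace form, its determinant and its adjugate\<close>

definition gram :: "tensor \<Rightarrow> real^8^8" where
  "gram W = (\<chi> i j. trace_form8 (form_of W) (axis i 1) (axis j 1))"

text \<open>Cramer's form of the adjugate, chosen because its entries are visibly polynomial in
  those of \<open>A\<close>.\<close>

definition adjugate :: "real^8^8 \<Rightarrow> real^8^8" where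
  "adjugate A = (\<chi> k i. det (\<chi> r c. if c = k then axis i 1 $ r else A $ r $ c))"

lemma adjugate_eq:
  assumes K: "A ** K = mat 1"
  shows "adjugate A = det A *\<^sub>R K"
proof -
  have "adjugate A $ k $ i = K $ k $ i * det A" for k i
  proof -
    have 1: "A *v (K *v axis i 1) = axis i 1" by (simp add: matrix_vector_mul_assoc K)
    have 2: "(K *v axis i 1) $ k = K $ k $ i" by (simp add: matrix_vector_mult_basis column_def)
    show ?thesis
      using cramer_lemma[of k A "K *v axis i 1"] unfolding 1 2 by (simp add: adjugate_def)
  qed
  then show ?thesis by (simp add: vec_eq_iff)
qed

lemma trace_form8_gram:
  assumes W: "skew W = W"
  shows "trace_form8 (form_of W) v w = v \<bullet> (gram W *v w)"
proof -
  note \<omega> = form_of_alt_forms[OF W]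
  have mult: "matrix (smul (form_of W) (\<Sum>i\<in>UNIV. v $ i *\<^sub>R axis i 1)) = (\<Sum>i\<in>UNIV. v $ i *\<^sub>R matrix (smul (form_of W) (axis i 1)))" for v
    by (simp add: vec_eq_iff matrix_def linear_sum[OF linear_smul_left[OF \<omega>]] linear_scale[OF linear_smul_left[OF \<omega>]])
  have v: "(\<Sum>i\<in>UNIV. v $ i *\<^sub>R axis i 1) = v" for v :: "real^8"
    using basis_expansion[of v] by (simp add: scalar_mult_eq_scaleR)
  have exp: "matrix (smul (form_of W) v) = (\<Sum>i\<in>UNIV. v $ i *\<^sub>R matrix (smul (form_of W) (axis i 1)))" for v
    using mult[of v] unfolding v .
  have "trace_form8 (form_of W) v w = (\<Sum>i\<in>UNIV. \<Sum>j\<in>UNIV. v $ i * w $ j * trace_form8 (form_of W) (axis i 1) (axis j 1))"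
  proof -
    have lin: "trace ((\<Sum>i\<in>UNIV. a i *\<^sub>R A i) ** (\<Sum>j\<in>UNIV. b j *\<^sub>R B j)) =
      (\<Sum>i\<in>UNIV. \<Sum>j\<in>UNIV. a i * b j * trace (A i ** B j))" for a b :: "8 \<Rightarrow> real" and A B :: "8 \<Rightarrow> real^8^8"
    proof -
      have tl: "linear (\<lambda>X :: real^8^8. trace (X ** Y))" for Y
        by (rule linearI) (simp_all add: trace_def matrix_matrix_mult_def sum.distrib sum_distrib_left algebra_simps)
      have tr: "linear (\<lambda>Y :: real^8^8. trace (X ** Y))" for X
        by (rule linearI) (simp_all add: trace_def matrix_matrix_mult_def sum.distrib sum_distrib_left algebra_simps)
      show ?thesis
        unfolding linear_sum[OF tl] linear_scale[OF tl]
        unfolding linear_sum[OF tr] linear_scale[OF tr]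
        by (simp add: sum_distrib_left mult.assoc)
    qed
    show ?thesis unfolding trace_form8_def by (subst (1) exp, subst (2) exp, rule lin)
  qed
  also have "\<dots> = v \<bullet> (gram W *v w)"
    by (simp add: inner_vec_def matrix_vector_mult_def gram_def sum_distrib_left mult_ac)
  finally show ?thesis .
qed

lemma gram_pull:
  assumes W: "skew W = W" and H: "det H \<noteq> 0"
  shows "gram (pull_tensor H W) = (det H)\<^sup>2 *\<^sub>R (transpose H ** gram W ** H)"
proof -
  have "gram (pull_tensor H W) $ i $ j = ((det H)\<^sup>2 *\<^sub>R (transpose H ** gram W ** H)) $ i $ j" for i j
  proof -
    have "gram (pull_tensor H W) $ i $ j = (det H)\<^sup>2 * ((H *v axis i 1) \<bullet> (gram W *v (H *v axis j 1)))"
    proof -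
      have "gram (pull_tensor H W) $ i $ j = trace_form8 (form_of (pull_tensor H W)) (axis i 1) (axis j 1)"
        by (simp add: gram_def)
      then show ?thesis
        by (simp only: pull_form_of[symmetric] trace_form8_pull[OF form_of_alt_forms[OF W] H] trace_form8_gram[OF W])
    qed
    also have "(H *v axis i 1) \<bullet> (gram W *v (H *v axis j 1)) =
        (transpose H *v (gram W *v (H *v axis j 1))) \<bullet> axis i 1"
      by (simp only: transpose_matrix_vector dot_lmul_matrix inner_commute[of "H *v axis i 1"])
    also have "\<dots> = axis i 1 \<bullet> ((transpose H ** gram W ** H) *v axis j 1)"
      by (simp add: inner_commute matrix_vector_mul_assoc matrix_mul_assoc)
    also have "\<dots> = (transpose H ** gram W ** H) $ i $ j"
      by (simp add: inner_axis' matrix_vector_mult_basis column_def)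
    finally show ?thesis by simp
  qed
  then show ?thesis by (simp add: vec_eq_iff)
qed

lemma det_scaleR: "det (c *\<^sub>R A) = c ^ CARD('n) * det (A :: real^'n^'n)"
proof -
  have "c *\<^sub>R A = mat c ** A"
    by (simp add: vec_eq_iff matrix_matrix_mult_def mat_def if_distrib[where f = "\<lambda>x. x * _"] cong: if_cong)
  then show ?thesis by (simp add: det_mul det_diagonal mat_def)
qed

text \<open>The exponent is 2 * 8 from the scalar \<open>(det H)\<^sup>2\<close> in front of an 8 by
  8 matrix, plus 2 from the factors \<open>H\<close> and \<open>transpose H\<close>.\<close>

lemma det_gram_pull:
  assumes W: "skew W = W" and H: "det H \<noteq> 0"
  shows "det (gram (pull_tensor H W)) = det H ^ 18 * det (gram W)"
  by (simp add: gram_pull[OF assms] det_scaleR det_mul det_transpose power_mult[symmetric])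
    (simp add: eval_nat_numeral)

lemma matrix_mult_scaleR_left: "(c *\<^sub>R A) ** (B :: real^'m^'k) = c *\<^sub>R (A ** B)"
  and matrix_mult_scaleR_right: "(A :: real^'k^'l) ** (c *\<^sub>R B) = c *\<^sub>R (A ** B)"
  by (simp_all add: vec_eq_iff matrix_matrix_mult_def sum_distrib_left mult_ac)

text \<open>The adjugate is the determinant, of weight 18, times the inverse, of weight -2. Its
  transformation by \<open>H\<close> is contragredient to that of the Gram matrix; here
  \<open>H\<close> is kept on the side where no inverse appears.\<close>

lemma adjugate_gram_pull:
  assumes W: "skew W = W" and H: "det H \<noteq> 0" and B: "det (gram W) \<noteq> 0"
  shows "H ** adjugate (gram (pull_tensor H W)) ** transpose H = det H ^ 16 *\<^sub>R adjugate (gram W)"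
proof -
  obtain L where L: "H ** L = mat 1" "L ** H = mat 1"
    using H by (metis invertible_det_nz invertible_def)
  obtain K where K: "gram W ** K = mat 1"
    using B by (metis invertible_det_nz invertible_def)
  have TL: "transpose H ** transpose L = mat 1" "transpose L ** transpose H = mat 1"
    using L by (metis matrix_transpose_mul transpose_mat)+
  have eqs: "L ** (H ** X) = X" "H ** (L ** X) = X" "gram W ** (K ** X) = X"
    "transpose H ** (transpose L ** X) = X" "transpose L ** (transpose H ** X) = X" for X :: "real^8^8"
    by (simp_all add: matrix_mul_assoc L K TL)
  have "gram (pull_tensor H W) ** ((1 / (det H)\<^sup>2) *\<^sub>R (L ** K ** transpose L)) = mat 1"
    using H by (simp add: gram_pull[OF W H] matrix_mult_scaleR_left matrix_mult_scaleR_right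
        matrix_mul_assoc[symmetric] eqs TL)
  from adjugate_eq[OF this]
  have "adjugate (gram (pull_tensor H W)) = (det H ^ 16 * det (gram W)) *\<^sub>R (L ** K ** transpose L)"
    using H by (simp add: det_gram_pull[OF W H] power2_eq_square eval_nat_numeral)
  then show ?thesis
    by (simp add: adjugate_eq[OF K] matrix_mult_scaleR_left matrix_mult_scaleR_right
        matrix_mul_assoc[symmetric] eqs TL)
qed

text \<open>The matrix acts on the first index only and \<open>skew\<close> restores the symmetry.
  Up to the factor 3 and a transposition this is the derivative of the pull-back at the identity, as
  \<open>pull_tensor_has_derivative\<close> shows.\<close>

definition inf_act :: "real^8^8 \<Rightarrow> tensor \<Rightarrow> tensor" where
  "inf_act A W = skew (unslice (A ** slices W))"

text \<open>Up to a power of the determinant of \<open>gram W\<close>, this is the adjoint of \<open>A \<mapsto> inf_act A W\<close>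
  with respect to the inner products induced by \<open>gram W\<close>.\<close>

definition inf_act_adj :: "tensor \<Rightarrow> tensor \<Rightarrow> real^8^8" where
  "inf_act_adj W \<sigma> = slices \<sigma> ** kron (adjugate (gram W)) (adjugate (gram W)) ** transpose (slices W)
     ** adjugate (gram W)"

definition inf_endo :: "tensor \<Rightarrow> tensor \<Rightarrow> tensor" where
  "inf_endo W \<sigma> = inf_act (inf_act_adj W \<sigma>) W"

lemma slices_add: "slices (A + B) = slices A + slices B"
  and slices_scaleR: "slices (c *\<^sub>R A) = c *\<^sub>R slices A"
  and unslice_scaleR: "unslice (c *\<^sub>R M) = c *\<^sub>R unslice M"
  and unslice_add: "unslice (M + N) = unslice M + unslice N"
  by (simp_all add: slices_def unslice_def vec_eq_iff)

lemma matrix_mult_add_left: "(A + B) ** C = A ** C + B ** (C :: real^'m^'k)"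
  by (simp add: vec_eq_iff matrix_matrix_mult_def algebra_simps sum.distrib)

lemma linear_inf_endo: "linear (inf_endo W)"
  by (rule linearI)
    (simp_all add: inf_endo_def inf_act_def inf_act_adj_def slices_add slices_scaleR unslice_scaleR unslice_add
      matrix_mult_add_left matrix_mult_scaleR_left linear_add[OF linear_skew] linear_scale[OF linear_skew])

lemma skew_inf_endo [simp]: "skew (inf_endo W \<sigma>) = inf_endo W \<sigma>"
  by (simp add: inf_endo_def inf_act_def)

text \<open>Every adjugate in the formula stands between an \<open>H\<close> and its transpose, so
  \<open>adjugate_gram_pull\<close> applies three times and gives the exponent 3 * 16.\<close>

lemma inf_endo_pull:
  assumes W: "skew W = W" and H: "det H \<noteq> 0" and B: "det (gram W) \<noteq> 0"
  shows "inf_endo (pull_tensor H W) (pull_tensor H \<sigma>) = det H ^ 48 *\<^sub>R pull_tensor H (inf_endo W \<sigma>)"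
proof -
  let ?C = "adjugate (gram W)" and ?C' = "adjugate (gram (pull_tensor H W))"
  let ?k = "kron H H"
  have C: "H ** ?C' ** transpose H = det H ^ 16 *\<^sub>R ?C"
    by (rule adjugate_gram_pull[OF assms])
  have CC: "?k ** kron ?C' ?C' ** transpose ?k = det H ^ 32 *\<^sub>R kron ?C ?C"
    by (simp add: transpose_kron kron_mult C kron_scaleR flip: power_add)
  have "inf_act_adj (pull_tensor H W) (pull_tensor H \<sigma>) ** slices (pull_tensor H W) =
      transpose H ** slices \<sigma> ** (?k ** kron ?C' ?C' ** transpose ?k) ** transpose (slices W)
        ** (H ** ?C' ** transpose H) ** slices W ** ?k"
    unfolding inf_act_adj_def slices_pull by (simp add: matrix_transpose_mul matrix_mul_assoc)
  also have "\<dots> = det H ^ 48 *\<^sub>R (transpose H ** (inf_act_adj W \<sigma> ** slices W) ** ?k)"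
    unfolding C CC inf_act_adj_def
    by (simp add: matrix_mult_scaleR_left matrix_mult_scaleR_right matrix_mul_assoc flip: power_add)
  finally have "inf_endo (pull_tensor H W) (pull_tensor H \<sigma>) =
      skew (det H ^ 48 *\<^sub>R pull_tensor H (unslice (inf_act_adj W \<sigma> ** slices W)))"
    by (simp add: inf_endo_def inf_act_def unslice_scaleR pull_tensor_def)
  also have "\<dots> = det H ^ 48 *\<^sub>R pull_tensor H (inf_endo W \<sigma>)"
    by (simp add: linear_scale[OF linear_skew] skew_pull inf_endo_def inf_act_def)
  finally show ?thesis .
qed

text \<open>The cube of \<open>inf_endo\<close> and the eighth power of the discriminant have the same weight 144, so
  that this extension to all tensors is again equivariant up to a power of the determinant.\<close>

definition full_endo :: "tensor \<Rightarrow> tensor \<Rightarrow> tensor" where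
  "full_endo W \<sigma> = inf_endo W (inf_endo W (inf_endo W (skew \<sigma>))) + det (gram W) ^ 8 *\<^sub>R (\<sigma> - skew \<sigma>)"

lemma linear_full_endo: "linear (full_endo W)"
  by (rule linearI)
    (simp_all add: full_endo_def linear_add[OF linear_skew] linear_scale[OF linear_skew]
      linear_add[OF linear_inf_endo] linear_scale[OF linear_inf_endo] algebra_simps)

lemma full_endo_pull:
  assumes W: "skew W = W" and H: "det H \<noteq> 0" and B: "det (gram W) \<noteq> 0"
  shows "full_endo (pull_tensor H W) (pull_tensor H \<sigma>) = det H ^ 144 *\<^sub>R pull_tensor H (full_endo W \<sigma>)"
proof -
  have "det (gram (pull_tensor H W)) ^ 8 = det H ^ 144 * det (gram W) ^ 8"
    by (simp add: det_gram_pull[OF W H] power_mult_distrib flip: power_mult)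
  then show ?thesis
    by (simp add: full_endo_def skew_pull inf_endo_pull[OF assms] linear_scale[OF linear_inf_endo]
        linear_add[OF linear_pull_tensor] linear_scale[OF linear_pull_tensor]
        linear_diff[OF linear_pull_tensor] scaleR_add_right flip: power_add)
qed

definition full_det :: "tensor \<Rightarrow> real" where
  "full_det W = det (matrix (full_endo W))"

text \<open>By \<open>full_endo_pull\<close> the two endomorphisms are conjugate, through the
  pull-back, up to the scalar \<open>det H ^ 144\<close>. The determinant of the pull-back itself
  cancels and only the scalar, raised to the dimension, remains.\<close>

lemma full_det_pull:
  assumes W: "skew W = W" and H: "det H \<noteq> 0" and B: "det (gram W) \<noteq> 0"
  shows "full_det (pull_tensor H W) = (det H ^ 144) ^ CARD(8 \<times> 8 \<times> 8) * full_det W"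
proof -
  let ?P = "matrix (pull_tensor H)"
  obtain L where L: "L ** H = mat 1" "H ** L = mat 1"
    using H by (metis invertible_det_nz invertible_def)
  have "pull_tensor L \<circ> pull_tensor H = id"
    by (simp add: fun_eq_iff pull_tensor_mult L)
  then have LP: "matrix (pull_tensor L) ** ?P = mat 1"
    using matrix_compose[OF linear_pull_tensor linear_pull_tensor, of L H] by (simp add: matrix_id_mat_1)
  have "det (matrix (pull_tensor L)) * det ?P = 1"
    by (simp only: det_mul[symmetric] LP det_I)
  then have P: "det ?P \<noteq> 0" by auto
  have "matrix (full_endo (pull_tensor H W)) ** ?P = matrix (full_endo (pull_tensor H W) \<circ> pull_tensor H)"
    by (simp add: matrix_compose linear_pull_tensor linear_full_endo)
  also have "\<dots> = det H ^ 144 *\<^sub>R matrix (pull_tensor H \<circ> full_endo W)"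
    by (simp add: vec_eq_iff matrix_def full_endo_pull[OF assms])
  also have "matrix (pull_tensor H \<circ> full_endo W) = ?P ** matrix (full_endo W)"
    by (simp add: matrix_compose linear_pull_tensor linear_full_endo)
  finally have "full_det (pull_tensor H W) * det ?P = (det H ^ 144) ^ CARD(8 \<times> 8 \<times> 8) * (det ?P * full_det W)"
    unfolding full_det_def by (simp only: det_mul[symmetric] det_scaleR[symmetric])
  then show ?thesis using P by simp
qed

section \<open>Polynomial dependence\<close>

lemma polyfun_uncontract:
  assumes "\<And>ys. polyfun (\<lambda>t. \<Phi> t ys)"
  shows "polyfun (\<lambda>t. uncontract (\<Phi> t) xs $ i)"
  unfolding uncontract_def sum_component vector_scaleR_component real_scaleR_def
  by (intro polyfun_sum polyfun_mult polyfun_const assms)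

lemma polyfun_wedge:
  assumes "\<And>ys. polyfun (\<lambda>t. \<alpha> t ys)" "\<And>ys. polyfun (\<lambda>t. \<beta> t ys)"
  shows "polyfun (\<lambda>t. wedge k l (\<alpha> t) (\<beta> t) xs)"
  unfolding wedge_def
  by (cases "length xs = k + l")
    (simp_all add: polyfun_sum polyfun_mult polyfun_divide_const assms)

text \<open>A curve of 3-forms with polynomial components; it is instantiated by straight lines
  through \<open>su3_tensor\<close>.\<close>

locale polynomial_path =
  fixes W :: "real \<Rightarrow> tensor"
  assumes skew_path: "skew (W t) = W t"
    and polyfun_path: "polyfun (\<lambda>t. W t $ q)"
begin

lemma polyfun_form: "polyfun (\<lambda>t. form_of (W t) xs)"
  unfolding form_of_def
  by (cases "length xs = 3") (simp_all add: polyfun_sum polyfun_mult polyfun_path)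

lemma polyfun_smul: "polyfun (\<lambda>t. smul (form_of (W t)) v w $ i)"
  unfolding smul_def S_map_eq[OF form_of_alt_forms[OF skew_path]] mult_form_def
  by (intro polyfun_uncontract polyfun_wedge) (simp_all add: interior_prod_def polyfun_form)

lemma polyfun_gram: "polyfun (\<lambda>t. gram (W t) $ i $ j)"
  unfolding gram_def trace_form8_def trace_def
  by (simp add: matrix_def matrix_matrix_mult_def polyfun_sum polyfun_mult polyfun_smul)

lemma polyfun_disc: "polyfun (\<lambda>t. det (gram (W t)))"
  by (rule polyfun_det[OF polyfun_gram])

lemma polyfun_adjugate: "polyfun (\<lambda>t. adjugate (gram (W t)) $ i $ j)"
proof -
  have "polyfun (\<lambda>t. (\<chi> r c. if c = i then axis j 1 $ r else gram (W t) $ r $ c) $ r $ c)" for r c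
    by (cases "c = i") (simp_all add: polyfun_gram)
  from polyfun_det[OF this] show ?thesis by (simp add: adjugate_def)
qed

lemma polyfun_skew:
  assumes "\<And>q. polyfun (\<lambda>t. \<sigma> t $ q)"
  shows "polyfun (\<lambda>t. skew (\<sigma> t) $ q)"
  by (cases q) (simp add: skew_nth polyfun_divide_const polyfun_diff polyfun_add assms)

lemma polyfun_inf_endo:
  assumes "\<And>q. polyfun (\<lambda>t. \<sigma> t $ q)"
  shows "polyfun (\<lambda>t. inf_endo (W t) (\<sigma> t) $ q)"
proof -
  have sl: "polyfun (\<lambda>t. slices (\<sigma> t) $ i $ j)" if "\<And>q. polyfun (\<lambda>t. \<sigma> t $ q)" for \<sigma> i j
    by (simp add: slices_def that)
  have tr: "polyfun (\<lambda>t. transpose (A t) $ i $ j)" if "\<And>i j. polyfun (\<lambda>t. A t $ i $ j)"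
    for A :: "real \<Rightarrow> real^(8 \<times> 8)^8" and i j
    by (simp add: transpose_def that)
  have kr: "polyfun (\<lambda>t. kron (adjugate (gram (W t))) (adjugate (gram (W t))) $ i $ j)" for i j
    by (simp add: kron_def polyfun_mult polyfun_adjugate)
  have "polyfun (\<lambda>t. (inf_act_adj (W t) (\<sigma> t) ** slices (W t)) $ i $ j)" for i j
    unfolding inf_act_adj_def
    by (intro polyfun_matrix_mult tr sl kr polyfun_adjugate assms polyfun_path)
  then show ?thesis
    unfolding inf_endo_def inf_act_def by (intro polyfun_skew) (simp add: unslice_def)
qed

lemma polyfun_full_det: "polyfun (\<lambda>t. full_det (W t))"
proof -
  have "polyfun (\<lambda>t. full_endo (W t) \<sigma> $ q)" for \<sigma> q
    unfolding full_endo_def vector_add_component vector_scaleR_component real_scaleR_def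
    by (intro polyfun_add polyfun_mult polyfun_inf_endo polyfun_power polyfun_disc polyfun_const)
  then show ?thesis
    unfolding full_det_def by (intro polyfun_det) (simp add: matrix_def)
qed

lemma polyfun_compat:
  "polyfun (\<lambda>t. trace_form8 (form_of (W t)) (smul (form_of (W t)) a b) c
    - trace_form8 (form_of (W t)) a (smul (form_of (W t)) b c))"
  unfolding trace_form8_gram[OF skew_path] inner_vec_def matrix_vector_mult_def inner_real_def vec_lambda_beta
  by (intro polyfun_diff polyfun_sum polyfun_mult polyfun_smul polyfun_gram polyfun_const)

end

lemma polynomial_path_line:
  assumes "skew A = A" "skew B = B"
  shows "polynomial_path (\<lambda>t. A + t *\<^sub>R (B - A))"
  by unfold_locales
    (simp_all add: linear_add[OF linear_skew] linear_scale[OF linear_skew] linear_diff[OF linear_skew] assms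
      polyfun_add polyfun_mult)

section \<open>Orbits\<close>

text \<open>The right-hand side is the Leibniz rule. Skewness of \<open>W\<close> turns its second
  and third sums into the first one with permuted indices. Since the first is already skew in its
  last two indices, the six terms of \<open>skew\<close> coincide in pairs, which changes the
  denominator 6 into 3.\<close>

lemma pull_tensor_deriv_eq:
  assumes W: "skew W = W"
  shows "3 * inf_act (transpose A) W $ (i, j, k) =
    (\<Sum>a\<in>UNIV. A $ a $ i * W $ (a, j, k)) + (\<Sum>b\<in>UNIV. A $ b $ j * W $ (i, b, k)) + (\<Sum>c\<in>UNIV. A $ c $ k * W $ (i, j, c))"
proof -
  define X where "X i j k = (\<Sum>a\<in>UNIV. A $ a $ i * W $ (a, j, k))" for i j k
  have X: "X i k j = - X i j k" for i j k
  proof -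
    have "A $ a $ i * W $ (a, k, j) = - (A $ a $ i * W $ (a, j, k))" for a
      using skew_swap(2)[OF W, of a k j] by simp
    then show ?thesis by (simp add: X_def sum_negf)
  qed
  have Y: "(\<Sum>b\<in>UNIV. A $ b $ j * W $ (i, b, k)) = - X j i k"
  proof -
    have "A $ b $ j * W $ (i, b, k) = - (A $ b $ j * W $ (b, i, k))" for b
      using skew_swap(1)[OF W, of b i k] by simp
    then show ?thesis by (simp add: X_def sum_negf)
  qed
  have Z: "(\<Sum>c\<in>UNIV. A $ c $ k * W $ (i, j, c)) = X k i j"
  proof -
    have "W $ (i, j, c) = W $ (c, i, j)" for c
      using skew_swap(1)[OF W, of c i j] skew_swap(2)[OF W, of i c j] by simp
    then show ?thesis by (simp add: X_def)
  qed
  have "unslice (transpose A ** slices W) $ (i, j, k) = X i j k" for i j k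
    by (simp add: unslice_def slices_def matrix_matrix_mult_def transpose_def X_def)
  then have "3 * inf_act (transpose A) W $ (i, j, k) = X i j k - X j i k + X k i j"
    using X[of i j k] X[of j i k] X[of k i j] by (simp add: inf_act_def skew_nth)
  then show ?thesis unfolding Y Z by (simp add: X_def)
qed

lemma bounded_linear_entry: "bounded_linear (\<lambda>H :: real^'m^'k. H $ a $ i)"
  by (rule bounded_linear_compose[OF bounded_linear_vec_nth bounded_linear_vec_nth])

lemma pull_tensor_has_derivative:
  assumes W: "skew W = W"
  shows "((\<lambda>H. pull_tensor H W) has_derivative (\<lambda>A. 3 *\<^sub>R inf_act (transpose A) W)) (at (mat 1))"
proof -
  have "((\<lambda>H. pull_tensor H W $ (i, j, k)) has_derivative (\<lambda>A. 3 * inf_act (transpose A) W $ (i, j, k))) (at (mat 1))"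
    for i j k
  proof -
    have entry: "((\<lambda>H :: real^8^8. H $ a $ i) has_derivative (\<lambda>A. A $ a $ i)) (at (mat 1))" for a i
      by (rule bounded_linear_imp_has_derivative[OF bounded_linear_entry])
    have eq: "(\<Sum>a\<in>UNIV. \<Sum>b\<in>UNIV. \<Sum>c\<in>UNIV. W $ (a, b, c) * ((mat 1 :: real^8^8) $ a $ i * ((mat 1 :: real^8^8) $ b $ j * A $ c $ k +
        A $ b $ j * (mat 1 :: real^8^8) $ c $ k) + A $ a $ i * ((mat 1 :: real^8^8) $ b $ j * (mat 1 :: real^8^8) $ c $ k))) =
      3 * inf_act (transpose A) W $ (i, j, k)" for A :: "real^8^8"
    proof -
      have d: "(mat 1 :: real^8^8) $ a $ i = (if a = i then 1 else 0)" for a i by (simp add: mat_def)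
      have m: "(if P then 1 else 0) * (x :: real) = (if P then x else 0)"
        "x * (if P then 1 else 0) = (if P then x else 0)"
        "x * (if P then y else 0) = (if P then x * y else 0)" for P x y
        by auto
      have s: "(\<Sum>i\<in>UNIV. if P then f i else 0) = (if P then (\<Sum>i\<in>UNIV. f i) else (0 :: real))" for P and f :: "8 \<Rightarrow> real"
        by simp
      show ?thesis
        unfolding pull_tensor_deriv_eq[OF W] d m distrib_left sum.distrib
        by (simp add: s mult.commute)
    qed
    show ?thesis
      unfolding pull_tensor_nth eq[symmetric]
      by (intro has_derivative_sum has_derivative_mult_right has_derivative_mult entry)
  qed
  then show ?thesis
    by (subst has_derivative_componentwise_within)
      (auto simp: Basis_vec_def inner_axis)
qed

lemma continuous_on_pull_tensor: "continuous_on UNIV (\<lambda>H. pull_tensor H W)"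
proof -
  have entry: "continuous_on UNIV (\<lambda>H :: real^8^8. H $ a $ i)" for a i
    by (rule linear_continuous_on[OF bounded_linear_entry])
  have "continuous_on UNIV (\<lambda>H. pull_tensor H W $ q)" for q
    by (cases q) (simp add: pull_tensor_nth continuous_on_sum continuous_on_mult continuous_on_const entry)
  then show ?thesis
    by (subst continuous_on_componentwise) (auto simp: Basis_vec_def inner_axis)
qed

lemma continuous_on_det: "continuous_on UNIV (det :: real^'n^'n \<Rightarrow> real)"
  unfolding det_def[abs_def]
  by (intro continuous_on_sum continuous_on_mult continuous_on_prod continuous_on_const
      linear_continuous_on[OF bounded_linear_entry])

text \<open>The orbit map is onto infinitesimally only within the 3-forms, not within all tensors. A
  second variable fills the kernel of \<open>skew\<close>, so that the enlarged map \<open>F\<close>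
  has a surjective derivative; applying \<open>skew\<close> to its values discards that variable
  again.\<close>

lemma orbit_neighbourhood:
  assumes W: "skew W = W" and surj: "\<And>\<sigma>. skew \<sigma> = \<sigma> \<Longrightarrow> \<exists>A. \<sigma> = inf_act A W"
  shows "\<exists>e>0. \<forall>V. skew V = V \<and> dist W V < e \<longrightarrow> (\<exists>H. det H \<noteq> 0 \<and> V = pull_tensor H W)"
proof -
  define F where "F = (\<lambda>p. pull_tensor (fst p) W + (snd p - skew (snd p)))"
  define F' where "F' = (\<lambda>p. 3 *\<^sub>R inf_act (transpose (fst p)) W + (snd p - skew (snd p)))"
  define T where "T = {p :: (real^8^8) \<times> tensor. det (fst p) \<noteq> 0}"
  have bl: "bounded_linear skew" using linear_skew by (simp add: linear_conv_bounded_linear)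
  have contF: "continuous_on UNIV F"
    unfolding F_def
    by (intro continuous_intros linear_continuous_on_compose[OF _ linear_skew]
      continuous_on_compose2[OF continuous_on_pull_tensor]) auto
  have pd: "((\<lambda>H. pull_tensor H W) has_derivative (\<lambda>A. 3 *\<^sub>R inf_act (transpose A) W)) (at (fst (mat 1, 0 :: tensor)))"
    unfolding fst_conv by (rule pull_tensor_has_derivative[OF W])
  have derF: "(F has_derivative F') (at (mat 1, 0))"
    unfolding F_def F'_def
    by (intro has_derivative_add has_derivative_diff has_derivative_snd has_derivative_ident
        bounded_linear.has_derivative[OF bl]
        has_derivative_compose[OF has_derivative_fst[OF has_derivative_ident], of "\<lambda>H. pull_tensor H W", simplified]
        pd)
  have linF': "linear F'"
    using derF has_derivative_linear by blast
  have "surj F'"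
  proof (rule surjI)
    fix \<sigma> :: tensor
    define A where "A = (SOME A. skew \<sigma> = inf_act A W)"
    have A: "skew \<sigma> = inf_act A W" unfolding A_def by (rule someI_ex) (use surj in simp)
    \<comment> \<open>The preimage of \<sigma> uses a third of \<open>A\<close> to undo the 3 in the
      derivative; the second component supplies what \<open>skew\<close> removes from
      \<sigma>.\<close>
    have "inf_act ((1/3) *\<^sub>R A) W = (1/3) *\<^sub>R inf_act A W"
      by (simp add: inf_act_def matrix_mult_scaleR_left unslice_scaleR linear_scale[OF linear_skew])
    then show "F' (transpose ((1/3) *\<^sub>R A), \<sigma>) = \<sigma>" 
      by (simp add: F'_def A[symmetric])
  qed
  then obtain G where G: "linear G" "F' \<circ> G = id"
    using linear_surjective_right_inverse[OF linF'] by blast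
  have "open T"
  proof -
    have "continuous_on UNIV (\<lambda>p :: (real^8^8) \<times> tensor. det (fst p))"
      by (rule continuous_on_compose2[OF continuous_on_det]) (auto intro: continuous_intros)
    then have "open ((\<lambda>p :: (real^8^8) \<times> tensor. det (fst p)) -` (- {0}))"
      by (intro open_vimage) auto
    then show ?thesis by (simp add: T_def vimage_def)
  qed
  moreover have "(mat 1, 0) \<in> T" by (simp add: T_def)
  \<comment> \<open>The right inverse \<open>G\<close> of the derivative at this single point makes
    the image of \<open>T\<close> a neighbourhood of \<open>W\<close>; the restriction to
    \<open>T\<close> keeps the group component invertible.\<close>
  ultimately have "F (mat 1, 0) \<in> interior (F ` T)"
    by (intro sussmann_open_mapping[OF open_UNIV contF UNIV_I derF _ G(2)])
      (use G(1) in \<open>auto simp: linear_conv_bounded_linear interior_open\<close>)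
  then obtain e where e: "e > 0" "ball W e \<subseteq> F ` T"
    by (auto simp: F_def mem_interior linear_0[OF linear_skew])
  show ?thesis
  proof (intro exI[of _ e] conjI allI impI)
    fix V assume V: "skew V = V \<and> dist W V < e"
    then obtain H \<tau> where H: "det H \<noteq> 0" and VF: "V = pull_tensor H W + (\<tau> - skew \<tau>)"
      using e(2) by (auto simp: F_def T_def subset_iff)
    have "V = skew V" using V by simp
    also have "\<dots> = pull_tensor H W"
      by (simp add: VF linear_add[OF linear_skew] linear_diff[OF linear_skew] skew_pull W)
    finally show "\<exists>H. det H \<noteq> 0 \<and> V = pull_tensor H W" using H by blast
  qed (rule e(1))
qed

section \<open>The structure constants of the reference form\<close>

text \<open>The sign of the permutation that sorts the list, found by counting inversions. The value
  0 on repetitions matches the vanishing of alternating forms there.\<close>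

fun list_sign :: "nat list \<Rightarrow> int" where
  "list_sign [] = 1"
| "list_sign (x # xs) =
    (if x \<in> set xs then 0 else (- 1) ^ length (filter (\<lambda>y. y < x) xs) * list_sign xs)"

text \<open>The 3-form \<open>\<langle>[x, y], z\<rangle>\<close> of the compact Lie algebra \<open>su(3)\<close> in a Gell-Mann basis, whose last
  vector is rescaled to make all coefficients integers.\<close>

definition su3_terms :: "(int \<times> nat list) list" where
  "su3_terms = [(2, [0, 1, 2]), (1, [0, 3, 6]), (- 1, [0, 4, 5]), (1, [1, 3, 5]), (1, [1, 4, 6]),
     (1, [2, 3, 4]), (- 1, [2, 5, 6]), (1, [3, 4, 7]), (1, [5, 6, 7])]"

text \<open>A pair \<open>(c, is)\<close> stands for \<open>c\<close> times the wedge product of the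
  coordinate covectors indexed by \<open>is\<close>. Index lists are merely concatenated; ordering
  signs and repeated indices are left to \<open>list_sign\<close>.\<close>

definition mult_terms :: "(int \<times> nat list) list \<Rightarrow> (int \<times> nat list) list \<Rightarrow> (int \<times> nat list) list" where
  "mult_terms L M = concat (map (\<lambda>(c, is). map (\<lambda>(d, js). (c * d, is @ js)) M) L)"

fun contract_term :: "nat \<Rightarrow> int \<times> nat list \<Rightarrow> (int \<times> nat list) list" where
  "contract_term i (c, [a, b, d]) = [(if i = a then c else 0, [b, d]), (if i = b then - c else 0, [a, d]),
     (if i = d then c else 0, [a, b])]"
| "contract_term i _ = []"

definition contract_terms :: "nat \<Rightarrow> (int \<times> nat list) list \<Rightarrow> (int \<times> nat list) list" where
  "contract_terms i L = filter (\<lambda>(c, is). c \<noteq> 0) (concat (map (contract_term i) L))"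

definition su3_products :: "nat \<Rightarrow> nat \<Rightarrow> (int \<times> nat list) list" where
  "su3_products i j =
     mult_terms (mult_terms (contract_terms i su3_terms) (contract_terms j su3_terms)) su3_terms"

text \<open>If \<open>L\<close> lists the terms of a 7-form, with signs already absorbed into the coefficients, this is
  the \<open>k\<close>-th component of \<open>uncontract\<close> of that form at the standard basis.\<close>

definition omission_coeff :: "(int \<times> nat list) list \<Rightarrow> nat \<Rightarrow> int" where
  "omission_coeff L k = (- 1) ^ k * (\<Sum>(c, is)\<leftarrow>L. if k \<in> set is then 0 else c)"

definition signed_terms :: "(int \<times> nat list) list \<Rightarrow> (int \<times> nat list) list" where
  "signed_terms L = filter (\<lambda>(c, is). c \<noteq> 0) (map (\<lambda>(c, is). (c * list_sign is, is)) L)"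

definition su3_const :: "nat \<Rightarrow> nat \<Rightarrow> nat \<Rightarrow> int" where
  "su3_const i j k = omission_coeff (signed_terms (su3_products i j)) k"

text \<open>These are 12 times the symmetric constants d_ijk of the Gell-Mann basis, with its last
  vector divided by the square root of 3; the last index is the component of the product.\<close>

definition su3_table :: "int list list list" where
  "su3_table =
      [[[0, 0, 0, 0, 0, 0, 0, 12], [0, 0, 0, 0, 0, 0, 0, 0], [0, 0, 0, 0, 0, 0, 0, 0],
        [0, 0, 0, 0, 0, 6, 0, 0], [0, 0, 0, 0, 0, 0, 6, 0], [0, 0, 0, 6, 0, 0, 0, 0],
        [0, 0, 0, 0, 6, 0, 0, 0], [4, 0, 0, 0, 0, 0, 0, 0]],
       [[0, 0, 0, 0, 0, 0, 0, 0], [0, 0, 0, 0, 0, 0, 0, 12], [0, 0, 0, 0, 0, 0, 0, 0],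
        [0, 0, 0, 0, 0, 0, - 6, 0], [0, 0, 0, 0, 0, 6, 0, 0], [0, 0, 0, 0, 6, 0, 0, 0],
        [0, 0, 0, - 6, 0, 0, 0, 0], [0, 4, 0, 0, 0, 0, 0, 0]],
       [[0, 0, 0, 0, 0, 0, 0, 0], [0, 0, 0, 0, 0, 0, 0, 0], [0, 0, 0, 0, 0, 0, 0, 12],
        [0, 0, 0, 6, 0, 0, 0, 0], [0, 0, 0, 0, 6, 0, 0, 0], [0, 0, 0, 0, 0, - 6, 0, 0],
        [0, 0, 0, 0, 0, 0, - 6, 0], [0, 0, 4, 0, 0, 0, 0, 0]],
       [[0, 0, 0, 0, 0, 6, 0, 0], [0, 0, 0, 0, 0, 0, - 6, 0], [0, 0, 0, 6, 0, 0, 0, 0],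
        [0, 0, 6, 0, 0, 0, 0, - 6], [0, 0, 0, 0, 0, 0, 0, 0], [6, 0, 0, 0, 0, 0, 0, 0],
        [0, - 6, 0, 0, 0, 0, 0, 0], [0, 0, 0, - 2, 0, 0, 0, 0]],
       [[0, 0, 0, 0, 0, 0, 6, 0], [0, 0, 0, 0, 0, 6, 0, 0], [0, 0, 0, 0, 6, 0, 0, 0],
        [0, 0, 0, 0, 0, 0, 0, 0], [0, 0, 6, 0, 0, 0, 0, - 6], [0, 6, 0, 0, 0, 0, 0, 0],
        [6, 0, 0, 0, 0, 0, 0, 0], [0, 0, 0, 0, - 2, 0, 0, 0]],
       [[0, 0, 0, 6, 0, 0, 0, 0], [0, 0, 0, 0, 6, 0, 0, 0], [0, 0, 0, 0, 0, - 6, 0, 0],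
        [6, 0, 0, 0, 0, 0, 0, 0], [0, 6, 0, 0, 0, 0, 0, 0], [0, 0, - 6, 0, 0, 0, 0, - 6],
        [0, 0, 0, 0, 0, 0, 0, 0], [0, 0, 0, 0, 0, - 2, 0, 0]],
       [[0, 0, 0, 0, 6, 0, 0, 0], [0, 0, 0, - 6, 0, 0, 0, 0], [0, 0, 0, 0, 0, 0, - 6, 0],
        [0, - 6, 0, 0, 0, 0, 0, 0], [6, 0, 0, 0, 0, 0, 0, 0], [0, 0, 0, 0, 0, 0, 0, 0],
        [0, 0, - 6, 0, 0, 0, 0, - 6], [0, 0, 0, 0, 0, 0, - 2, 0]],
       [[4, 0, 0, 0, 0, 0, 0, 0], [0, 4, 0, 0, 0, 0, 0, 0], [0, 0, 4, 0, 0, 0, 0, 0],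
        [0, 0, 0, - 2, 0, 0, 0, 0], [0, 0, 0, 0, - 2, 0, 0, 0], [0, 0, 0, 0, 0, - 2, 0, 0],
        [0, 0, 0, 0, 0, 0, - 2, 0], [0, 0, 0, 0, 0, 0, 0, - 4]]]"

text \<open>Naming the rows keeps \<open>code_simp\<close> from unfolding them under a binder, before the indices are
  known.\<close>

definition su3_consts :: "nat \<Rightarrow> nat \<Rightarrow> int list" where
  "su3_consts i j = map (omission_coeff (signed_terms (su3_products i j))) [0..<8]"

definition su3_const_rows :: "nat \<Rightarrow> int list list" where
  "su3_const_rows i = map (su3_consts i) [0..<8]"

lemma su3_table_eq:
  "map su3_const_rows [0..<8] = su3_table"
  by code_simp

lemma su3_const_table: "i < 8 \<Longrightarrow> j < 8 \<Longrightarrow> k < 8 \<Longrightarrow> su3_const i j k = su3_table ! i ! j ! k"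
  by (simp add: su3_table_eq[symmetric] su3_const_def su3_consts_def su3_const_rows_def)

text \<open>For su(3) the sum of d_ikl d_jkl over k and l is 5/3 for i = j, and 144 * 5/3 = 240. The
  rescaling of the last vector divides its entry by 3.\<close>

definition su3_gram :: "nat \<Rightarrow> int" where
  "su3_gram i = (if i = 7 then 80 else 240)"

lemma su3_table_gram:
  "\<forall>i\<in>set [0..<8]. \<forall>j\<in>set [0..<8].
     (\<Sum>k\<leftarrow>[0..<8]. \<Sum>l\<leftarrow>[0..<8]. su3_table ! i ! l ! k * su3_table ! j ! k ! l) = (if i = j then su3_gram i else 0)"
  by code_simp

text \<open>Lowering the last index with the diagonal Gram matrix produces a multiple of the totally
  symmetric tensor d_ijk; this is (i) on basis vectors.\<close>

lemma su3_table_compat: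
  "\<forall>i\<in>set [0..<8]. \<forall>j\<in>set [0..<8]. \<forall>k\<in>set [0..<8].
     su3_table ! i ! j ! k * su3_gram k = su3_gram i * su3_table ! j ! k ! i"
  by code_simp

section \<open>Decomposable forms\<close>

text \<open>The wedge product of the covectors dual to \<open>vs\<close> under the inner product,
  evaluated at \<open>xs\<close>.\<close>

definition gram_det :: "'a::real_inner list \<Rightarrow> 'a list \<Rightarrow> real" where
  "gram_det vs xs = (if length xs = length vs then
     \<Sum>p | p permutes {..<length vs}. of_int (sign p) * (\<Prod>a<length vs. xs ! p a \<bullet> vs ! a) else 0)"

text \<open>Invariance of the determinant under transposition. It transfers alternation in the
  arguments to alternation in the factors.\<close>

lemma gram_det_commute: "gram_det vs xs = gram_det xs vs"
proof (cases "length xs = length vs")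
  case True
  let ?S = "{..<length vs}"
  have "(\<Sum>p | p permutes ?S. of_int (sign p) * (\<Prod>a\<in>?S. xs ! p a \<bullet> vs ! a)) =
      (\<Sum>p | p permutes ?S. of_int (sign p) * (\<Prod>a\<in>?S. vs ! p a \<bullet> xs ! a))"
  proof (rule sum.reindex_bij_witness[of _ inv inv])
    fix p assume "p \<in> {p. p permutes ?S}"
    then have p: "p permutes ?S" by simp
    show "inv (inv p) = p" by (rule permutes_inv_inv[OF p])
    show "inv p \<in> {p. p permutes ?S}" using permutes_inv[OF p] by simp
    have "(\<Prod>a\<in>?S. vs ! inv p a \<bullet> xs ! a) = (\<Prod>a\<in>?S. vs ! inv p (p a) \<bullet> xs ! p a)"
      by (rule prod.reindex_bij_betw[OF permutes_imp_bij[OF p], symmetric])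
    also have "\<dots> = (\<Prod>a\<in>?S. xs ! p a \<bullet> vs ! a)"
      by (simp add: permutes_inverses[OF p] inner_commute)
    finally show "of_int (sign (inv p)) * (\<Prod>a\<in>?S. vs ! inv p a \<bullet> xs ! a) =
        of_int (sign p) * (\<Prod>a\<in>?S. xs ! p a \<bullet> vs ! a)"
      using p by (simp add: sign_inverse permutes_imp_permutation[of ?S])
  qed (auto simp: permutes_inv_inv permutes_inv)
  then show ?thesis by (simp add: gram_det_def True)
qed (simp add: gram_det_def)

lemma prod_lessThan_add: "(\<Prod>i<k + l. F i) = (\<Prod>i<k. F i) * (\<Prod>i<l. F (k + i))" for F :: "nat \<Rightarrow> real"
  by (induction l) (simp_all add: mult.assoc)

lemma card_permutes_lessThan: "card {p. p permutes {..<n}} = fact n"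
  by (rule card_permutations) auto

text \<open>Permutations \<open>q\<close> and \<open>r\<close> of the two blocks combine to a
  permutation \<open>s\<close> of all positions, which is absorbed into the outer sum. Each of the
  \<open>fact k * fact l\<close> pairs thus contributes the same amount, and this number cancels
  against the normalisation of \<open>wedge\<close>.\<close>

lemma wedge_gram_det:
  fixes us vs :: "'a::real_inner list"
  assumes us: "length us = k" and vs: "length vs = l"
  shows "wedge k l (gram_det us) (gram_det vs) = gram_det (us @ vs)"
proof
  fix xs :: "'a list"
  show "wedge k l (gram_det us) (gram_det vs) xs = gram_det (us @ vs) xs"
  proof (cases "length xs = k + l")
    case False
    then show ?thesis by (simp add: wedge_def gram_det_def us vs)
  next
    case len: True
    define n where "n = k + l"
    define A where "A p = of_int (sign p) * (\<Prod>i<n. xs ! p i \<bullet> (us @ vs) ! i)" for p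
    define G where "G p q r = of_int (sign p) * (of_int (sign q) * (\<Prod>a<k. xs ! p (q a) \<bullet> us ! a)) *
       (of_int (sign r) * (\<Prod>b<l. xs ! p (k + r b) \<bullet> vs ! b))" for p q r
    have inner_sum: "(\<Sum>p | p permutes {..<n}. G p q r) = (\<Sum>p | p permutes {..<n}. A p)"
      if q: "q permutes {..<k}" and r: "r permutes {..<l}" for q r
    proof -
      \<comment> \<open>The permutation \<open>r\<close> moved to the second block of positions,
        with its sign unchanged.\<close>
      define r' where "r' = map_permutation {..<l} ((+) k) r"
      have bij: "bij_betw ((+) k) {..<l} {k..<n}"
        unfolding n_def lessThan_atLeast0 by (rule bij_betw_byWitness[of _ "\<lambda>x. x - k"]) auto
      have r': "r' permutes {k..<n}" unfolding r'_def by (rule map_permutation_permutes[OF bij r])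
      have r'_apply: "r' (k + b) = k + r b" if "b < l" for b
        unfolding r'_def by (rule map_permutation_apply) (use that in auto)
      have r'_less: "r' i = i" if "i < k" for i
        by (rule permutes_not_in[OF r']) (use that in auto)
      have q_ge: "q i = i" if "i \<ge> k" for i
        by (rule permutes_not_in[OF q]) (use that in auto)
      have qn: "q permutes {..<n}" by (rule permutes_subset[OF q]) (auto simp: n_def)
      have r'n: "r' permutes {..<n}" by (rule permutes_subset[OF r']) auto
      define s where "s = q \<circ> r'"
      have s: "s permutes {..<n}" unfolding s_def by (rule permutes_compose[OF r'n qn])
      have sign_s: "sign s = sign q * sign r"
        unfolding s_def using sign_compose permutes_imp_permutation[OF _ qn] permutes_imp_permutation[OF _ r'n]
        by (simp add: sign_compose r'_def sign_map_permutation[OF _ r])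
      have "G p q r = A (p \<circ> s)" if p: "p permutes {..<n}" for p
      proof -
        have "sign (p \<circ> s) = sign p * sign s"
          using permutes_imp_permutation[OF _ p] permutes_imp_permutation[OF _ s] by (simp add: sign_compose)
        moreover have "(\<Prod>i<n. xs ! p (s i) \<bullet> (us @ vs) ! i) =
            (\<Prod>a<k. xs ! p (q a) \<bullet> us ! a) * (\<Prod>b<l. xs ! p (k + r b) \<bullet> vs ! b)"
          unfolding n_def prod_lessThan_add
          by (intro arg_cong2[where f = "(*)"] prod.cong refl)
            (simp_all add: s_def r'_less r'_apply q_ge nth_append us)
        ultimately show ?thesis by (simp add: G_def A_def sign_s)
      qed
      then have "(\<Sum>p | p permutes {..<n}. G p q r) = (\<Sum>p | p permutes {..<n}. A (p \<circ> s))"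
        by (intro sum.cong) auto
      also have "\<dots> = (\<Sum>p | p permutes {..<n}. A p)"
        by (rule sum.reindex_bij_witness[of _ "\<lambda>p. p \<circ> inv s" "\<lambda>p. p \<circ> s"])
          (auto simp: permutes_compose s permutes_inv comp_assoc permutes_inv_o[OF s])
      finally show ?thesis .
    qed
    have "(\<Sum>p | p permutes {..<k + l}. of_int (sign p) *
        gram_det us (map (\<lambda>i. xs ! p i) [0..<k]) * gram_det vs (map (\<lambda>i. xs ! p i) [k..<k + l])) =
      (\<Sum>p | p permutes {..<n}. \<Sum>q | q permutes {..<k}. \<Sum>r | r permutes {..<l}. G p q r)"
    proof -
      have 1: "gram_det us (map (\<lambda>i. xs ! p i) [0..<k]) =
        (\<Sum>q | q permutes {..<k}. of_int (sign q) * (\<Prod>a<k. xs ! p (q a) \<bullet> us ! a))" for p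
      proof -
        have "(\<Prod>a<k. map (\<lambda>i. xs ! p i) [0..<k] ! q a \<bullet> us ! a) = (\<Prod>a<k. xs ! p (q a) \<bullet> us ! a)"
          if "q permutes {..<k}" for q
          using permutes_in_image[OF that] by (intro prod.cong refl) simp
        then show ?thesis by (simp add: gram_det_def us)
      qed
      have 2: "gram_det vs (map (\<lambda>i. xs ! p i) [k..<k + l]) =
        (\<Sum>r | r permutes {..<l}. of_int (sign r) * (\<Prod>b<l. xs ! p (k + r b) \<bullet> vs ! b))" for p
      proof -
        have "(\<Prod>a<l. map (\<lambda>i. xs ! p i) [k..<k + l] ! r a \<bullet> vs ! a) = (\<Prod>b<l. xs ! p (k + r b) \<bullet> vs ! b)"
          if "r permutes {..<l}" for r
          using permutes_in_image[OF that] by (intro prod.cong refl) simp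
        then show ?thesis by (simp add: gram_det_def vs)
      qed
      show ?thesis
        unfolding 1 2 G_def n_def sum_distrib_left sum_distrib_right
        by (intro sum.cong refl sum.swap)
    qed
    also have "\<dots> = (\<Sum>q | q permutes {..<k}. \<Sum>p | p permutes {..<n}. \<Sum>r | r permutes {..<l}. G p q r)"
      by (rule sum.swap)
    also have "\<dots> = (\<Sum>q | q permutes {..<k}. \<Sum>r | r permutes {..<l}. \<Sum>p | p permutes {..<n}. G p q r)"
      by (intro sum.cong refl sum.swap)
    also have "\<dots> = (\<Sum>q | q permutes {..<k}. \<Sum>r | r permutes {..<l}. \<Sum>p | p permutes {..<n}. A p)"
      by (intro sum.cong refl inner_sum) auto
    also have "\<dots> = fact k * fact l * (\<Sum>p | p permutes {..<n}. A p)"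
      by (simp add: card_permutes_lessThan)
    also have "(\<Sum>p | p permutes {..<n}. A p) = gram_det (us @ vs) xs"
      by (simp add: gram_det_def A_def n_def us vs len)
    finally show ?thesis by (simp add: wedge_def len)
  qed
qed

text \<open>Splitting off one covector at a time reduces alternation to that of wedge
  products.\<close>

lemma gram_det_alt_forms: "gram_det vs \<in> alt_forms (length vs)"
proof (induction vs)
  case Nil
  show ?case
    by (rule alt_formsI) (auto simp: gram_det_def)
next
  case (Cons v vs)
  have [simp]: "{p. p permutes {..<Suc 0}} = {id}" by (simp add: lessThan_Suc permutes_sing)
  have "gram_det [v] \<in> alt_forms 1"
    by (rule alt_formsI)
      (auto simp: gram_det_def length_Suc_conv inner_left_distrib intro!: linearI)
  from wedge_alt_forms[OF this Cons]
  show ?case by (simp add: wedge_gram_det)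
qed

lemma gram_det_orthonormal:
  fixes vs :: "'a::euclidean_space list"
  assumes d: "distinct vs" and B: "set vs \<subseteq> Basis"
  shows "gram_det vs vs = 1"
proof -
  let ?S = "{..<length vs}"
  have "of_int (sign p) * (\<Prod>a\<in>?S. vs ! p a \<bullet> vs ! a) = (if p = id then 1 else 0)" if p: "p permutes ?S" for p
  proof (cases "p = id")
    case True
    have "vs ! a \<bullet> vs ! a = 1" if "a < length vs" for a
      using B that nth_mem by (metis inner_same_Basis subsetD)
    then show ?thesis by (simp add: True)
  next
    case False
    then obtain a where a: "p a \<noteq> a" by (auto simp: fun_eq_iff)
    then have "a \<in> ?S" using p by (metis permutes_not_in)
    moreover from this have "p a \<in> ?S" using permutes_in_image[OF p] by simp
    ultimately have "vs ! p a \<bullet> vs ! a = 0"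
      using a d B by (simp add: inner_Basis nth_eq_iff_index_eq subset_iff)
    then have "(\<Prod>a\<in>?S. vs ! p a \<bullet> vs ! a) = 0"
      using \<open>a \<in> ?S\<close> by (meson finite_lessThan prod_zero)
    then show ?thesis using False by simp
  qed
  then have "gram_det vs vs = (\<Sum>p | p permutes ?S. if p = id then 1 else 0)"
    by (simp add: gram_det_def)
  also have "\<dots> = 1"
    by (subst sum.delta) (auto simp: finite_permutations permutes_id)
  finally show ?thesis .
qed

text \<open>Insertion sort: once the tail is sorted, the head has to pass precisely the smaller
  entries, which is the exponent in \<open>list_sign\<close>.\<close>

lemma alt_forms_sort:
  fixes \<omega> :: "'v::real_vector list \<Rightarrow> real"
  assumes \<omega>: "\<omega> \<in> alt_forms n" and "distinct is"
  shows "\<omega> (ps @ map f is) = of_int (list_sign is) * \<omega> (ps @ map f (sort is))"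
  using assms(2)
proof (induction "is" arbitrary: ps)
  case (Cons x xs)
  define A where "A = filter (\<lambda>y. y < x) (sort xs)"
  define B where "B = filter (\<lambda>y. \<not> y < x) (sort xs)"
  have sorted_split: "sorted ys \<Longrightarrow> filter (\<lambda>y. y < x) ys @ filter (\<lambda>y. \<not> y < x) ys = ys"
    and insort_split: "sorted ys \<Longrightarrow> insort x ys = filter (\<lambda>y. y < x) ys @ x # filter (\<lambda>y. \<not> y < x) ys" for ys :: "nat list"
  proof (induction ys)
    case (Cons y ys)
    { case 1 show ?case
      proof (cases "y < x")
        case False
        then have "filter (\<lambda>y. y < x) ys = []" "filter (\<lambda>y. \<not> y < x) ys = ys"
          using 1 by (auto simp: filter_empty_conv filter_id_conv)
        then show ?thesis using False by simp
      qed (use 1 Cons in simp) }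
    { case 2 show ?case
      proof (cases "y < x")
        case False
        then have "filter (\<lambda>y. y < x) ys = []" "filter (\<lambda>y. \<not> y < x) ys = ys"
          using 2 by (auto simp: filter_empty_conv filter_id_conv)
        then show ?thesis using False by simp
      qed (use 2 Cons in simp) }
  qed simp_all
  have s: "sort xs = A @ B" "sort (x # xs) = A @ x # B"
    using sorted_split[of "sort xs"] insort_split[of "sort xs"] by (simp_all add: A_def B_def)
  have lA: "length A = length (filter (\<lambda>y. y < x) xs)"
    unfolding A_def by (metis filter_sort length_sort)
  have "\<omega> (ps @ map f (x # xs)) = of_int (list_sign xs) * \<omega> (ps @ f x # map f (sort xs))"
    using Cons.IH[of "ps @ [f x]"] Cons.prems by simp
  also have "\<omega> (ps @ f x # map f (sort xs)) = (- 1) ^ length A * \<omega> (ps @ map f A @ f x # map f B)"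
    using alt_forms_move[OF \<omega>, of ps "map f A" "f x" "map f B"]
    by (simp add: s mult.assoc[symmetric] flip: power_add)
  finally show ?case
    using Cons.prems unfolding s(2) by (simp add: lA)
qed simp

lemma list_sign_distinct: "\<not> distinct is \<Longrightarrow> list_sign is = 0"
  by (induction "is") auto

text \<open>If \<open>k\<close> occurs in \<open>is\<close>, the covector of \<open>e8 k\<close>
  annihilates every argument. Otherwise seven distinct indices must be all those different from
  \<open>k\<close>, and sorting reduces to an orthonormal list.\<close>

lemma gram_det_omission:
  assumes "length is = 7" "set is \<subseteq> {..<8}" "k < 8"
  shows "gram_det (map e8 is) (take k basis8 @ drop (Suc k) basis8) =
    (if k \<in> set is then 0 else of_int (list_sign is))"
proof -
  define ks where "ks = filter (\<lambda>m. m \<noteq> k) [0..<8]"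
  have ks_eq: "take k basis8 @ drop (Suc k) basis8 = map e8 ks"
  proof -
    have upt: "[0..<8] = [0..<k] @ k # [Suc k..<8]"
      using assms(3) upt_add_eq_append[of 0 k "8 - k"] by (simp add: upt_conv_Cons)
    have "filter (\<lambda>m. m \<noteq> k) [0..<k] = [0..<k]" "filter (\<lambda>m. m \<noteq> k) [Suc k..<8] = [Suc k..<8]"
      by (auto simp: filter_id_conv)
    then have "ks = [0..<k] @ [Suc k..<8]" unfolding ks_def upt by simp
    moreover have "take k [0..<8] = [0..<k]" "drop (Suc k) [0..<8] = [Suc k..<8]"
      using assms(3) by (simp_all add: take_upt drop_upt)
    ultimately show ?thesis by (simp add: basis8_def take_map drop_map)
  qed
  have inj: "inj_on e8 {..<8}"
    by (auto simp: inj_on_def e8_def axis_eq_axis of_nat_8_eq_iff)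
  have basis: "e8 ` {..<8} \<subseteq> Basis"
    by (auto simp: e8_def axis_in_Basis_iff)
  have ks: "sorted ks" "distinct ks" "set ks = {..<8} - {k}"
    by (auto simp: ks_def sorted_wrt_filter)
  show ?thesis
  proof (cases "distinct is")
    case False
    then have "\<not> distinct (map e8 is)" by (auto simp: distinct_map)
    then show ?thesis
      using False by (simp add: list_sign_distinct gram_det_commute[of "map e8 is"]
          alt_forms_distinct[OF gram_det_alt_forms])
  next
    case d: True
    have "gram_det (map e8 is) (map e8 ks) = of_int (list_sign is) * gram_det (map e8 (sort is)) (map e8 ks)"
      using alt_forms_sort[OF gram_det_alt_forms d, of "map e8 ks" "[]" e8]
      by (simp add: gram_det_commute[of _ "map e8 ks"])
    moreover have "gram_det (map e8 (sort is)) (map e8 ks) = (if k \<in> set is then 0 else 1)"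
    proof (cases "k \<in> set is")
      case True
      then obtain a where a: "a < length (sort is)" "sort is ! a = k"
        by (metis in_set_conv_nth set_sort)
      have "(\<Prod>a<length (sort is). map e8 ks ! p a \<bullet> map e8 (sort is) ! a) = 0"
        if p: "p permutes {..<length (sort is)}" and l: "length ks = length (sort is)" for p
      proof -
        have pa: "p a < length ks" using permutes_in_image[OF p, of a] a l by simp
        then have "ks ! p a \<in> set ks" by simp
        then have "ks ! p a \<noteq> k" "ks ! p a < 8" using ks(3) by auto
        then have "map e8 ks ! p a \<bullet> map e8 (sort is) ! a = 0"
          using a pa assms(3) by (simp add: e8_def inner_axis_axis of_nat_8_eq_iff)
        then show ?thesis using a(1) by (meson finite_lessThan lessThan_iff prod_zero)
      qed
      then show ?thesis using True by (auto simp: gram_det_def intro!: sum.neutral)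
    next
      case False
      have "set is = {..<8} - {k}"
      proof (rule card_subset_eq)
        show "set is \<subseteq> {..<8} - {k}" using False assms(2) by auto
        show "card (set is) = card ({..<8} - {k})" using assms d distinct_card[OF d] by simp
      qed simp
      then have "sort is = ks"
        by (intro sorted_distinct_set_unique) (use ks d in auto)
      moreover have "gram_det (map e8 ks) (map e8 ks) = 1"
      proof (rule gram_det_orthonormal)
        show "distinct (map e8 ks)" using ks inj by (auto simp: distinct_map intro: inj_on_subset)
        show "set (map e8 ks) \<subseteq> Basis" using ks(3) basis by auto
      qed
      ultimately show ?thesis using False by simp
    qed
    ultimately show ?thesis by (simp add: ks_eq)
  qed
qed

section \<open>Forms represented by term lists\<close>

definition terms_form :: "(int \<times> nat list) list \<Rightarrow> (real^8) list \<Rightarrow> real" where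
  "terms_form L xs = (\<Sum>(c, is)\<leftarrow>L. of_int c * gram_det (map e8 is) xs)"

definition valid_terms :: "nat \<Rightarrow> (int \<times> nat list) list \<Rightarrow> bool" where
  "valid_terms k L \<longleftrightarrow> (\<forall>(c, is)\<in>set L. length is = k \<and> set is \<subseteq> {..<8})"

lemma terms_form_simps:
  "terms_form [] xs = 0" "terms_form ((c, is) # L) xs = of_int c * gram_det (map e8 is) xs + terms_form L xs"
  "terms_form (L @ M) xs = terms_form L xs + terms_form M xs"
  by (simp_all add: terms_form_def)

lemma valid_terms_simps:
  "valid_terms k []" "valid_terms k ((c, is) # L) \<longleftrightarrow> length is = k \<and> set is \<subseteq> {..<8} \<and> valid_terms k L"
  "valid_terms k (L @ M) \<longleftrightarrow> valid_terms k L \<and> valid_terms k M"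
  unfolding valid_terms_def set_append ball_Un by simp_all

lemma alt_forms_lincomb:
  fixes \<alpha> \<beta> :: "'v::real_vector list \<Rightarrow> real"
  assumes \<alpha>: "\<alpha> \<in> alt_forms k" and \<beta>: "\<beta> \<in> alt_forms k"
  shows "(\<lambda>xs. c * \<alpha> xs + \<beta> xs) \<in> alt_forms k"
proof (rule alt_formsI)
  fix xs ys :: "'v list" assume *: "length xs + length ys + 1 = k"
  show "linear (\<lambda>v. c * \<alpha> (xs @ v # ys) + \<beta> (xs @ v # ys))"
    by (rule linearI)
      (simp_all add: linear_add[OF alt_forms_linear[OF \<alpha> *]] linear_add[OF alt_forms_linear[OF \<beta> *]]
        linear_scale[OF alt_forms_linear[OF \<alpha> *]] linear_scale[OF alt_forms_linear[OF \<beta> *]] algebra_simps)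
qed (auto simp: alt_forms_length[OF \<alpha>] alt_forms_length[OF \<beta>] alt_forms_distinct[OF \<alpha>] alt_forms_distinct[OF \<beta>])

lemma terms_form_alt_forms: "valid_terms k L \<Longrightarrow> terms_form L \<in> alt_forms k"
proof (induction L)
  case Nil
  show ?case by (rule alt_formsI) (simp_all add: terms_form_simps linear_zero)
next
  case (Cons t L)
  obtain c "is" where t: "t = (c, is)" by (cases t)
  have "gram_det (map e8 is) \<in> alt_forms k"
    using gram_det_alt_forms[of "map e8 is"] Cons.prems by (simp add: t valid_terms_simps)
  moreover have "terms_form L \<in> alt_forms k"
    using Cons by (simp add: t valid_terms_simps)
  ultimately have "(\<lambda>xs. of_int c * gram_det (map e8 is) xs + terms_form L xs) \<in> alt_forms k"
    by (rule alt_forms_lincomb)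
  then show ?case by (simp add: t terms_form_simps[abs_def])
qed

lemma wedge_lincomb_left:
  "wedge k l (\<lambda>xs. c * \<alpha> xs + \<alpha>' xs) \<beta> ys = c * wedge k l \<alpha> \<beta> ys + wedge k l \<alpha>' \<beta> ys"
  by (cases "length ys = k + l")
    (simp_all add: wedge_def algebra_simps sum.distrib sum_distrib_left add_divide_distrib)

lemma wedge_lincomb_right:
  "wedge k l \<alpha> (\<lambda>xs. c * \<beta> xs + \<beta>' xs) ys = c * wedge k l \<alpha> \<beta> ys + wedge k l \<alpha> \<beta>' ys"
  by (cases "length ys = k + l")
    (simp_all add: wedge_def algebra_simps sum.distrib sum_distrib_left add_divide_distrib)

lemma wedge_gram_det_terms_form:
  assumes "length is = k" "valid_terms l M"
  shows "wedge k l (gram_det (map e8 is)) (terms_form M) ys =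
    (\<Sum>(d, js)\<leftarrow>M. of_int d * gram_det (map e8 (is @ js)) ys)"
  using assms(2)
proof (induction M)
  case Nil
  show ?case by (simp add: wedge_def terms_form_simps)
next
  case (Cons t M)
  obtain d js where t: "t = (d, js)" by (cases t)
  have "terms_form (t # M) = (\<lambda>xs. of_int d * gram_det (map e8 js) xs + terms_form M xs)"
    by (simp add: t terms_form_simps fun_eq_iff)
  then show ?case
    using Cons assms(1) by (simp add: t wedge_lincomb_right wedge_gram_det valid_terms_simps)
qed

lemma wedge_terms_form:
  assumes "valid_terms k L" "valid_terms l M"
  shows "wedge k l (terms_form L) (terms_form M) = terms_form (mult_terms L M)"
proof
  fix ys
  show "wedge k l (terms_form L) (terms_form M) ys = terms_form (mult_terms L M) ys"
    using assms(1)
  proof (induction L)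
    case Nil
    show ?case by (simp add: wedge_def terms_form_simps mult_terms_def)
  next
    case (Cons t L)
    obtain c "is" where t: "t = (c, is)" by (cases t)
    have 1: "terms_form (t # L) = (\<lambda>xs. of_int c * gram_det (map e8 is) xs + terms_form L xs)"
      by (simp add: t terms_form_simps fun_eq_iff)
    have 2: "mult_terms (t # L) M = map (\<lambda>(d, js). (c * d, is @ js)) M @ mult_terms L M"
      by (simp add: mult_terms_def t)
    have 3: "terms_form (map (\<lambda>(d, js). (c * d, is @ js)) M) ys =
        of_int c * (\<Sum>(d, js)\<leftarrow>M. of_int d * gram_det (map e8 (is @ js)) ys)"
      by (induction M) (auto simp: terms_form_simps algebra_simps)
    show ?case
      unfolding 1 2 wedge_lincomb_left terms_form_simps(3) 3
      using Cons assms(2) by (simp add: t valid_terms_simps wedge_gram_det_terms_form)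
  qed
qed

lemma valid_mult_terms: "valid_terms k L \<Longrightarrow> valid_terms l M \<Longrightarrow> valid_terms (k + l) (mult_terms L M)"
  by (fastforce simp: valid_terms_def mult_terms_def)

lemma gram_det_2: "gram_det [u, v] [x, y] = (x \<bullet> u) * (y \<bullet> v) - (y \<bullet> u) * (x \<bullet> v)"
proof -
  have S: "{..<2::nat} = insert 0 {1}" by auto
  show ?thesis
    unfolding gram_det_def
    by (simp add: numeral_2_eq_2[symmetric] S sum_over_permutations_insert permutes_sing sign_swap_id)
qed

text \<open>Laplace expansion along the first argument; its three summands are the three terms
  produced by \<open>contract_term\<close>.\<close>

lemma gram_det_3:
  "gram_det [u, v, w] [x, y, z] =
    (x \<bullet> u) * gram_det [v, w] [y, z] - (x \<bullet> v) * gram_det [u, w] [y, z] + (x \<bullet> w) * gram_det [u, v] [y, z]"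
proof -
  let ?t = "Transposition.transpose :: nat \<Rightarrow> nat \<Rightarrow> nat \<Rightarrow> nat"
  have S: "{..<3::nat} = insert 0 (insert 1 {2})" by auto
  have perms: "(\<Sum>p | p permutes {..<3::nat}. g p) = g id + g (?t 1 2) + g (?t 0 1) + g (?t 0 1 \<circ> ?t 1 2)
      + g (?t 0 2) + g (?t 0 2 \<circ> ?t 1 2)" for g :: "(nat \<Rightarrow> nat) \<Rightarrow> real"
    unfolding S by (simp add: sum_over_permutations_insert permutes_sing)
  have prods: "(\<Prod>a<3. F a) = F 0 * F 1 * F 2" for F :: "nat \<Rightarrow> real"
    unfolding S by (simp add: mult.assoc)
  have signs: "sign (?t 0 1 \<circ> ?t 1 2) = 1" "sign (?t 0 2 \<circ> ?t 1 2) = 1"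
    by (simp_all add: sign_compose permutation_swap_id sign_swap_id)
  have len: "length [u, v, w] = 3" "length [x, y, z] = 3" by simp_all
  have "gram_det [u, v, w] [x, y, z] =
      (x \<bullet> u) * (y \<bullet> v) * (z \<bullet> w) - (x \<bullet> u) * (z \<bullet> v) * (y \<bullet> w) - (y \<bullet> u) * (x \<bullet> v) * (z \<bullet> w)
      + (y \<bullet> u) * (z \<bullet> v) * (x \<bullet> w) - (z \<bullet> u) * (y \<bullet> v) * (x \<bullet> w) + (z \<bullet> u) * (x \<bullet> v) * (y \<bullet> w)"
    unfolding gram_det_def len perms prods signs
    by (simp add: sign_swap_id Transposition.transpose_def)
  then show ?thesis unfolding gram_det_2 by (simp add: algebra_simps)
qed

lemma inner_e8: "i < 8 \<Longrightarrow> j < 8 \<Longrightarrow> e8 i \<bullet> e8 j = (if i = j then 1 else 0)"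
  by (simp add: e8_def inner_axis_axis of_nat_8_eq_iff)

lemma terms_form_filter: "terms_form (filter (\<lambda>(c, is). c \<noteq> 0) L) xs = terms_form L xs"
  by (induction L) (auto simp: terms_form_simps)

lemma length2_obtain:
  assumes "length xs = 2" obtains x y where "xs = [x, y]"
  using assms by (auto simp: eval_nat_numeral length_Suc_conv)

lemma interior_prod_terms_form:
  assumes i: "i < 8" and L: "valid_terms 3 L"
  shows "interior_prod (e8 i) (terms_form L) = terms_form (contract_terms i L)"
    and "valid_terms 2 (contract_terms i L)"
proof -
  have v: "valid_terms 2 (concat (map (contract_term i) L))"
    using L
  proof (induction L)
    case (Cons t L)
    obtain c "is" where t: "t = (c, is)" by (cases t)
    then have "length is = 3" using Cons.prems by (simp add: valid_terms_simps)
    then obtain a b d where "is = [a, b, d]" by (rule length3_obtain)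
    then show ?case using Cons by (simp add: t valid_terms_simps)
  qed (simp add: valid_terms_simps)
  then show "valid_terms 2 (contract_terms i L)"
    unfolding contract_terms_def valid_terms_def set_filter by blast
  show "interior_prod (e8 i) (terms_form L) = terms_form (contract_terms i L)"
  proof
    fix xs
    show "interior_prod (e8 i) (terms_form L) xs = terms_form (contract_terms i L) xs"
    proof (cases "length xs = 2")
      case False
      have "terms_form L (e8 i # xs) = 0"
        by (rule alt_forms_length[OF terms_form_alt_forms[OF L]]) (use False in simp)
      moreover have "terms_form (concat (map (contract_term i) L)) xs = 0"
        by (rule alt_forms_length[OF terms_form_alt_forms[OF v] False])
      ultimately show ?thesis
        by (simp add: interior_prod_def contract_terms_def terms_form_filter)
    next
      case True
      then obtain x y where xs: "xs = [x, y]" by (rule length2_obtain)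
      show ?thesis
        unfolding interior_prod_def contract_terms_def terms_form_filter using L
      proof (induction L)
        case (Cons t L)
        obtain c "is" where t: "t = (c, is)" by (cases t)
        then have "length is = 3" using Cons.prems by (simp add: valid_terms_simps)
        then obtain a b d where "is" : "is = [a, b, d]" by (rule length3_obtain)
        show ?case
          using Cons i by (auto simp: t "is" valid_terms_simps terms_form_simps xs gram_det_3 inner_e8 algebra_simps)
      qed (simp add: terms_form_simps)
    qed
  qed
qed

lemma valid_su3_terms: "valid_terms 3 su3_terms"
  by (simp add: su3_terms_def valid_terms_def)

definition su3_form :: "(real^8) list \<Rightarrow> real" where
  "su3_form = terms_form su3_terms"

lemma su3_form_alt_forms: "su3_form \<in> alt_forms 3"
  unfolding su3_form_def by (rule terms_form_alt_forms[OF valid_su3_terms])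

lemma omission_coeff_eq:
  assumes "valid_terms 7 L" "k < 8"
  shows "(- 1) ^ k * terms_form L (take k basis8 @ drop (Suc k) basis8) =
    of_int (omission_coeff (signed_terms L) k)"
proof -
  have "terms_form L (take k basis8 @ drop (Suc k) basis8) =
      of_int (\<Sum>(c, is)\<leftarrow>signed_terms L. if k \<in> set is then 0 else c)"
    using assms(1)
    by (induction L)
      (auto simp: terms_form_simps signed_terms_def valid_terms_simps gram_det_omission assms(2) split: if_splits)
  then show ?thesis by (simp add: omission_coeff_def)
qed

text \<open>The bridge between the symbolic computation on term lists and the multiplication defined
  through wedge products and contraction.\<close>

lemma su3_smul:
  assumes "i < 8" "j < 8" "k < 8"
  shows "smul su3_form (e8 i) (e8 j) $ of_nat k = of_int (su3_table ! i ! j ! k)"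
proof -
  note v = valid_su3_terms interior_prod_terms_form(2)[OF _ valid_su3_terms]
  have v4: "valid_terms 4 (mult_terms (contract_terms i su3_terms) (contract_terms j su3_terms))"
    using valid_mult_terms[OF v(2)[OF assms(1)] v(2)[OF assms(2)]] by simp
  have v7: "valid_terms 7 (su3_products i j)"
    unfolding su3_products_def using valid_mult_terms[OF v4 v(1)] by simp
  have \<Phi>: "mult_form su3_form (e8 i) (e8 j) = terms_form (su3_products i j)"
    unfolding mult_form_def su3_form_def su3_products_def
    by (simp only: interior_prod_terms_form(1)[OF assms(1) v(1)] interior_prod_terms_form(1)[OF assms(2) v(1)]
        wedge_terms_form v(2)[OF assms(1)] v(2)[OF assms(2)] wedge_terms_form[OF v4 v(1)])
  have "smul su3_form (e8 i) (e8 j) $ of_nat k =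
      (\<Sum>m<8. if m = k then (- 1) ^ m * mult_form su3_form (e8 i) (e8 j) (take m basis8 @ drop (Suc m) basis8) else 0)"
    unfolding smul_def S_map_eq[OF su3_form_alt_forms] uncontract_def sum_component length_basis8
    by (rule sum.cong) (use assms(3) in \<open>auto simp: basis8_nth e8_def axis_def of_nat_8_eq_iff\<close>)
  also have "\<dots> = (- 1) ^ k * terms_form (su3_products i j) (take k basis8 @ drop (Suc k) basis8)"
    using assms(3) by (simp add: \<Phi>)
  also have "\<dots> = of_int (su3_const i j k)"
    by (simp only: omission_coeff_eq[OF v7 assms(3)] su3_const_def)
  finally show ?thesis by (simp add: su3_const_table[OF assms])
qed

section \<open>The reference form\<close>

text \<open>A skew tensor orthogonal to the tangent space of the orbit at the reference form is
  zero. The equations \<open>G\<close> for all pairs \<open>a\<close>, \<open>b\<close> express this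
  orthogonality, one for each elementary matrix.\<close>

lemma su3_kernel:
  fixes s :: "nat \<Rightarrow> nat \<Rightarrow> nat \<Rightarrow> real"
  assumes sw1: "\<And>i j k. s j i k = - s i j k" and sw2: "\<And>i j k. s i k j = - s i j k"
    and G: "\<And>a b. a < 8 \<Longrightarrow> b < 8 \<Longrightarrow>
      (\<Sum>(c, ps)\<leftarrow>contract_terms b su3_terms. of_int c * s a (ps ! 0) (ps ! 1)) = 0"
    and less: "i < 8" "j < 8" "k < 8"
  shows "s i j k = 0"
proof -
  \<comment> \<open>These rules bring all indices into increasing order, so that the hypotheses
    become linear equations in 56 unknowns.\<close>
  have sk: "s a a c = 0" "s a c c = 0" "a < b \<Longrightarrow> s b a c = - s a b c" "b < c \<Longrightarrow> s a c b = - s a b c" for a b c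
    using sw1[of a a c] sw2[of a c c] sw1[of b a c] sw2[of a c b] by simp_all
  have G0: "2 * s a 1 2 + s a 3 6 - s a 4 5 = 0" if "a < 8" for a
    using G[OF that, of 0] by (simp add: contract_terms_def su3_terms_def)
  have G1: "- 2 * s a 0 2 + s a 3 5 + s a 4 6 = 0" if "a < 8" for a
    using G[OF that, of 1] by (simp add: contract_terms_def su3_terms_def)
  have G2: "2 * s a 0 1 + s a 3 4 - s a 5 6 = 0" if "a < 8" for a
    using G[OF that, of 2] by (simp add: contract_terms_def su3_terms_def)
  have G3: "- s a 0 6 - s a 1 5 - s a 2 4 + s a 4 7 = 0" if "a < 8" for a
    using G[OF that, of 3] by (simp add: contract_terms_def su3_terms_def)
  have G4: "s a 0 5 - s a 1 6 + s a 2 3 - s a 3 7 = 0" if "a < 8" for a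
    using G[OF that, of 4] by (simp add: contract_terms_def su3_terms_def)
  have G5: "- s a 0 4 + s a 1 3 + s a 2 6 + s a 6 7 = 0" if "a < 8" for a
    using G[OF that, of 5] by (simp add: contract_terms_def su3_terms_def)
  have G6: "s a 0 3 + s a 1 4 - s a 2 5 - s a 5 7 = 0" if "a < 8" for a
    using G[OF that, of 6] by (simp add: contract_terms_def su3_terms_def)
  have G7: "s a 3 4 + s a 5 6 = 0" if "a < 8" for a
    using G[OF that, of 7] by (simp add: contract_terms_def su3_terms_def)
  \<comment> \<open>From here on each line names the equations from which one component can be
    eliminated. For this one they are the equations with \<open>a = b\<close>, coming from the
    diagonal matrices.\<close>
  have z012: "s 0 1 2 = 0"
    using G0[of 0] G1[of 1] G2[of 2] G3[of 3] G4[of 4] G5[of 5] G6[of 6] G7[of 7] by (simp add: sk)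
  have z013: "s 0 1 3 = 0"
    using G2[of 3] G7[of 3] by (simp add: sk)
  have z014: "s 0 1 4 = 0"
    using G2[of 4] G7[of 4] by (simp add: sk)
  have z015: "s 0 1 5 = 0"
    using G2[of 5] G7[of 5] by (simp add: sk)
  have z016: "s 0 1 6 = 0"
    using G2[of 6] G7[of 6] by (simp add: sk)
  have z017: "s 0 1 7 = 0"
    using G7[of 2] G3[of 3] G4[of 4] G5[of 5] G6[of 6] G2[of 7] by (simp add: sk)
  have z023: "s 0 2 3 = 0"
    using G1[of 3] G7[of 6] by (simp add: sk)
  have z024: "s 0 2 4 = 0"
    using G1[of 4] G7[of 5] by (simp add: sk)
  have z025: "s 0 2 5 = 0"
    using G7[of 4] G1[of 5] by (simp add: sk)
  have z026: "s 0 2 6 = 0"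
    using G7[of 3] G1[of 6] by (simp add: sk)
  have z027: "s 0 2 7 = 0"
    using G2[of 1] G7[of 1] G1[of 2] G6[of 3] G5[of 4] G1[of 7] by (simp add: sk)
  have z034: "s 0 3 4 = 0"
    using G2[of 0] G7[of 0] by (simp add: sk)
  have z035: "s 0 3 5 = 0"
    using G0[of 1] G4[of 3] G6[of 5] by (simp add: sk)
  have z036: "s 0 3 6 = 0"
    using G0[of 0] G1[of 1] G2[of 2] G3[of 3] G4[of 4] G5[of 5] G6[of 6] G7[of 7] by (simp add: sk)
  have z037: "s 0 3 7 = 0"
    using G4[of 0] G1[of 3] G2[of 6] G7[of 6] by (simp add: sk)
  have z045: "s 0 4 5 = 0"
    using G0[of 0] G1[of 1] G2[of 2] G3[of 3] G4[of 4] G5[of 5] G6[of 6] G7[of 7] by (simp add: sk)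
  have z046: "s 0 4 6 = 0"
    using G1[of 0] G0[of 1] G4[of 3] G6[of 5] by (simp add: sk)
  have z047: "s 0 4 7 = 0"
    using G3[of 0] G1[of 4] G2[of 5] G7[of 5] by (simp add: sk)
  have z056: "s 0 5 6 = 0"
    using G2[of 0] G7[of 0] by (simp add: sk)
  have z057: "s 0 5 7 = 0"
    using G6[of 0] G2[of 4] G7[of 4] G1[of 5] by (simp add: sk)
  have z067: "s 0 6 7 = 0"
    using G5[of 0] G2[of 3] G7[of 3] G1[of 6] by (simp add: sk)
  have z123: "s 1 2 3 = 0"
    using G0[of 3] G7[of 5] by (simp add: sk)
  have z124: "s 1 2 4 = 0"
    using G0[of 4] G7[of 6] by (simp add: sk)
  have z125: "s 1 2 5 = 0"
    using G7[of 3] G0[of 5] by (simp add: sk)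
  have z126: "s 1 2 6 = 0"
    using G7[of 4] G0[of 6] by (simp add: sk)
  have z127: "s 1 2 7 = 0"
    using G2[of 0] G7[of 0] G0[of 2] G5[of 3] G6[of 4] G0[of 7] by (simp add: sk)
  have z134: "s 1 3 4 = 0"
    using G2[of 1] G7[of 1] by (simp add: sk)
  have z135: "s 1 3 5 = 0"
    using G0[of 0] G1[of 1] G2[of 2] G3[of 3] G4[of 4] G5[of 5] G6[of 6] G7[of 7] by (simp add: sk)
  have z136: "s 1 3 6 = 0"
    using G0[of 1] G4[of 3] G6[of 5] by (simp add: sk)
  have z137: "s 1 3 7 = 0"
    using G4[of 1] G0[of 3] G2[of 5] G7[of 5] by (simp add: sk)
  have z145: "s 1 4 5 = 0"
    using G0[of 1] G4[of 3] G6[of 5] by (simp add: sk)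
  have z146: "s 1 4 6 = 0"
    using G0[of 0] G1[of 1] G2[of 2] G3[of 3] G4[of 4] G5[of 5] G6[of 6] G7[of 7] by (simp add: sk)
  have z147: "s 1 4 7 = 0"
    using G3[of 1] G0[of 4] G2[of 6] G7[of 6] by (simp add: sk)
  have z156: "s 1 5 6 = 0"
    using G2[of 1] G7[of 1] by (simp add: sk)
  have z157: "s 1 5 7 = 0"
    using G6[of 1] G2[of 3] G7[of 3] G0[of 5] by (simp add: sk)
  have z167: "s 1 6 7 = 0"
    using G5[of 1] G2[of 4] G7[of 4] G0[of 6] by (simp add: sk)
  have z234: "s 2 3 4 = 0"
    using G0[of 0] G1[of 1] G2[of 2] G7[of 2] G3[of 3] G4[of 4] G5[of 5] G6[of 6] G7[of 7] by (simp add: sk)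
  have z235: "s 2 3 5 = 0"
    using G2[of 1] G6[of 3] G4[of 5] by (simp add: sk)
  have z236: "s 2 3 6 = 0"
    using G2[of 0] G0[of 2] G6[of 4] G3[of 5] by (simp add: sk)
  have z237: "s 2 3 7 = 0"
    using G4[of 2] G7[of 4] G1[of 5] G0[of 6] by (simp add: sk)
  have z245: "s 2 4 5 = 0"
    using G2[of 0] G6[of 4] G3[of 5] by (simp add: sk)
  have z246: "s 2 4 6 = 0"
    using G2[of 1] G1[of 2] G6[of 3] G4[of 5] by (simp add: sk)
  have z247: "s 2 4 7 = 0"
    using G3[of 2] G7[of 3] G0[of 5] G1[of 6] by (simp add: sk)
  have z256: "s 2 5 6 = 0"
    using G0[of 0] G1[of 1] G2[of 2] G7[of 2] G3[of 3] G4[of 4] G5[of 5] G6[of 6] G7[of 7] by (simp add: sk)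
  have z257: "s 2 5 7 = 0"
    using G6[of 2] G1[of 3] G0[of 4] G7[of 6] by (simp add: sk)
  have z267: "s 2 6 7 = 0"
    using G5[of 2] G0[of 3] G1[of 4] G7[of 5] by (simp add: sk)
  have z345: "s 3 4 5 = 0"
    using G7[of 5] by (simp add: sk)
  have z346: "s 3 4 6 = 0"
    using G7[of 6] by (simp add: sk)
  have z347: "s 3 4 7 = 0"
    using G7[of 2] G3[of 3] G4[of 4] G5[of 5] G6[of 6] G7[of 7] by (simp add: sk)
  have z356: "s 3 5 6 = 0"
    using G7[of 3] by (simp add: sk)
  have z357: "s 3 5 7 = 0"
    using G7[of 1] G6[of 3] G4[of 5] by (simp add: sk)
  have z367: "s 3 6 7 = 0"
    using G2[of 0] G7[of 0] G0[of 2] G5[of 3] G6[of 4] G3[of 5] by (simp add: sk)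
  have z456: "s 4 5 6 = 0"
    using G7[of 4] by (simp add: sk)
  have z457: "s 4 5 7 = 0"
    using G7[of 0] G6[of 4] G3[of 5] by (simp add: sk)
  have z467: "s 4 6 7 = 0"
    using G2[of 1] G7[of 1] G1[of 2] G6[of 3] G5[of 4] G4[of 5] by (simp add: sk)
  have z567: "s 5 6 7 = 0"
    using G7[of 2] G3[of 3] G4[of 4] G5[of 5] G6[of 6] G7[of 7] by (simp add: sk)
  note zs = z012 z013 z014 z015 z016 z017 z023 z024 z025 z026 z027 z034 z035 z036 z037 z045 z046 z047
    z056 z057 z067 z123 z124 z125 z126 z127 z134 z135 z136 z137 z145 z146 z147 z156 z157 z167
    z234 z235 z236 z237 z245 z246 z247 z256 z257 z267 z345 z346 z347 z356 z357 z367 z456 z457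
    z467 z567
  have upt: "{..<8::nat} = {0, 1, 2, 3, 4, 5, 6, 7}" by auto
  have "\<forall>i\<in>{..<8}. \<forall>j\<in>{..<8}. \<forall>k\<in>{..<8}. i < j \<longrightarrow> j < k \<longrightarrow> s i j k = 0"
    unfolding upt by (simp add: zs[unfolded One_nat_def])
  then have A: "s i j k = 0" if "i < j" "j < k" "k < 8" for i j k
    using that by (meson lessThan_iff order.strict_trans)
  consider "i = j" | "j = k" | "i = k" | "i < j" "j < k" | "i < k" "k < j" | "j < i" "i < k" | "j < k" "k < i"
    | "k < i" "i < j" | "k < j" "j < i"
    by linarith
  then show ?thesis
  proof cases
    case 1 then show ?thesis by (simp add: sk(1))
  next
    case 2 then show ?thesis by (simp add: sk(2))
  next
    case 3 then show ?thesis using sw1[of j i i] sk(2)[of j i] by simp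
  next
    case 4 then show ?thesis using A less by blast
  next
    case 5 then show ?thesis using A[OF 5 less(2)] sw2[of i k j] by simp
  next
    case 6 then show ?thesis using A[OF 6 less(3)] sw1[of j i k] by simp
  next
    case 7 then show ?thesis using A[OF 7 less(1)] sw1[of j i k] sw2[of j k i] by linarith
  next
    case 8 then show ?thesis using A[OF 8 less(2)] sw2[of i k j] sw1[of k i j] by linarith
  next
    case 9 then show ?thesis using A[OF 9 less(1)] sw2[of i k j] sw1[of k i j] sw2[of k j i] by linarith
  qed
qed

definition su3_tensor :: tensor where
  "su3_tensor = tensor_of su3_form"

lemma form_of_su3_tensor [simp]: "form_of su3_tensor = su3_form"
  unfolding su3_tensor_def by (rule form_of_tensor_of[OF su3_form_alt_forms])

lemma skew_su3_tensor: "skew su3_tensor = su3_tensor"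
  unfolding su3_tensor_def by (rule skew_tensor_of[OF su3_form_alt_forms])

lemma sum_list_upt_8: "(\<Sum>k\<leftarrow>[0..<8]. f k) = (\<Sum>k<8. f k)" for f :: "nat \<Rightarrow> int"
  by (simp add: interv_sum_list_conv_sum_set_nat lessThan_atLeast0)

lemma gram_su3_of_nat:
  assumes "i < 8" "j < 8"
  shows "gram su3_tensor $ of_nat i $ of_nat j = (if i = j then of_int (su3_gram i) else 0)"
proof -
  have "gram su3_tensor $ of_nat i $ of_nat j =
      (\<Sum>k<8. \<Sum>l<8. smul su3_form (e8 i) (e8 l) $ of_nat k * smul su3_form (e8 j) (e8 k) $ of_nat l)"
    by (simp add: gram_def trace_form8_def trace_def matrix_matrix_mult_def matrix_def sum_UNIV_8 e8_def)
  also have "\<dots> = of_int (\<Sum>k<8. \<Sum>l<8. su3_table ! i ! l ! k * su3_table ! j ! k ! l)"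
    using assms by (simp add: su3_smul)
  also have "(\<Sum>k<8. \<Sum>l<8. su3_table ! i ! l ! k * su3_table ! j ! k ! l) = (if i = j then su3_gram i else 0)"
    using su3_table_gram assms unfolding sum_list_upt_8 by simp
  finally show ?thesis by simp
qed

definition su3_weight :: "8 \<Rightarrow> real" where
  "su3_weight i = of_int (su3_gram (idx8 i))"

lemma su3_weight_pos: "su3_weight i > 0"
  by (simp add: su3_weight_def su3_gram_def)

lemma gram_su3: "gram su3_tensor $ i $ j = (if i = j then su3_weight i else 0)"
  using gram_su3_of_nat[OF idx8_less idx8_less, of i j] by (simp add: su3_weight_def)

lemma det_gram_su3: "det (gram su3_tensor) > 0"
  by (subst det_diagonal) (auto simp: gram_su3 su3_weight_pos intro: prod_pos)

lemma adjugate_su3: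
  obtains c where "\<And>i. c i > 0" "\<And>i j. adjugate (gram su3_tensor) $ i $ j = (if i = j then c i else 0)"
proof
  have "gram su3_tensor ** (\<chi> i j. if i = j then 1 / su3_weight i else 0) = mat 1"
    using su3_weight_pos
    by (auto simp: vec_eq_iff matrix_matrix_mult_def gram_su3 mat_def if_distrib[where f = "\<lambda>x. _ * x"] less_imp_neq[THEN not_sym]
        cong: if_cong)
  from adjugate_eq[OF this]
  show "adjugate (gram su3_tensor) $ i $ j = (if i = j then det (gram su3_tensor) / su3_weight i else 0)" for i j
    by simp
  show "det (gram su3_tensor) / su3_weight i > 0" for i
    using det_gram_su3 su3_weight_pos by simp
qed

text \<open>The Gram matrix is diagonal, so both sides expand into trilinear sums over the structure
  constants, which \<open>su3_table_compat\<close> matches termwise.\<close>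

lemma su3_compat:
  "trace_form8 su3_form (smul su3_form a b) c = trace_form8 su3_form a (smul su3_form b c)"
proof -
  let ?\<omega> = su3_form
  define m where "m i j k = smul ?\<omega> (axis i 1) (axis j 1) $ k" for i j k
  have m_compat: "m i j k * su3_weight k = su3_weight i * m j k i" for i j k
  proof -
    have m: "m i j k = of_int (su3_table ! idx8 i ! idx8 j ! idx8 k)" for i j k
      using su3_smul[OF idx8_less idx8_less idx8_less, of i j k] by (simp add: m_def)
    have "su3_table ! idx8 i ! idx8 j ! idx8 k * su3_gram (idx8 k) =
        su3_gram (idx8 i) * su3_table ! idx8 j ! idx8 k ! idx8 i"
      using su3_table_compat idx8_less by (simp add: Ball_def)
    then show ?thesis unfolding m su3_weight_def by (metis of_int_mult)
  qed
  have v: "(\<Sum>i\<in>UNIV. v $ i *\<^sub>R axis i 1) = v" for v :: "real^8"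
    using basis_expansion[of v] by (simp add: scalar_mult_eq_scaleR)
  have expand: "smul ?\<omega> v w $ k = (\<Sum>i\<in>UNIV. \<Sum>j\<in>UNIV. v $ i * w $ j * m i j k)" for v w k
  proof -
    note ll = linear_smul_left[OF su3_form_alt_forms] and lr = linear_smul_right[OF su3_form_alt_forms]
    have "smul ?\<omega> v w = smul ?\<omega> (\<Sum>i\<in>UNIV. v $ i *\<^sub>R axis i 1) (\<Sum>j\<in>UNIV. w $ j *\<^sub>R axis j 1)"
      by (simp add: v)
    also have "\<dots> = (\<Sum>i\<in>UNIV. v $ i *\<^sub>R (\<Sum>j\<in>UNIV. w $ j *\<^sub>R smul ?\<omega> (axis i 1) (axis j 1)))"
      unfolding linear_sum[OF ll] linear_scale[OF ll] unfolding linear_sum[OF lr] linear_scale[OF lr] ..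
    finally show ?thesis
      by (simp add: m_def sum_distrib_left mult.assoc)
  qed
  have tr: "trace_form8 ?\<omega> v w = (\<Sum>i\<in>UNIV. v $ i * su3_weight i * w $ i)" for v w
    using trace_form8_gram[OF skew_su3_tensor, of v w]
    by (simp add: inner_vec_def matrix_vector_mult_def gram_su3 if_distrib[where f = "\<lambda>x. x * _"] mult.assoc cong: if_cong)
  have "trace_form8 ?\<omega> (smul ?\<omega> a b) c =
      (\<Sum>k\<in>UNIV. \<Sum>i\<in>UNIV. \<Sum>j\<in>UNIV. a $ i * b $ j * c $ k * (m i j k * su3_weight k))"
    by (simp add: tr expand sum_distrib_left sum_distrib_right mult_ac)
  also have "\<dots> = (\<Sum>i\<in>UNIV. \<Sum>k\<in>UNIV. \<Sum>j\<in>UNIV. a $ i * b $ j * c $ k * (m i j k * su3_weight k))"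
    by (rule sum.swap)
  also have "\<dots> = (\<Sum>i\<in>UNIV. \<Sum>j\<in>UNIV. \<Sum>k\<in>UNIV. a $ i * b $ j * c $ k * (m i j k * su3_weight k))"
    by (intro sum.cong refl sum.swap)
  also have "\<dots> = (\<Sum>i\<in>UNIV. \<Sum>j\<in>UNIV. \<Sum>k\<in>UNIV. a $ i * b $ j * c $ k * (su3_weight i * m j k i))"
    by (simp only: m_compat)
  also have "\<dots> = trace_form8 ?\<omega> a (smul ?\<omega> b c)"
    by (simp add: tr expand sum_distrib_left mult_ac)
  finally show ?thesis .
qed

text \<open>An index permutation is moved to the other factor as its inverse; the two cyclic ones
  are exchanged and the transpositions are fixed.\<close>

lemma inner_skew: "skew Z \<bullet> X = Z \<bullet> skew X"
proof -
  have in3: "A \<bullet> B = (\<Sum>q\<in>UNIV. A $ q * B $ q)" for A B :: tensor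
    by (simp add: inner_vec_def)
  have reindex: "(\<Sum>q\<in>UNIV. Z $ \<pi> q * X $ q) = (\<Sum>q\<in>UNIV. Z $ q * X $ \<pi>' q)"
    if "\<And>q. \<pi> (\<pi>' q) = q" "\<And>q. \<pi>' (\<pi> q) = q" for \<pi> \<pi>' :: "8 \<times> 8 \<times> 8 \<Rightarrow> 8 \<times> 8 \<times> 8"
    by (rule sum.reindex_bij_witness[of _ \<pi>' \<pi>]) (auto simp: that)
  have s: "skew W $ q = (W $ q + W $ (fst (snd q), snd (snd q), fst q) + W $ (snd (snd q), fst q, fst (snd q))
      - W $ (fst (snd q), fst q, snd (snd q)) - W $ (fst q, snd (snd q), fst (snd q))
      - W $ (snd (snd q), fst (snd q), fst q)) / 6" for W q
    by (cases q) (simp add: skew_nth)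
  show ?thesis
    unfolding in3 s
    using reindex[of "\<lambda>q. (fst (snd q), snd (snd q), fst q)" "\<lambda>q. (snd (snd q), fst q, fst (snd q))"]
      reindex[of "\<lambda>q. (snd (snd q), fst q, fst (snd q))" "\<lambda>q. (fst (snd q), snd (snd q), fst q)"]
      reindex[of "\<lambda>q. (fst (snd q), fst q, snd (snd q))" "\<lambda>q. (fst (snd q), fst q, snd (snd q))"]
      reindex[of "\<lambda>q. (fst q, snd (snd q), fst (snd q))" "\<lambda>q. (fst q, snd (snd q), fst (snd q))"]
      reindex[of "\<lambda>q. (snd (snd q), fst (snd q), fst q)" "\<lambda>q. (snd (snd q), fst (snd q), fst q)"]
    by (simp add: ring_distribs add_divide_distrib diff_divide_distrib sum.distrib sum_subtractf
        flip: sum_divide_distrib)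
qed

text \<open>Each index pair is met in both orders, with two signs that cancel; hence the factor
  2.\<close>

lemma sum_terms_form_pair:
  fixes t :: "nat \<Rightarrow> nat \<Rightarrow> real"
  assumes t: "\<And>j k. t k j = - t j k" and L: "valid_terms 2 L"
  shows "(\<Sum>j<8. \<Sum>k<8. t j k * terms_form L [e8 j, e8 k]) = 2 * (\<Sum>(c, ps)\<leftarrow>L. of_int c * t (ps ! 0) (ps ! 1))"
  using L
proof (induction L)
  case (Cons u L)
  obtain c "is" where u: "u = (c, is)" by (cases u)
  then have "length is = 2" using Cons.prems by (simp add: valid_terms_simps)
  then obtain p q where "is": "is = [p, q]" by (rule length2_obtain)
  have pq: "p < 8" "q < 8" using Cons.prems by (auto simp: u "is" valid_terms_simps)
  have "(\<Sum>j<8. \<Sum>k<8. t j k * gram_det [e8 p, e8 q] [e8 j, e8 k]) = t p q - t q p"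
  proof -
    have "(\<Sum>j<8. \<Sum>k<8. t j k * gram_det [e8 p, e8 q] [e8 j, e8 k]) =
        (\<Sum>j<8. \<Sum>k<8. (if j = p then if k = q then t j k else 0 else 0) - (if k = p then if j = q then t j k else 0 else 0))"
      using pq by (intro sum.cong refl) (auto simp: gram_det_2 inner_e8)
    also have "\<dots> = (\<Sum>j<8. if j = p then t j q else 0) - (\<Sum>j<8. if j = q then t j p else 0)"
    proof -
      have "(\<Sum>k<8. (if j = p then if k = q then t j k else 0 else 0) - (if k = p then if j = q then t j k else 0 else 0)) =
          (if j = p then t j q else 0) - (if j = q then t j p else 0)" for j
        using pq by (simp add: sum_subtractf)
      then show ?thesis by (simp add: sum_subtractf)
    qed
    finally show ?thesis using pq by simp
  qed
  then have "(\<Sum>j<8. \<Sum>k<8. t j k * (of_int c * gram_det [e8 p, e8 q] [e8 j, e8 k])) = 2 * (of_int c * t p q)"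
    using t[of p q] by (simp add: mult.left_commute[of _ "of_int c"] flip: sum_distrib_left)
  then show ?case
    using Cons by (simp add: u "is" valid_terms_simps terms_form_simps distrib_left sum.distrib)
qed (simp add: terms_form_simps)

text \<open>Pairing the image of \<sigma> with \<sigma> in the metric gives a sum of squares with
  positive weights. Hence the adjoint orbit map kills \<sigma>, and \<open>su3_kernel\<close>
  applies.\<close>

lemma inf_endo_su3_eq_0:
  assumes \<sigma>: "skew \<sigma> = \<sigma>" and 0: "inf_endo su3_tensor \<sigma> = 0"
  shows "\<sigma> = 0"
proof -
  obtain c where c_pos: "\<And>i. c i > 0"
    and C: "\<And>i j. adjugate (gram su3_tensor) $ i $ j = (if i = j then c i else 0)"
    by (rule adjugate_su3) blast
  \<comment> \<open>\<sigma> with all indices raised by the diagonal adjugate: the Euclidean product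
    with \<open>Z\<close> is the metric product with \<sigma>.\<close>
  define Z :: tensor where "Z = (\<chi> q. \<sigma> $ q * (c (fst q) * c (fst (snd q)) * c (snd (snd q))))"
  have Z: "Z $ (i, j, k) = \<sigma> $ (i, j, k) * (c i * c j * c k)" for i j k by (simp add: Z_def)
  have "skew Z $ (i, j, k) = skew \<sigma> $ (i, j, k) * (c i * c j * c k)" for i j k
    by (simp add: skew_nth Z field_simps)
  then have skZ: "skew Z = Z" by (simp add: tensor_eq_iff \<sigma> Z)
  \<comment> \<open>The entries of \<open>inf_act_adj su3_tensor \<sigma>\<close> without their
    column weights; their squares appear in the sum below.\<close>
  define U where "U a b = (\<Sum>j\<in>UNIV. \<Sum>k\<in>UNIV. \<sigma> $ (a, j, k) * (c j * c k) * su3_tensor $ (b, j, k))" for a b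
  have A: "inf_act_adj su3_tensor \<sigma> $ a $ b = U a b * c b" for a b
  proof -
    have m: "x * (if P then y else 0) = (if P then x * y else 0)" "(if P then y else 0) * x = (if P then y * x else 0)"
      for P and x y :: real by auto
    have 1: "(N ** adjugate (gram su3_tensor)) $ a $ b = N $ a $ b * c b" for N :: "real^8^8"
      by (simp add: matrix_matrix_mult_def C m)
    have 2: "(M ** transpose (slices su3_tensor)) $ a $ b = (\<Sum>j\<in>UNIV. \<Sum>k\<in>UNIV. M $ a $ (j, k) * su3_tensor $ (b, j, k))"
      for M :: "real^(8 \<times> 8)^8"
      by (simp add: matrix_matrix_mult_def sum_UNIV_prod transpose_def slices_def)
    have 3: "(slices \<sigma> ** kron (adjugate (gram su3_tensor)) (adjugate (gram su3_tensor))) $ a $ (j, k) =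
        \<sigma> $ (a, j, k) * (c j * c k)" for j k
      by (simp add: matrix_matrix_mult_def sum_UNIV_prod kron_def C slices_def m)
    show ?thesis unfolding inf_act_adj_def 1 2 3 U_def ..
  qed
  have "0 = Z \<bullet> inf_endo su3_tensor \<sigma>" by (simp add: 0)
  also have "\<dots> = Z \<bullet> unslice (inf_act_adj su3_tensor \<sigma> ** slices su3_tensor)"
    by (simp add: inf_endo_def inf_act_def skZ flip: inner_skew)
  also have "\<dots> = (\<Sum>a\<in>UNIV. \<Sum>j\<in>UNIV. \<Sum>k\<in>UNIV. \<Sum>b\<in>UNIV.
      \<sigma> $ (a, j, k) * (c a * c j * c k) * (U a b * c b * su3_tensor $ (b, j, k)))"
    by (simp add: inner_vec_def sum_UNIV_prod Z unslice_def matrix_matrix_mult_def A slices_def sum_distrib_left)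
  also have "\<dots> = (\<Sum>a\<in>UNIV. \<Sum>b\<in>UNIV. c a * c b * (U a b)\<^sup>2)"
  proof (rule sum.cong[OF refl])
    fix a
    let ?f = "\<lambda>j k b. \<sigma> $ (a, j, k) * (c a * c j * c k) * (U a b * c b * su3_tensor $ (b, j, k))"
    have "(\<Sum>j\<in>UNIV. \<Sum>k\<in>UNIV. \<Sum>b\<in>UNIV. ?f j k b) = (\<Sum>j\<in>UNIV. \<Sum>b\<in>UNIV. \<Sum>k\<in>UNIV. ?f j k b)"
      by (intro sum.cong refl sum.swap)
    also have "\<dots> = (\<Sum>b\<in>UNIV. \<Sum>j\<in>UNIV. \<Sum>k\<in>UNIV. ?f j k b)"
      by (rule sum.swap)
    also have "\<dots> = (\<Sum>b\<in>UNIV. c a * c b * U a b * U a b)"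
      unfolding U_def[of a] sum_distrib_left[of "c a * c _ * _"] by (simp add: U_def[symmetric] mult_ac)
    finally show "(\<Sum>j\<in>UNIV. \<Sum>k\<in>UNIV. \<Sum>b\<in>UNIV. ?f j k b) = (\<Sum>b\<in>UNIV. c a * c b * (U a b)\<^sup>2)"
      by (simp add: power2_eq_square mult.assoc)
  qed
  finally have sum0: "(\<Sum>a\<in>UNIV. \<Sum>b\<in>UNIV. c a * c b * (U a b)\<^sup>2) = 0" ..
  have nn: "c a * c b * (U a b)\<^sup>2 \<ge> 0" for a b
    using c_pos[of a] c_pos[of b] by simp
  have U0: "U a b = 0" for a b
  proof -
    have "(\<Sum>b\<in>UNIV. c a * c b * (U a b)\<^sup>2) = 0"
      using sum0 by (subst (asm) sum_nonneg_eq_0_iff) (auto intro: sum_nonneg nn)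
    then have "c a * c b * (U a b)\<^sup>2 = 0"
      by (subst (asm) sum_nonneg_eq_0_iff) (auto intro: nn)
    then show ?thesis using c_pos[of a] c_pos[of b] by simp
  qed
  define s where "s i j k = Z $ (of_nat i, of_nat j, of_nat k)" for i j k
  have "s i j k = 0" if "i < 8" "j < 8" "k < 8" for i j k
  proof (rule su3_kernel[OF _ _ _ that])
    show "s j i k = - s i j k" "s i k j = - s i j k" for i j k
      unfolding s_def by (rule skew_swap[OF skZ])+
    fix a b :: nat assume ab: "a < 8" "b < 8"
    have "2 * (\<Sum>(c, ps)\<leftarrow>contract_terms b su3_terms. of_int c * s a (ps ! 0) (ps ! 1)) =
        (\<Sum>j<8. \<Sum>k<8. s a j k * terms_form (contract_terms b su3_terms) [e8 j, e8 k])"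
      by (rule sum_terms_form_pair[OF _ interior_prod_terms_form(2)[OF ab(2) valid_su3_terms], symmetric])
        (unfold s_def, rule skew_swap(2)[OF skZ])
    also have "\<dots> = (\<Sum>j<8. \<Sum>k<8. s a j k * su3_tensor $ (of_nat b, of_nat j, of_nat k))"
      by (simp add: su3_tensor_def su3_form_def interior_prod_def e8_def
          flip: interior_prod_terms_form(1)[OF ab(2) valid_su3_terms])
    also have "\<dots> = c (of_nat a) * U (of_nat a) (of_nat b)"
      by (simp add: s_def Z U_def sum_UNIV_8 sum_distrib_left mult_ac)
    finally show "(\<Sum>(c, ps)\<leftarrow>contract_terms b su3_terms. of_int c * s a (ps ! 0) (ps ! 1)) = 0"
      by (simp add: U0)
  qed
  then have "Z $ (i, j, k) = 0" for i j k
    using idx8_less[of i] idx8_less[of j] idx8_less[of k] by (metis of_nat_idx8 s_def)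
  moreover have "c i * c j * c k \<noteq> 0" for i j k
    using c_pos by (metis less_irrefl mult_eq_0_iff)
  ultimately show ?thesis by (simp add: tensor_eq_iff Z)
qed

text \<open>A preimage of \<sigma> under \<open>full_endo W\<close> exists; applying
  \<open>skew\<close> deletes the summand on the complement, and what remains is a value of
  \<open>inf_endo W\<close>, hence tangent to the orbit.\<close>

lemma surj_inf_act_of_full_det:
  assumes "full_det W \<noteq> 0" "skew \<sigma> = \<sigma>"
  shows "\<exists>A. \<sigma> = inf_act A W"
proof -
  obtain K where K: "matrix (full_endo W) ** K = mat 1"
    using assms(1) unfolding full_det_def by (metis invertible_det_nz invertible_def)
  define \<tau> where "\<tau> = K *v \<sigma>"
  have "full_endo W \<tau> = matrix (full_endo W) *v \<tau>"
    by (rule matrix_works_real[OF linear_full_endo, symmetric])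
  then have "full_endo W \<tau> = \<sigma>"
    by (simp add: \<tau>_def matrix_vector_mul_assoc K)
  then have "\<sigma> = skew (full_endo W \<tau>)" by (simp add: assms(2))
  also have "\<dots> = inf_endo W (inf_endo W (inf_endo W (skew \<tau>)))"
    by (simp add: full_endo_def linear_add[OF linear_skew] linear_scale[OF linear_skew] linear_diff[OF linear_skew])
  finally show ?thesis unfolding inf_endo_def by blast
qed

text \<open>On a kernel vector, \<open>inf_endo_su3_eq_0\<close> used three times kills the skew
  part, and the non-zero discriminant kills the rest.\<close>

lemma full_det_su3: "full_det su3_tensor \<noteq> 0"
proof -
  have "x = 0" if x: "full_endo su3_tensor x = 0" for x
  proof -
    have "skew (full_endo su3_tensor x) = inf_endo su3_tensor (inf_endo su3_tensor (inf_endo su3_tensor (skew x)))"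
      by (simp add: full_endo_def linear_add[OF linear_skew] linear_scale[OF linear_skew] linear_diff[OF linear_skew])
    then have "inf_endo su3_tensor (inf_endo su3_tensor (inf_endo su3_tensor (skew x))) = 0"
      by (simp add: x linear_0[OF linear_skew])
    then have "skew x = 0"
      using inf_endo_su3_eq_0 by simp
    then show ?thesis
      using x det_gram_su3 by (simp add: full_endo_def linear_0[OF linear_inf_endo])
  qed
  then have "\<exists>B. B ** matrix (full_endo su3_tensor) = mat 1"
    unfolding matrix_left_invertible_ker matrix_works_real[OF linear_full_endo] by blast
  then show ?thesis
    unfolding full_det_def by (metis det_I det_mul mult_zero_right zero_neq_one)
qed

section \<open>Passing from the reference form to all forms\<close>

lemma su3_orbit_line:
  assumes W: "skew W = W"
  shows "\<forall>\<^sub>F t in at 0. \<exists>H. det H \<noteq> 0 \<and> su3_tensor + t *\<^sub>R (W - su3_tensor) = pull_tensor H su3_tensor"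
proof -
  let ?\<gamma> = "\<lambda>t. su3_tensor + t *\<^sub>R (W - su3_tensor)"
  obtain e where e: "e > 0" "\<And>V. skew V = V \<Longrightarrow> dist su3_tensor V < e \<Longrightarrow> \<exists>H. det H \<noteq> 0 \<and> V = pull_tensor H su3_tensor"
    using orbit_neighbourhood[OF skew_su3_tensor surj_inf_act_of_full_det[OF full_det_su3]] by blast
  have "(?\<gamma> \<longlongrightarrow> su3_tensor + 0 *\<^sub>R (W - su3_tensor)) (at 0)"
    by (intro tendsto_intros)
  then have "\<forall>\<^sub>F t in at 0. dist (?\<gamma> t) su3_tensor < e"
    using e(1) by (auto dest: tendstoD)
  then show ?thesis
    by (rule eventually_mono)
      (rule e(2), simp_all add: dist_commute linear_add[OF linear_skew] linear_scale[OF linear_skew]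
        linear_diff[OF linear_skew] W skew_su3_tensor)
qed

lemma full_det_nonzero:
  assumes W: "skew W = W" and disc: "det (gram W) \<noteq> 0"
  shows "full_det W \<noteq> 0"
proof -
  define \<gamma> where "\<gamma> t = su3_tensor + t *\<^sub>R (W - su3_tensor)" for t
  interpret polynomial_path \<gamma>
    unfolding \<gamma>_def by (rule polynomial_path_line[OF skew_su3_tensor W])
  let ?n = "CARD(8 \<times> 8 \<times> 8)" and ?Q = "det (gram su3_tensor)"
  \<comment> \<open>On the orbit, the ratio of \<open>full_det\<close> to its reference value is the
    \<open>8 * ?n\<close>-th power of the corresponding ratio of discriminants, because both have
    weight 144 times the dimension. Clearing denominators gives a polynomial in
    \<open>t\<close>.\<close>
  define f where "f t = full_det (\<gamma> t) * ?Q ^ (8 * ?n) - det (gram (\<gamma> t)) ^ (8 * ?n) * full_det su3_tensor" for t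
  have "polyfun f"
    unfolding f_def by (intro polyfun_diff polyfun_mult polyfun_power polyfun_const polyfun_full_det polyfun_disc)
  moreover have "\<forall>\<^sub>F t in at 0. f t = 0"
    using su3_orbit_line[OF W]
  proof (rule eventually_mono)
    fix t assume "\<exists>H. det H \<noteq> 0 \<and> su3_tensor + t *\<^sub>R (W - su3_tensor) = pull_tensor H su3_tensor"
    then obtain H where H: "det H \<noteq> 0" "\<gamma> t = pull_tensor H su3_tensor" by (auto simp: \<gamma>_def)
    have Q0: "?Q \<noteq> 0" using det_gram_su3 by simp
    have "(det H ^ 144) ^ ?n = (det H ^ 18) ^ (8 * ?n)"
      by (simp only: power_mult[symmetric] mult.assoc[symmetric]) simp
    then show "f t = 0"
      unfolding f_def H(2) full_det_pull[OF skew_su3_tensor H(1) Q0] det_gram_pull[OF skew_su3_tensor H(1)]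
        power_mult_distrib by (simp only: mult_ac diff_self)
  qed
  ultimately have "f 1 = 0" by (rule polyfun_zero_near)
  then have "full_det W * ?Q ^ (8 * ?n) = det (gram W) ^ (8 * ?n) * full_det su3_tensor"
    by (simp add: f_def \<gamma>_def)
  moreover have "det (gram W) ^ (8 * ?n) * full_det su3_tensor \<noteq> 0"
    using disc full_det_su3 by simp
  ultimately show ?thesis by auto
qed

lemma trace_form8_compat:
  assumes W: "skew W = W"
  shows "trace_form8 (form_of W) (smul (form_of W) a b) c = trace_form8 (form_of W) a (smul (form_of W) b c)"
proof -
  define \<gamma> where "\<gamma> t = su3_tensor + t *\<^sub>R (W - su3_tensor)" for t
  interpret polynomial_path \<gamma>
    unfolding \<gamma>_def by (rule polynomial_path_line[OF skew_su3_tensor W])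
  define f where "f t = trace_form8 (form_of (\<gamma> t)) (smul (form_of (\<gamma> t)) a b) c
    - trace_form8 (form_of (\<gamma> t)) a (smul (form_of (\<gamma> t)) b c)" for t
  have "polyfun f" unfolding f_def by (rule polyfun_compat)
  moreover have "\<forall>\<^sub>F t in at 0. f t = 0"
    using su3_orbit_line[OF W]
  proof (rule eventually_mono)
    fix t assume "\<exists>H. det H \<noteq> 0 \<and> su3_tensor + t *\<^sub>R (W - su3_tensor) = pull_tensor H su3_tensor"
    then obtain H where H: "det H \<noteq> 0" "\<gamma> t = pull_tensor H su3_tensor" by (auto simp: \<gamma>_def)
    let ?m = "smul su3_form"
    have tr_l: "trace_form8 su3_form (r *\<^sub>R v) w = r * trace_form8 su3_form v w"
      and tr_r: "trace_form8 su3_form v (r *\<^sub>R w) = r * trace_form8 su3_form v w" for r v w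
      using trace_form8_gram[OF skew_su3_tensor]
      by (simp_all add: matrix_vector_mult_scaleR)
    \<comment> \<open>Both sides acquire the same scalar: the square of \<open>det H\<close> from
      the trace form and one more factor from the product.\<close>
    show "f t = 0"
      unfolding f_def H(2) pull_form_of[symmetric] form_of_su3_tensor
        trace_form8_pull[OF su3_form_alt_forms H(1)] smul_pull[OF su3_form_alt_forms] tr_l tr_r su3_compat
      by simp
  qed
  ultimately have "f 1 = 0" by (rule polyfun_zero_near)
  then show ?thesis by (simp add: f_def \<gamma>_def)
qed

section \<open>Stability\<close>

text \<open>The action substitutes the inverse of \<open>g\<close>, so \<open>H\<close> is the
  matrix of \<open>inv g\<close>; the orbit is the same because inversion permutes the
  group.\<close>

lemma gl_orbit_eq:
  assumes \<omega>: "\<omega> \<in> alt_forms 3"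
  shows "(\<lambda>g. gl_act g \<omega>) ` GL = {form_of (pull_tensor H (tensor_of \<omega>)) | H. det H \<noteq> 0}"
proof -
  have act: "gl_act g \<omega> = form_of (pull_tensor H (tensor_of \<omega>))" if "inv g = (*v) H" for g H
    unfolding pull_form_of[symmetric] form_of_tensor_of[OF \<omega>] by (simp add: gl_act_def pull_def fun_eq_iff that)
  show ?thesis
  proof (intro set_eqI iffI)
    fix \<eta> assume "\<eta> \<in> (\<lambda>g. gl_act g \<omega>) ` GL"
    then obtain g where g: "linear g" "bij g" "\<eta> = gl_act g \<omega>" by (auto simp: GL_def)
    let ?G = "matrix g" and ?H = "matrix (inv g)"
    have lin: "linear (inv g)"
    proof -
      obtain h where h: "linear h" "h \<circ> g = id"
        using linear_injective_left_inverse[OF g(1)] g(2) by (auto simp: bij_def)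
      have "inv g = h"
      proof
        fix y
        obtain x where y: "y = g x" using g(2) by (metis bij_pointE)
        show "inv g y = h y"
          using fun_cong[OF h(2), of x] inv_f_f[OF bij_is_inj[OF g(2)], of x] by (simp add: y)
      qed
      then show ?thesis using h(1) by simp
    qed
    have H: "inv g = (*v) ?H" by (simp add: fun_eq_iff matrix_works_real[OF lin])
    have "?H ** ?G = matrix (inv g \<circ> g)" by (rule matrix_compose[OF g(1) lin, symmetric])
    also have "\<dots> = mat 1" using g(2) by (simp add: bij_is_inj matrix_id_mat_1)
    finally have "det ?H * det ?G = 1" by (simp only: det_mul[symmetric] det_I)
    then have "det ?H \<noteq> 0" by auto
    then show "\<eta> \<in> {form_of (pull_tensor H (tensor_of \<omega>)) | H. det H \<noteq> 0}"
      using act[OF H] g(3) by blast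
  next
    fix \<eta> assume "\<eta> \<in> {form_of (pull_tensor H (tensor_of \<omega>)) | H. det H \<noteq> 0}"
    then obtain H where H: "det H \<noteq> 0" "\<eta> = form_of (pull_tensor H (tensor_of \<omega>))" by blast
    then obtain L where L: "L ** H = mat 1" "H ** L = mat 1"
      by (metis invertible_det_nz invertible_def)
    have "inv ((*v) L) = (*v) H"
      by (rule inv_unique_comp) (simp_all add: fun_eq_iff matrix_vector_mul_assoc L)
    moreover have "bij ((*v) L)"
      by (rule o_bij[of "(*v) H"]) (simp_all add: fun_eq_iff matrix_vector_mul_assoc L)
    ultimately show "\<eta> \<in> (\<lambda>g. gl_act g \<omega>) ` GL"
      using act[of "(*v) L" H] H(2) by (intro image_eqI[of _ _ "(*v) L"]) (simp_all add: GL_def)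
  qed
qed

text \<open>Under pointwise convergence, evaluation at a fixed list is continuous, and the
  components are such evaluations.\<close>

lemma continuous_on_tensor_of: "continuous_on UNIV tensor_of"
  unfolding tensor_of_def by (intro continuous_on_vec_lambda continuous_on_product_coordinates)

text \<open>The discriminant stays non-zero along the whole orbit by semi-invariance, so
  \<open>orbit_neighbourhood\<close> applies at each of its points; composing group elements leads
  back to the orbit of \<omega>.\<close>

lemma stable_if_disc:
  assumes \<omega>: "\<omega> \<in> alt_forms 3" and disc: "det (gram (tensor_of \<omega>)) \<noteq> 0"
  shows "stable3 \<omega>"
proof -
  let ?W = "tensor_of \<omega>"
  define orb where "orb = {pull_tensor H ?W | H. det H \<noteq> 0}"
  have W: "skew ?W = ?W" by (rule skew_tensor_of[OF \<omega>])
  have orb_skew: "skew V = V" if "V \<in> orb" for V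
    using that by (auto simp: orb_def skew_pull W)
  have "\<exists>e>0. \<forall>V'. skew V' = V' \<and> dist V V' < e \<longrightarrow> V' \<in> orb" if V: "V \<in> orb" for V
  proof -
    obtain H where H: "det H \<noteq> 0" "V = pull_tensor H ?W" using V by (auto simp: orb_def)
    have "det (gram V) \<noteq> 0" unfolding H(2) det_gram_pull[OF W H(1)] using H(1) disc by simp
    from orbit_neighbourhood[OF orb_skew[OF V] surj_inf_act_of_full_det[OF full_det_nonzero[OF orb_skew[OF V] this]]]
    obtain e where e: "e > 0" "\<And>V'. skew V' = V' \<Longrightarrow> dist V V' < e \<Longrightarrow> \<exists>K. det K \<noteq> 0 \<and> V' = pull_tensor K V"
      by blast
    have "V' \<in> orb" if V': "skew V' = V'" "dist V V' < e" for V'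
    proof -
      obtain K where K: "det K \<noteq> 0" "V' = pull_tensor K V" using e(2)[OF V'] by blast
      then have "V' = pull_tensor (H ** K) ?W" "det (H ** K) \<noteq> 0"
        using H by (simp_all add: pull_tensor_mult det_mul)
      then show ?thesis unfolding orb_def by blast
    qed
    then show ?thesis using e(1) by blast
  qed
  then obtain \<epsilon> where \<epsilon>: "\<And>V. V \<in> orb \<Longrightarrow> \<epsilon> V > 0"
    "\<And>V V'. V \<in> orb \<Longrightarrow> skew V' = V' \<Longrightarrow> dist V V' < \<epsilon> V \<Longrightarrow> V' \<in> orb"
    by metis
  \<comment> \<open>An open set of tensors that meets the skew ones exactly in the orbit. Its
    preimage under \<open>tensor_of\<close> witnesses relative openness among the forms.\<close>
  define U where "U = (\<Union>V\<in>orb. ball V (\<epsilon> V))"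
  have "open (tensor_of -` U)"
    by (rule open_vimage[OF _ continuous_on_tensor_of]) (auto simp: U_def)
  moreover have "(\<lambda>g. gl_act g \<omega>) ` GL = alt_forms 3 \<inter> tensor_of -` U"
  proof -
    have 1: "(\<lambda>g. gl_act g \<omega>) ` GL = form_of ` orb"
      unfolding gl_orbit_eq[OF \<omega>] orb_def by blast
    show ?thesis
    proof (intro set_eqI iffI)
      fix \<eta> assume "\<eta> \<in> (\<lambda>g. gl_act g \<omega>) ` GL"
      then obtain V where "V \<in> orb" "\<eta> = form_of V" unfolding 1 by blast
      moreover from this have "V \<in> U"
        using \<epsilon>(1) unfolding U_def by (intro UN_I[of V]) auto
      ultimately show "\<eta> \<in> alt_forms 3 \<inter> tensor_of -` U"
        using orb_skew by (simp add: form_of_alt_forms)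
    next
      fix \<eta> assume \<eta>: "\<eta> \<in> alt_forms 3 \<inter> tensor_of -` U"
      then have "tensor_of \<eta> \<in> orb"
        using \<epsilon>(2) by (auto simp: U_def skew_tensor_of)
      then show "\<eta> \<in> (\<lambda>g. gl_act g \<omega>) ` GL"
        unfolding 1 using \<eta> form_of_tensor_of by (metis IntD1 image_eqI)
    qed
  qed
  ultimately show ?thesis unfolding stable3_def openin_open by blast
qed

lemma disc_if_stable:
  assumes \<omega>: "\<omega> \<in> alt_forms 3" and st: "stable3 \<omega>"
  shows "det (gram (tensor_of \<omega>)) \<noteq> 0"
proof
  let ?W = "tensor_of \<omega>"
  assume disc: "det (gram ?W) = 0"
  have W: "skew ?W = ?W" by (rule skew_tensor_of[OF \<omega>])
  define \<gamma> where "\<gamma> t = ?W + t *\<^sub>R (su3_tensor - ?W)" for t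
  interpret polynomial_path \<gamma>
    unfolding \<gamma>_def by (rule polynomial_path_line[OF W skew_su3_tensor])
  obtain T where T: "open T" "(\<lambda>g. gl_act g \<omega>) ` GL = alt_forms 3 \<inter> T"
    using st unfolding stable3_def openin_open by blast
  have "\<omega> \<in> (\<lambda>g. gl_act g \<omega>) ` GL"
  proof -
    have "\<omega> = form_of (pull_tensor (mat 1) ?W)" by (simp add: form_of_tensor_of[OF \<omega>])
    moreover have "det (mat 1 :: real^8^8) \<noteq> 0" by simp
    ultimately show ?thesis unfolding gl_orbit_eq[OF \<omega>] by blast
  qed
  then have "\<omega> \<in> T" using T(2) by blast
  moreover have g0: "form_of (\<gamma> 0) = \<omega>" by (simp add: \<gamma>_def form_of_tensor_of[OF \<omega>])
  \<comment> \<open>Continuity into the space of functions is checked at each list separately, where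
    the curve is polynomial.\<close>
  moreover have "continuous_on UNIV (\<lambda>t. form_of (\<gamma> t))"
  proof (rule continuous_on_coordinatewise_then_product)
    fix xs
    obtain p where p: "(\<lambda>t. form_of (\<gamma> t) xs) = poly p" using polyfun_form[of xs] by (auto simp: polyfun_def)
    show "continuous_on UNIV (\<lambda>t. form_of (\<gamma> t) xs)"
      using continuous_on_poly[OF continuous_on_id, of UNIV p] unfolding p by simp
  qed
  ultimately have "open ((\<lambda>t. form_of (\<gamma> t)) -` T)" "0 \<in> (\<lambda>t. form_of (\<gamma> t)) -` T"
    using T(1) by (auto intro: open_vimage)
  then have "\<forall>\<^sub>F t in at 0. t \<in> (\<lambda>t. form_of (\<gamma> t)) -` T"
    by (rule eventually_at_in_open')
  then have "\<forall>\<^sub>F t in at 0. det (gram (\<gamma> t)) = 0"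
  proof (rule eventually_mono)
    fix t assume "t \<in> (\<lambda>t. form_of (\<gamma> t)) -` T"
    then have "form_of (\<gamma> t) \<in> (\<lambda>g. gl_act g \<omega>) ` GL"
      using T(2) form_of_alt_forms[OF skew_path] by blast
    then obtain H where H: "det H \<noteq> 0" "form_of (\<gamma> t) = form_of (pull_tensor H ?W)"
      unfolding gl_orbit_eq[OF \<omega>] by blast
    then have "\<gamma> t = pull_tensor H ?W" by (metis tensor_of_form_of)
    then show "det (gram (\<gamma> t)) = 0" by (simp add: det_gram_pull[OF W H(1)] disc)
  qed
  then have "det (gram (\<gamma> 1)) = 0" by (rule polyfun_zero_near[OF polyfun_disc])
  then show False using det_gram_su3 by (simp add: \<gamma>_def)
qed

text \<open>A multivector of top degree is determined on 8-forms by its value at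
  \<open>vol8\<close>, so pairing with its square multiplies the Gram matrix by a non-zero square,
  whichever \<open>\<rho>\<close> is chosen.\<close>

lemma trace_form_nondegenerate_iff:
  assumes \<omega>: "\<omega> \<in> alt_forms 3"
  shows "trace_form_nondegenerate \<omega> \<longleftrightarrow> det (gram (tensor_of \<omega>)) \<noteq> 0"
proof -
  let ?G = "gram (tensor_of \<omega>)"
  have pair: "pair_square (trace_form \<omega> v w) \<rho> = (\<rho> vol8)\<^sup>2 * (v \<bullet> (?G *v w))" if "\<rho> \<in> multivectors 8" for \<rho> v w
  proof -
    have sc: "\<rho> (\<lambda>xs. r * vol8 xs) = r * \<rho> vol8" for r
      using that vol8_alt_forms unfolding multivectors_def by blast
    have te: "trace_form \<omega> v w xs = (\<lambda>ys. (v \<bullet> (?G *v w) * vol8 xs) * vol8 ys)" for xs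
      using trace_form8_gram[OF skew_tensor_of[OF \<omega>], of v w]
      by (simp add: fun_eq_iff trace_form_eq[OF \<omega>] form_of_tensor_of[OF \<omega>])
    have "pair_square (trace_form \<omega> v w) \<rho> = \<rho> (\<lambda>xs. (v \<bullet> (?G *v w) * vol8 xs) * \<rho> vol8)"
      by (simp only: pair_square_def te sc)
    also have "\<dots> = \<rho> (\<lambda>xs. (v \<bullet> (?G *v w) * \<rho> vol8) * vol8 xs)"
      by (simp only: mult_ac)
    also have "\<dots> = (v \<bullet> (?G *v w) * \<rho> vol8) * \<rho> vol8"
      by (rule sc)
    finally show ?thesis by (simp add: power2_eq_square)
  qed
  have nz: "\<rho> vol8 \<noteq> 0" if "nonzero_multivector 8 \<rho>" for \<rho> :: "((real^8) list \<Rightarrow> real) \<Rightarrow> real"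
  proof -
    obtain \<alpha> where \<alpha>: "\<alpha> \<in> alt_forms 8" "\<rho> \<alpha> \<noteq> 0" and \<rho>: "\<rho> \<in> multivectors 8"
      using \<open>nonzero_multivector 8 \<rho>\<close> by (auto simp: nonzero_multivector_def)
    have "\<alpha> = (\<lambda>xs. \<alpha> basis8 * vol8 xs)"
    proof
      fix xs
      show "\<alpha> xs = \<alpha> basis8 * vol8 xs"
        unfolding alt_forms_8_eq[OF \<alpha>(1), of xs] by (simp add: vol8_basis8)
    qed
    then have "\<rho> \<alpha> = \<rho> (\<lambda>xs. \<alpha> basis8 * vol8 xs)" by simp
    also have "\<dots> = \<alpha> basis8 * \<rho> vol8"
      using \<rho> vol8_alt_forms unfolding multivectors_def by blast
    finally show ?thesis using \<alpha>(2) by auto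
  qed
  \<comment> \<open>Evaluation at the standard basis, that is, the wedge product of the basis
    vectors, is the witness for the converse direction.\<close>
  have ex: "nonzero_multivector 8 (\<lambda>\<alpha> :: (real^8) list \<Rightarrow> real. \<alpha> basis8)"
    unfolding nonzero_multivector_def multivectors_def
    using vol8_alt_forms vol8_basis8 by (auto intro!: bexI[of _ vol8])
  have deg: "nondegenerate_form (\<lambda>v w. r * (v \<bullet> (?G *v w))) \<longleftrightarrow> det ?G \<noteq> 0" if "r \<noteq> 0" for r
  proof -
    have "(\<forall>w. r * (v \<bullet> (?G *v w)) = 0) \<longleftrightarrow> transpose ?G *v v = 0" for v
    proof -
      have "(\<forall>w. (transpose ?G *v v) \<bullet> w = 0) \<longleftrightarrow> transpose ?G *v v = 0"
        by (metis inner_eq_zero_iff inner_zero_left)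
      then show ?thesis using that by (simp add: transpose_matrix_vector dot_lmul_matrix)
    qed
    then have "nondegenerate_form (\<lambda>v w. r * (v \<bullet> (?G *v w))) \<longleftrightarrow> (\<exists>B. B ** transpose ?G = mat 1)"
      by (simp add: nondegenerate_form_def matrix_left_invertible_ker)
    also have "\<dots> \<longleftrightarrow> det (transpose ?G) \<noteq> 0"
      by (metis invertible_det_nz invertible_left_inverse)
    finally show ?thesis by (simp only: det_transpose)
  qed
  show ?thesis
  proof
    assume "trace_form_nondegenerate \<omega>"
    then obtain \<rho> where \<rho>: "nonzero_multivector 8 \<rho>"
      "nondegenerate_form (\<lambda>v w. pair_square (trace_form \<omega> v w) \<rho>)"
      unfolding trace_form_nondegenerate_def by blast
    then have "\<rho> \<in> multivectors 8" by (simp add: nonzero_multivector_def)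
    from \<rho>(2) show "det ?G \<noteq> 0"
      unfolding pair[OF \<open>\<rho> \<in> multivectors 8\<close>] using deg[of "(\<rho> vol8)\<^sup>2"] nz[OF \<rho>(1)] by simp
  next
    assume G: "det ?G \<noteq> 0"
    let ?\<rho> = "\<lambda>\<alpha> :: (real^8) list \<Rightarrow> real. \<alpha> basis8"
    have mv: "?\<rho> \<in> multivectors 8" using ex by (simp add: nonzero_multivector_def)
    have "nondegenerate_form (\<lambda>v w. pair_square (trace_form \<omega> v w) ?\<rho>)"
      unfolding pair[OF mv] using deg[of 1] G by (simp add: vol8_basis8)
    with ex show "trace_form_nondegenerate \<omega>" unfolding trace_form_nondegenerate_def by blast
  qed
qed

theorem proposition3p6:
  fixes \<omega> :: "(real^8) list \<Rightarrow> real"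
  assumes "\<omega> \<in> alt_forms 3"
  shows "(\<forall>a b c. extend (\<lambda>x. trace_form \<omega> x c) (S_map \<omega> a b)
                = extend (\<lambda>x. trace_form \<omega> a x) (S_map \<omega> b c)) \<and>
         (trace_form_nondegenerate \<omega> \<longleftrightarrow> stable3 \<omega>)"
proof (intro conjI allI)
  fix a b c
  have sc: "trace_form8 \<omega> (r *\<^sub>R v) w = r * trace_form8 \<omega> v w" "trace_form8 \<omega> v (r *\<^sub>R w) = r * trace_form8 \<omega> v w"
    for r v w
    using trace_form8_gram[OF skew_tensor_of[OF assms]]
    by (simp_all add: form_of_tensor_of[OF assms] matrix_vector_mult_scaleR)
  have "trace_form8 \<omega> (smul \<omega> a b) c = trace_form8 \<omega> a (smul \<omega> b c)"
    using trace_form8_compat[OF skew_tensor_of[OF assms], of a b c] by (simp add: form_of_tensor_of[OF assms])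
  then show "extend (\<lambda>x. trace_form \<omega> x c) (S_map \<omega> a b) = extend (\<lambda>x. trace_form \<omega> a x) (S_map \<omega> b c)"
    by (simp add: extend_def fun_eq_iff trace_form_eq[OF assms] S_map_smul[OF assms] sc)
next
  show "trace_form_nondegenerate \<omega> \<longleftrightarrow> stable3 \<omega>"
    using trace_form_nondegenerate_iff[OF assms] stable_if_disc[OF assms] disc_if_stable[OF assms] by blast
qed

end
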